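(* Let $k=\mathbb{F}_q$ be a finite field of odd characteristic, $(Q,\sigma)$ a quiver with involution and duality structure $(s,\tau)$, and $\theta$ a $\sigma$-compatible stability. The Harder–Narasimhan recursion in the Hall module $\mathcal{M}_Q$, $$\mathbf{1}^\sigma_d=\sum_{(d^\bullet;d^\infty)}\mathbf{1}^\theta_{d^1}\cdots\mathbf{1}^\theta_{d^n}\star\mathbf{1}^{\sigma,\theta}_{d^\infty}\qquad(d\in\Lambda_Q^{\sigma,+}),$$ where the sum is over all $n\ge0$ and $(d^\bullet;d^\infty)=(d^1,\dots,d^n;d^\infty)\in(\Lambda_Q^+)^n\times\Lambda_Q^{\sigma,+}$ with all $d^i\neq0$, $\sum_{i=1}^nH(d^i)+d^\infty=d$ and $\mu(d^1)>\cdots>\mu(d^n)>0$, is solved as follows: for each $d\in\Lambda_Q^{\sigma,+}$, $$\mathbf{1}^{\sigma,\theta}_d=\sum_{(d^\bullet;d^\infty)}(-1)^n\,\mathbf{1}_{d^1}\cdots\mathbf{1}_{d^n}\star\mathbf{1}^\sigma_{d^\infty},$$ where the sum is over all $n\ge0$ and $(d^\bullet;d^\infty)=(d^1,\dots,d^n;d^\infty)\in(\Lambda_Q^+)^n\times\Lambda_Q^{\sigma,+}$ with all $d^i\ne0$, of $\sigma$-weight $\sum_{i=1}^nH(d^i)+d^\infty=d$, which are equal to $(\varnothing;d)$ (the case $n=0$) or satisfy $\mu\big(\sum_{i=1}^jd^i\big)>0$ for all $j=1,\dots,n$.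
   Context: Quivers. $Q$ is a quiver with finite sets of nodes $Q_0$ and arrows $Q_1$; $\Lambda_Q=\mathbb{Z}Q_0$, $\Lambda_Q^+=\mathbb{Z}_{\ge 0}Q_0$. A representation $M$ consists of finite dimensional $k$-vector spaces $M_i$ and linear maps $m_\alpha:M_i\to M_j$ for arrows $\alpha:i\to j$; $\mathbf{dim}\,M=\sum_i(\dim M_i)\,i$. Involutions and duality structures. An involution $\sigma$ of $Q$ is a pair of involutions of $Q_0$ and $Q_1$ such that $\alpha:i\to j$ is sent to $\sigma(\alpha):\sigma(j)\to\sigma(i)$, and every arrow of the form $i\to\sigma(i)$ is fixed by $\sigma$. It acts on $\Lambda_Q$; $\Lambda_Q^{\sigma,+}\subset\Lambda_Q^+$ denotes the $\sigma$-invariants, and $H(d)=d+\sigma(d)$. A duality structure is a pair $s:Q_0\to\{\pm1\}$, $\tau:Q_1\to\{\pm1\}$ with $s$ $\sigma$-invariant and $\tau_\alpha\tau_{\sigma(\alpha)}=s_is_j$ for every $\alpha:i\to j$. Self-dual representations. A self-dual representation is a representation $M$ with a non-degenerate bilinear form $\langle\cdot,\cdot\rangle$ on $\bigoplus_iM_i$ such that $M_i$ and $M_j$ are orthogonal unless $i=\sigma(j)$; $\langle x,x'\rangle=s_i\langle x',x\rangle$ for $x,x'\in M_i+M_{\sigma(i)}$; and $\langle m_\alpha x,x'\rangle=\tau_\alpha\langle x,m_{\sigma(\alpha)}x'\rangle$ for every $\alpha:i\to j$, $x\in M_i$, $x'\in M_{\sigma(j)}$. Isometries are isomorphisms preserving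 the forms; $\simeq_S$ means isometric. A subrepresentation $U\subset N$ is isotropic if $U\subset U^\perp$; then $N/\!/U:=U^\perp/U$ with its induced self-dual structure. Stability. A stability is $\theta\in\mathrm{Hom}_{\mathbb Z}(\Lambda_Q,\mathbb Z)$, $\sigma$-compatible if $\theta\circ\sigma=-\theta$. The slope of $0\ne d\in\Lambda_Q^+$ is $\mu(d)=\theta(d)/\sum_id_i$, and $\mu(U)=\mu(\mathbf{dim}\,U)$. A representation $U$ is semistable if $\mu(V)\le\mu(U)$ for all non-zero subrepresentations $V\subsetneq U$. A self-dual representation $M$ (which has slope $0$) is semistable if $\mu(V)\le0$ for all non-zero isotropic subrepresentations $V\subset M$ (equivalently, if it is semistable as an ordinary representation). The zero self-dual representation counts as semistable. Hall algebra and Hall module. $\mathcal{H}_Q$ is the associative $\mathbb{Q}$-algebra with basis the isomorphism classes $[U]$ of $\mathbb{F}_q$-representations and product $[U]\cdot[V]=\sum_XF^X_{U,V}[X]$, $F^X_{U,V}=\#\{\tilde U\subset X\mid\tilde U\simeq U,\ X/\tilde U\simeq V\}$. $\mathcal{M}_Q$ is the left $\mathcal{H}_Q$-module with $\mathbb{Q}$-basis the isometry classes $[M]$ of self-dual $\mathbb{F}_q$-representations and action $[U]\star[M]=\sum_NG^N_{U,M}[N]$, $G^N_{U,M}=\#\{\tilde U\subset N\mid\tilde U\simeq U,\ \tilde U\text{ isotropic},\ N/\!/\tilde U\simeq_SM\}$. Characteristic functions. $\mathbf{1}_d=\sum_{\mathbf{dim}\,U=d}[U]\in\mathcal{H}_Q$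 and $\mathbf{1}_d^\sigma=\sum_{\mathbf{dim}\,M=d}[M]\in\mathcal{M}_Q$ (sums over isomorphism, respectively isometry, classes); $\mathbf{1}_d^\theta$ and $\mathbf{1}_d^{\sigma,\theta}$ are the analogous sums over semistable representations, respectively semistable self-dual representations, of dimension vector $d$. *)

theory Defs
  imports
    "HOL-Algebra.Free_Abelian_Groups"
    "HOL-Algebra.AbelCoset"
    "Graph_Theory.Digraph"
    "Jordan_Normal_Form.VS_Connect"
begin

section \<open>Quivers with involution and duality structure\<close>

text \<open>
  A quiver is a finite directed multigraph, loops allowed. The record adds the two components of
  \<open>\<sigma>\<close> and the sign functions \<open>s\<close> and \<open>\<tau>\<close>; all four only matter on nodes and arrows of the quiver.
\<close>

record ('v, 'a) dquiver = "('v, 'a) pre_digraph" +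
  node_inv :: "'v \<Rightarrow> 'v"
  arrow_inv :: "'a \<Rightarrow> 'a"
  node_sgn :: "'v \<Rightarrow> int"
  arrow_sgn :: "'a \<Rightarrow> int"

definition quiver_with_involution :: "('v, 'a) dquiver \<Rightarrow> bool" where
  "quiver_with_involution Q \<longleftrightarrow>
     fin_digraph (pre_digraph.truncate Q) \<and>
     (\<forall>i\<in>verts Q. node_inv Q i \<in> verts Q \<and> node_inv Q (node_inv Q i) = i) \<and>
     (\<forall>a\<in>arcs Q. arrow_inv Q a \<in> arcs Q \<and> arrow_inv Q (arrow_inv Q a) = a \<and>
        tail Q (arrow_inv Q a) = node_inv Q (head Q a) \<and>
        head Q (arrow_inv Q a) = node_inv Q (tail Q a)) \<and>
     (\<forall>a\<in>arcs Q. head Q a = node_inv Q (tail Q a) \<longrightarrow> arrow_inv Q a = a)"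

definition duality_structure :: "('v, 'a) dquiver \<Rightarrow> bool" where
  "duality_structure Q \<longleftrightarrow>
     (\<forall>i\<in>verts Q. node_sgn Q i \<in> {1, -1} \<and> node_sgn Q (node_inv Q i) = node_sgn Q i) \<and>
     (\<forall>a\<in>arcs Q. arrow_sgn Q a \<in> {1, -1} \<and>
        arrow_sgn Q a * arrow_sgn Q (arrow_inv Q a) = node_sgn Q (tail Q a) * node_sgn Q (head Q a))"


section \<open>Dimension vectors and stabilities\<close>

text \<open>The lattice \<open>\<Lambda>\<^sub>Q = \<int>Q\<^sub>0\<close> is \<^term>\<open>free_Abelian_group (verts Q)\<close>.\<close>

definition dimvecs :: "('v, 'a) dquiver \<Rightarrow> ('v \<Rightarrow>\<^sub>0 int) set" where
  "dimvecs Q = {d \<in> carrier (free_Abelian_group (verts Q)). \<forall>i. 0 \<le> Poly_Mapping.lookup d i}"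

definition dual_dimvec :: "('v, 'a) dquiver \<Rightarrow> ('v \<Rightarrow>\<^sub>0 int) \<Rightarrow> ('v \<Rightarrow>\<^sub>0 int)" where
  "dual_dimvec Q d = frag_extend (\<lambda>i. frag_of (node_inv Q i)) d"

definition sd_dimvecs :: "('v, 'a) dquiver \<Rightarrow> ('v \<Rightarrow>\<^sub>0 int) set" where
  "sd_dimvecs Q = {d \<in> dimvecs Q. dual_dimvec Q d = d}"

definition hyperbolic_dimvec :: "('v, 'a) dquiver \<Rightarrow> ('v \<Rightarrow>\<^sub>0 int) \<Rightarrow> ('v \<Rightarrow>\<^sub>0 int)" where
  "hyperbolic_dimvec Q d = d + dual_dimvec Q d"

definition stability :: "('v, 'a) dquiver \<Rightarrow> (('v \<Rightarrow>\<^sub>0 int) \<Rightarrow> int) \<Rightarrow> bool" where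
  "stability Q \<theta> \<longleftrightarrow> \<theta> \<in> hom (free_Abelian_group (verts Q)) integer_group"

definition compatible_stability :: "('v, 'a) dquiver \<Rightarrow> (('v \<Rightarrow>\<^sub>0 int) \<Rightarrow> int) \<Rightarrow> bool" where
  "compatible_stability Q \<theta> \<longleftrightarrow> stability Q \<theta> \<and>
     (\<forall>d\<in>carrier (free_Abelian_group (verts Q)). \<theta> (dual_dimvec Q d) = - \<theta> d)"

definition slope :: "('v, 'a) dquiver \<Rightarrow> (('v \<Rightarrow>\<^sub>0 int) \<Rightarrow> int) \<Rightarrow> ('v \<Rightarrow>\<^sub>0 int) \<Rightarrow> rat" where
  "slope Q \<theta> d = of_int (\<theta> d) / of_int (\<Sum>i\<in>verts Q. Poly_Mapping.lookup d i)"


section \<open>Representations\<close>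

text \<open>
  The ground field is a type \<open>'k\<close>, seen as the ring record \<^term>\<open>class_ring :: 'k::field ring\<close>.
  The elements of the vector spaces of a representation live in an arbitrary type \<open>'x\<close>, so that
  quotients, whose elements are cosets, are again representations (over \<open>'x set\<close>).
\<close>

record ('k, 'v, 'a, 'x) rep =
  node_space :: "'v \<Rightarrow> ('k, 'x) module"
  arrow_map :: "'a \<Rightarrow> 'x \<Rightarrow> 'x"

definition representation ::
  "('v, 'a) dquiver \<Rightarrow> ('k::field, 'v, 'a, 'x, 'm) rep_scheme \<Rightarrow> bool" where
  "representation Q M \<longleftrightarrow>
     (\<forall>i\<in>verts Q. vectorspace (class_ring :: 'k ring) (node_space M i) \<and>
        vectorspace.fin_dim (class_ring :: 'k ring) (node_space M i)) \<and>
     (\<forall>a\<in>arcs Q. linear_map (class_ring :: 'k ring)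
        (node_space M (tail Q a)) (node_space M (head Q a)) (arrow_map M a))"

definition dimvec ::
  "('v, 'a) dquiver \<Rightarrow> ('k::field, 'v, 'a, 'x, 'm) rep_scheme \<Rightarrow> ('v \<Rightarrow>\<^sub>0 int)" where
  "dimvec Q M =
     (\<Sum>i\<in>verts Q.
        frag_cmul (int (vectorspace.dim (class_ring :: 'k ring) (node_space M i))) (frag_of i))"

definition rep_isomorphism ::
  "('v, 'a) dquiver \<Rightarrow> ('k::field, 'v, 'a, 'x, 'm) rep_scheme \<Rightarrow>
     ('k, 'v, 'a, 'y, 'n) rep_scheme \<Rightarrow> ('v \<Rightarrow> 'x \<Rightarrow> 'y) \<Rightarrow> bool" where
  "rep_isomorphism Q M N f \<longleftrightarrow>
     (\<forall>i\<in>verts Q. linear_map (class_ring :: 'k ring) (node_space M i) (node_space N i) (f i) \<and>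
        bij_betw (f i) (carrier (node_space M i)) (carrier (node_space N i))) \<and>
     (\<forall>a\<in>arcs Q. \<forall>x\<in>carrier (node_space M (tail Q a)).
        f (head Q a) (arrow_map M a x) = arrow_map N a (f (tail Q a) x))"

definition isomorphic ::
  "('v, 'a) dquiver \<Rightarrow> ('k::field, 'v, 'a, 'x, 'm) rep_scheme \<Rightarrow>
     ('k, 'v, 'a, 'y, 'n) rep_scheme \<Rightarrow> bool" where
  "isomorphic Q M N \<longleftrightarrow> (\<exists>f. rep_isomorphism Q M N f)"

text \<open>
  Subrepresentations are families of subspaces, required to be extensional on the set of nodes so
  that they can be counted.
\<close>

definition subreps ::
  "('v, 'a) dquiver \<Rightarrow> ('k::field, 'v, 'a, 'x, 'm) rep_scheme \<Rightarrow> ('v \<Rightarrow> 'x set) set" where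
  "subreps Q M =
     {U \<in> (\<Pi>\<^sub>E i\<in>verts Q. {S. VectorSpace.subspace (class_ring :: 'k ring) S (node_space M i)}).
        \<forall>a\<in>arcs Q. arrow_map M a ` U (tail Q a) \<subseteq> U (head Q a)}"

definition zero_sub ::
  "('v, 'a) dquiver \<Rightarrow> ('k::field, 'v, 'a, 'x, 'm) rep_scheme \<Rightarrow> 'v \<Rightarrow> 'x set" where
  "zero_sub Q M = (\<lambda>i\<in>verts Q. {\<zero>\<^bsub>node_space M i\<^esub>})"

definition full_sub ::
  "('v, 'a) dquiver \<Rightarrow> ('k::field, 'v, 'a, 'x, 'm) rep_scheme \<Rightarrow> 'v \<Rightarrow> 'x set" where
  "full_sub Q M = (\<lambda>i\<in>verts Q. carrier (node_space M i))"

definition sub_rep ::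
  "('k::field, 'v, 'a, 'x, 'm) rep_scheme \<Rightarrow> ('v \<Rightarrow> 'x set) \<Rightarrow> ('k, 'v, 'a, 'x) rep" where
  "sub_rep M U =
     \<lparr>node_space = (\<lambda>i. (node_space M i)\<lparr>carrier := U i\<rparr>), arrow_map = arrow_map M\<rparr>"

text \<open>
  The quotient of a vector space by a subspace \<open>S\<close>. Scalars and, below, arrows act on a coset
  elementwise; the result is enlarged by \<open>S\<close> to a full coset (\<open>0 \<cdot> A\<close> would otherwise be \<open>{0}\<close>).
\<close>

definition quot_space :: "('k::field, 'x) module \<Rightarrow> 'x set \<Rightarrow> ('k, 'x set) module" where
  "quot_space V S =
     \<lparr>carrier = a_rcosets\<^bsub>V\<^esub> S, mult = undefined, one = undefined,
      zero = S, add = (\<lambda>A B. A <+>\<^bsub>V\<^esub> B), smult = (\<lambda>c A. S <+>\<^bsub>V\<^esub> ((\<lambda>x. c \<odot>\<^bsub>V\<^esub> x) ` A))\<rparr>"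

definition quot_rep ::
  "('v, 'a) dquiver \<Rightarrow> ('k::field, 'v, 'a, 'x, 'm) rep_scheme \<Rightarrow> ('v \<Rightarrow> 'x set) \<Rightarrow>
     ('k, 'v, 'a, 'x set) rep" where
  "quot_rep Q M U =
     \<lparr>node_space = (\<lambda>i. quot_space (node_space M i) (U i)),
      arrow_map = (\<lambda>a A. U (head Q a) <+>\<^bsub>node_space M (head Q a)\<^esub> (arrow_map M a ` A))\<rparr>"

definition semistable ::
  "('v, 'a) dquiver \<Rightarrow> (('v \<Rightarrow>\<^sub>0 int) \<Rightarrow> int) \<Rightarrow> ('k::field, 'v, 'a, 'x, 'm) rep_scheme \<Rightarrow> bool" where
  "semistable Q \<theta> M \<longleftrightarrow>
     (\<forall>U\<in>subreps Q M. U \<noteq> zero_sub Q M \<longrightarrow> U \<noteq> full_sub Q M \<longrightarrow>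
        slope Q \<theta> (dimvec Q (sub_rep M U)) \<le> slope Q \<theta> (dimvec Q M))"


section \<open>Self-dual representations\<close>

text \<open>
  A bilinear form on \<open>\<Oplus>\<^sub>i M\<^sub>i\<close> is given by its components \<open>form M i j : M\<^sub>i \<times> M\<^sub>j \<rightarrow> k\<close>;
  the value on two elements of the direct sum is recovered as \<open>pairing\<close>.
\<close>

record ('k, 'v, 'a, 'x) sd_rep = "('k, 'v, 'a, 'x) rep" +
  form :: "'v \<Rightarrow> 'v \<Rightarrow> 'x \<Rightarrow> 'x \<Rightarrow> 'k"

definition pairing ::
  "('v, 'a) dquiver \<Rightarrow> ('k::field, 'v, 'a, 'x) sd_rep \<Rightarrow> ('v \<Rightarrow> 'x) \<Rightarrow> ('v \<Rightarrow> 'x) \<Rightarrow> 'k" where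
  "pairing Q M x y = (\<Sum>i\<in>verts Q. \<Sum>j\<in>verts Q. form M i j (x i) (y j))"

definition bilinear_on ::
  "('k::field, 'x) module \<Rightarrow> ('k, 'x) module \<Rightarrow> ('x \<Rightarrow> 'x \<Rightarrow> 'k) \<Rightarrow> bool" where
  "bilinear_on V W b \<longleftrightarrow>
     (\<forall>x\<in>carrier V. \<forall>x'\<in>carrier V. \<forall>y\<in>carrier W. b (x \<oplus>\<^bsub>V\<^esub> x') y = b x y + b x' y) \<and>
     (\<forall>x\<in>carrier V. \<forall>y\<in>carrier W. \<forall>y'\<in>carrier W. b x (y \<oplus>\<^bsub>W\<^esub> y') = b x y + b x y') \<and>
     (\<forall>c. \<forall>x\<in>carrier V. \<forall>y\<in>carrier W. b (c \<odot>\<^bsub>V\<^esub> x) y = c * b x y \<and> b x (c \<odot>\<^bsub>W\<^esub> y) = c * b x y)"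

definition self_dual_rep :: "('v, 'a) dquiver \<Rightarrow> ('k::field, 'v, 'a, 'x) sd_rep \<Rightarrow> bool" where
  "self_dual_rep Q M \<longleftrightarrow>
     representation Q M \<and>
     (\<forall>i\<in>verts Q. \<forall>j\<in>verts Q. bilinear_on (node_space M i) (node_space M j) (form M i j)) \<and>
     (\<forall>x\<in>(\<Pi>\<^sub>E i\<in>verts Q. carrier (node_space M i)).
        (\<forall>y\<in>(\<Pi>\<^sub>E i\<in>verts Q. carrier (node_space M i)). pairing Q M x y = 0) \<longrightarrow>
        (\<forall>i\<in>verts Q. x i = \<zero>\<^bsub>node_space M i\<^esub>)) \<and>
     (\<forall>i\<in>verts Q. \<forall>j\<in>verts Q. i \<noteq> node_inv Q j \<longrightarrow>
        (\<forall>x\<in>carrier (node_space M i). \<forall>y\<in>carrier (node_space M j). form M i j x y = 0)) \<and>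
     (\<forall>i\<in>verts Q. \<forall>j\<in>{i, node_inv Q i}. \<forall>j'\<in>{i, node_inv Q i}.
        \<forall>x\<in>carrier (node_space M j). \<forall>x'\<in>carrier (node_space M j').
          form M j j' x x' = of_int (node_sgn Q i) * form M j' j x' x) \<and>
     (\<forall>a\<in>arcs Q. \<forall>x\<in>carrier (node_space M (tail Q a)).
        \<forall>x'\<in>carrier (node_space M (node_inv Q (head Q a))).
          form M (head Q a) (node_inv Q (head Q a)) (arrow_map M a x) x' =
          of_int (arrow_sgn Q a) *
            form M (tail Q a) (node_inv Q (tail Q a)) x (arrow_map M (arrow_inv Q a) x'))"

definition isometric ::
  "('v, 'a) dquiver \<Rightarrow> ('k::field, 'v, 'a, 'x) sd_rep \<Rightarrow> ('k, 'v, 'a, 'y) sd_rep \<Rightarrow> bool" where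
  "isometric Q M N \<longleftrightarrow>
     (\<exists>f. rep_isomorphism Q M N f \<and>
        (\<forall>i\<in>verts Q. \<forall>j\<in>verts Q. \<forall>x\<in>carrier (node_space M i). \<forall>y\<in>carrier (node_space M j).
           form N i j (f i x) (f j y) = form M i j x y))"

definition perp ::
  "('v, 'a) dquiver \<Rightarrow> ('k::field, 'v, 'a, 'x) sd_rep \<Rightarrow> ('v \<Rightarrow> 'x set) \<Rightarrow> 'v \<Rightarrow> 'x set" where
  "perp Q N U =
     (\<lambda>i\<in>verts Q. {x \<in> carrier (node_space N i). \<forall>j\<in>verts Q. \<forall>y\<in>U j. form N i j x y = 0})"

definition isotropic_subreps ::
  "('v, 'a) dquiver \<Rightarrow> ('k::field, 'v, 'a, 'x) sd_rep \<Rightarrow> ('v \<Rightarrow> 'x set) set" where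
  "isotropic_subreps Q N = {U \<in> subreps Q N. \<forall>i\<in>verts Q. U i \<subseteq> perp Q N U i}"

text \<open>The reduction \<open>N // U = U\<^sup>\<bottom> / U\<close>; the form of two cosets is that of any representatives.\<close>

definition reduction ::
  "('v, 'a) dquiver \<Rightarrow> ('k::field, 'v, 'a, 'x) sd_rep \<Rightarrow> ('v \<Rightarrow> 'x set) \<Rightarrow>
     ('k, 'v, 'a, 'x set) sd_rep" where
  "reduction Q N U =
     \<lparr>node_space = node_space (quot_rep Q (sub_rep N (perp Q N U)) U),
      arrow_map = arrow_map (quot_rep Q (sub_rep N (perp Q N U)) U),
      form = (\<lambda>i j A B. THE c. \<exists>x\<in>A. \<exists>y\<in>B. c = form N i j x y)\<rparr>"

definition sd_semistable ::
  "('v, 'a) dquiver \<Rightarrow> (('v \<Rightarrow>\<^sub>0 int) \<Rightarrow> int) \<Rightarrow> ('k::field, 'v, 'a, 'x) sd_rep \<Rightarrow> bool" where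
  "sd_semistable Q \<theta> M \<longleftrightarrow>
     (\<forall>U\<in>isotropic_subreps Q M. U \<noteq> zero_sub Q M \<longrightarrow> slope Q \<theta> (dimvec Q (sub_rep M U)) \<le> 0)"


section \<open>The Hall algebra\<close>

text \<open>
  Isomorphism and isometry classes are formed among the (self-dual) representations whose spaces
  are carried by subsets of \<^typ>\<open>nat\<close>. Over a finite field every finite dimensional vector space
  is finite, so every (self-dual) representation has an isomorphic (isometric) copy of this kind.
\<close>

type_synonym ('k, 'v, 'a) rep_class = "('k, 'v, 'a, nat) rep set"
type_synonym ('k, 'v, 'a) sd_class = "('k, 'v, 'a, nat) sd_rep set"
type_synonym ('k, 'v, 'a) hall_algebra = "('k, 'v, 'a) rep_class \<Rightarrow>\<^sub>0 rat"
type_synonym ('k, 'v, 'a) hall_module = "('k, 'v, 'a) sd_class \<Rightarrow>\<^sub>0 rat"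

definition iso_rel :: "('v, 'a) dquiver \<Rightarrow> ('k::field, 'v, 'a, nat) rep rel" where
  "iso_rel Q = {(M, N). representation Q M \<and> representation Q N \<and> isomorphic Q M N}"

definition iso_classes :: "('v, 'a) dquiver \<Rightarrow> ('k::field, 'v, 'a) rep_class set" where
  "iso_classes Q = {M. representation Q M} // iso_rel Q"

definition class_repr :: "'r set \<Rightarrow> 'r" where
  "class_repr A = (SOME M. M \<in> A)"

definition hall_number ::
  "('v, 'a) dquiver \<Rightarrow> ('k::field, 'v, 'a, 'x) rep \<Rightarrow> ('k, 'v, 'a, 'y) rep \<Rightarrow>
     ('k, 'v, 'a, 'z) rep \<Rightarrow> nat" where
  "hall_number Q X U V =
     card {W \<in> subreps Q X. isomorphic Q (sub_rep X W) U \<and> isomorphic Q (quot_rep Q X W) V}"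

definition hall_mult ::
  "('v, 'a) dquiver \<Rightarrow> ('k::field, 'v, 'a) hall_algebra \<Rightarrow> ('k, 'v, 'a) hall_algebra \<Rightarrow>
     ('k, 'v, 'a) hall_algebra" where
  "hall_mult Q f g =
     (\<Sum>A\<in>Poly_Mapping.keys f. \<Sum>B\<in>Poly_Mapping.keys g.
        let F = (\<lambda>C. hall_number Q (class_repr C) (class_repr A) (class_repr B)) in
        \<Sum>C\<in>{C \<in> iso_classes Q. F C \<noteq> 0}.
          Poly_Mapping.single C (Poly_Mapping.lookup f A * Poly_Mapping.lookup g B * of_nat (F C)))"

definition zero_rep :: "('k::field, 'v, 'a, nat) rep" where
  "zero_rep =
     \<lparr>node_space = (\<lambda>_. \<lparr>carrier = {0}, mult = (\<lambda>_ _. 0), one = 0, zero = 0,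
                         add = (\<lambda>_ _. 0), smult = (\<lambda>_ _. 0)\<rparr>),
      arrow_map = (\<lambda>_ _. 0)\<rparr>"

text \<open>The unit of the Hall algebra is the class of the zero representation.\<close>

definition hall_one :: "('v, 'a) dquiver \<Rightarrow> ('k::field, 'v, 'a) hall_algebra" where
  "hall_one Q = Poly_Mapping.single (iso_rel Q `` {zero_rep}) 1"

definition hall_prod ::
  "('v, 'a) dquiver \<Rightarrow> ('k::field, 'v, 'a) hall_algebra list \<Rightarrow> ('k, 'v, 'a) hall_algebra" where
  "hall_prod Q fs = foldr (hall_mult Q) fs (hall_one Q)"


section \<open>The Hall module\<close>

definition isometry_rel :: "('v, 'a) dquiver \<Rightarrow> ('k::field, 'v, 'a, nat) sd_rep rel" where
  "isometry_rel Q = {(M, N). self_dual_rep Q M \<and> self_dual_rep Q N \<and> isometric Q M N}"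

definition isometry_classes :: "('v, 'a) dquiver \<Rightarrow> ('k::field, 'v, 'a) sd_class set" where
  "isometry_classes Q = {M. self_dual_rep Q M} // isometry_rel Q"

definition hall_module_number ::
  "('v, 'a) dquiver \<Rightarrow> ('k::field, 'v, 'a, 'x) sd_rep \<Rightarrow> ('k, 'v, 'a, 'y) rep \<Rightarrow>
     ('k, 'v, 'a, 'z) sd_rep \<Rightarrow> nat" where
  "hall_module_number Q N U M =
     card {W \<in> isotropic_subreps Q N. isomorphic Q (sub_rep N W) U \<and> isometric Q (reduction Q N W) M}"

definition hall_act ::
  "('v, 'a) dquiver \<Rightarrow> ('k::field, 'v, 'a) hall_algebra \<Rightarrow> ('k, 'v, 'a) hall_module \<Rightarrow>
     ('k, 'v, 'a) hall_module" where
  "hall_act Q f m =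
     (\<Sum>A\<in>Poly_Mapping.keys f. \<Sum>B\<in>Poly_Mapping.keys m.
        let G = (\<lambda>C. hall_module_number Q (class_repr C) (class_repr A) (class_repr B)) in
        \<Sum>C\<in>{C \<in> isometry_classes Q. G C \<noteq> 0}.
          Poly_Mapping.single C (Poly_Mapping.lookup f A * Poly_Mapping.lookup m B * of_nat (G C)))"

definition hall_module_scale ::
  "rat \<Rightarrow> ('k, 'v, 'a) hall_module \<Rightarrow> ('k, 'v, 'a) hall_module" where
  "hall_module_scale c m = Poly_Mapping.map ((*) c) m"


section \<open>Characteristic functions\<close>

definition char_all ::
  "('v, 'a) dquiver \<Rightarrow> ('v \<Rightarrow>\<^sub>0 int) \<Rightarrow> ('k::field, 'v, 'a) hall_algebra" where
  "char_all Q d =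
     (\<Sum>A\<in>{A \<in> iso_classes Q. dimvec Q (class_repr A) = d}. Poly_Mapping.single A 1)"

definition char_ss ::
  "('v, 'a) dquiver \<Rightarrow> (('v \<Rightarrow>\<^sub>0 int) \<Rightarrow> int) \<Rightarrow> ('v \<Rightarrow>\<^sub>0 int) \<Rightarrow>
     ('k::field, 'v, 'a) hall_algebra" where
  "char_ss Q \<theta> d =
     (\<Sum>A\<in>{A \<in> iso_classes Q. dimvec Q (class_repr A) = d \<and> semistable Q \<theta> (class_repr A)}.
        Poly_Mapping.single A 1)"

definition char_sd_all ::
  "('v, 'a) dquiver \<Rightarrow> ('v \<Rightarrow>\<^sub>0 int) \<Rightarrow> ('k::field, 'v, 'a) hall_module" where
  "char_sd_all Q d =
     (\<Sum>A\<in>{A \<in> isometry_classes Q. dimvec Q (class_repr A) = d}. Poly_Mapping.single A 1)"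

definition char_sd_ss ::
  "('v, 'a) dquiver \<Rightarrow> (('v \<Rightarrow>\<^sub>0 int) \<Rightarrow> int) \<Rightarrow> ('v \<Rightarrow>\<^sub>0 int) \<Rightarrow>
     ('k::field, 'v, 'a) hall_module" where
  "char_sd_ss Q \<theta> d =
     (\<Sum>A\<in>{A \<in> isometry_classes Q. dimvec Q (class_repr A) = d \<and> sd_semistable Q \<theta> (class_repr A)}.
        Poly_Mapping.single A 1)"


section \<open>Index sets of the two sums\<close>

definition weighted_tuples ::
  "('v, 'a) dquiver \<Rightarrow> ('v \<Rightarrow>\<^sub>0 int) \<Rightarrow> (('v \<Rightarrow>\<^sub>0 int) list \<times> ('v \<Rightarrow>\<^sub>0 int)) set" where
  "weighted_tuples Q d =
     {(ds, e). set ds \<subseteq> dimvecs Q - {0} \<and> e \<in> sd_dimvecs Q \<and>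
        sum_list (map (hyperbolic_dimvec Q) ds) + e = d}"

definition HN_tuples ::
  "('v, 'a) dquiver \<Rightarrow> (('v \<Rightarrow>\<^sub>0 int) \<Rightarrow> int) \<Rightarrow> ('v \<Rightarrow>\<^sub>0 int) \<Rightarrow>
     (('v \<Rightarrow>\<^sub>0 int) list \<times> ('v \<Rightarrow>\<^sub>0 int)) set" where
  "HN_tuples Q \<theta> d =
     {(ds, e) \<in> weighted_tuples Q d. sorted_wrt (>) (map (slope Q \<theta>) ds @ [0])}"

definition resolution_tuples ::
  "('v, 'a) dquiver \<Rightarrow> (('v \<Rightarrow>\<^sub>0 int) \<Rightarrow> int) \<Rightarrow> ('v \<Rightarrow>\<^sub>0 int) \<Rightarrow>
     (('v \<Rightarrow>\<^sub>0 int) list \<times> ('v \<Rightarrow>\<^sub>0 int)) set" where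
  "resolution_tuples Q \<theta> d =
     {(ds, e) \<in> weighted_tuples Q d.
        (ds, e) = ([], d) \<or> (\<forall>j\<in>{1..length ds}. slope Q \<theta> (sum_list (take j ds)) > 0)}"

end

theory Submission
  imports Defs "HOL-Library.Cardinality"
begin

text \<open>
  Evaluated at a self-dual representation \<open>N\<close>, both right-hand sides count chains
  \<open>0 < U\<^sub>1 < \<dots> < U\<^sub>n\<close> of isotropic subrepresentations. In the recursion the chains are those with semistable
  subquotients of decreasing positive slopes and semistable \<open>N // U\<^sub>n\<close>. There is exactly one: \<open>U\<^sub>1\<close> must be the
  isotropic subrepresentation of maximal slope and, among those, of maximal dimension, and one continues above \<open>U\<^sub>1\<close>.

  In the resolution the chains lie in the poset \<open>P\<close> of isotropic \<open>U\<close> with \<open>\<theta>(U) > 0\<close> and are counted with sign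
  \<open>(-1)\<^sup>n\<close>. If \<open>P\<close> is empty, then \<open>N\<close> is semistable and only the empty chain contributes. Otherwise choose
  \<open>U\<close> in \<open>P\<close> with \<open>\<theta>(U)\<close> maximal. Since \<open>dim U\<^sup>\<bottom> = dim N - \<sigma>(dim U)\<close>, maximality gives
  \<open>\<theta>(V \<inter> U\<^sup>\<bottom>) \<ge> \<theta>(V)\<close> and \<open>\<theta>(V \<inter> U\<^sup>\<bottom> + U) \<ge> \<theta>(V \<inter> U\<^sup>\<bottom>)\<close>, so \<open>V \<ge> V \<inter> U\<^sup>\<bottom> \<le> V \<inter> U\<^sup>\<bottom> + U \<ge> U\<close> contracts
  \<open>P\<close> to the point \<open>U\<close> and the signed count vanishes.

  Dimensions are compared through cardinalities, which are powers of the order of the ground field.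
\<close>

section \<open>Finite vector spaces\<close>

text \<open>Two isotropic subrepresentations need not have an isotropic sum, so destabilising
  objects cannot be compared through their sum in the usual way. The substitute is the identity
  \<theta>(V \<inter> U') = \<theta>(V) + \<theta>(U) - \<theta>(V' \<inter> U), where ' is the
  orthogonal complement. It follows from modularity and \<theta>(U') = \<theta>(U), the latter
  because \<theta>(dim N) = 0 and \<theta> changes sign under \<sigma>. As V' \<inter> U lies in U
  it is again isotropic, so maximality of \<theta>(U) bounds its degree; and V \<inter> U' is
  orthogonal to U, so its sum with U is isotropic. Both halves of the theorem rest on this, and
  neither is deduced from the other. A subquotient of a subquotient has elements of a new type at
  each step. All chains are therefore kept inside one N, and a subquotient is a pair A \<le> B in N
  together with a map that presents it. Hall products are read off as counts of flags in N, after
  which both identities concern only the lattice of subrepresentations with its involution, degree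
  and rank.\<close>

abbreviation kspace :: "('k::field, 'x) module \<Rightarrow> bool" where
  "kspace V \<equiv> vectorspace (class_ring :: 'k ring) V"

abbreviation ksubspace :: "'x set \<Rightarrow> ('k::field, 'x) module \<Rightarrow> bool" where
  "ksubspace S V \<equiv> VectorSpace.subspace (class_ring :: 'k ring) S V"

lemma kspaceI:
  fixes V :: "('k::field, 'x) module"
  assumes "abelian_group V"
    and "\<And>c x. x \<in> carrier V \<Longrightarrow> c \<odot>\<^bsub>V\<^esub> x \<in> carrier V"
    and "\<And>c c' x. x \<in> carrier V \<Longrightarrow> (c + c') \<odot>\<^bsub>V\<^esub> x = c \<odot>\<^bsub>V\<^esub> x \<oplus>\<^bsub>V\<^esub> c' \<odot>\<^bsub>V\<^esub> x"
    and "\<And>c x y. x \<in> carrier V \<Longrightarrow> y \<in> carrier V \<Longrightarrow>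
      c \<odot>\<^bsub>V\<^esub> (x \<oplus>\<^bsub>V\<^esub> y) = c \<odot>\<^bsub>V\<^esub> x \<oplus>\<^bsub>V\<^esub> c \<odot>\<^bsub>V\<^esub> y"
    and "\<And>c c' x. x \<in> carrier V \<Longrightarrow> (c * c') \<odot>\<^bsub>V\<^esub> x = c \<odot>\<^bsub>V\<^esub> (c' \<odot>\<^bsub>V\<^esub> x)"
    and "\<And>x. x \<in> carrier V \<Longrightarrow> 1 \<odot>\<^bsub>V\<^esub> x = x"
  shows "kspace V"
  unfolding vectorspace_def
  using class_field.field_axioms
  by (intro conjI moduleI class_cring.cring_axioms assms(1)) (use assms in auto)

lemma kspace_closed:
  fixes V :: "('k::field, 'x) module"
  assumes "kspace V"
  shows "\<zero>\<^bsub>V\<^esub> \<in> carrier V"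
    and "\<And>x y. x \<in> carrier V \<Longrightarrow> y \<in> carrier V \<Longrightarrow> x \<oplus>\<^bsub>V\<^esub> y \<in> carrier V"
    and "\<And>x y. x \<in> carrier V \<Longrightarrow> y \<in> carrier V \<Longrightarrow> x \<ominus>\<^bsub>V\<^esub> y \<in> carrier V"
    and "\<And>c x. x \<in> carrier V \<Longrightarrow> c \<odot>\<^bsub>V\<^esub> x \<in> carrier V"
    and "\<And>x. x \<in> carrier V \<Longrightarrow> 0 \<odot>\<^bsub>V\<^esub> x = \<zero>\<^bsub>V\<^esub>"
    and "\<And>c. c \<odot>\<^bsub>V\<^esub> \<zero>\<^bsub>V\<^esub> = \<zero>\<^bsub>V\<^esub>"
    and "\<And>x y. x \<in> carrier V \<Longrightarrow> y \<in> carrier V \<Longrightarrow> x \<ominus>\<^bsub>V\<^esub> y = x \<oplus>\<^bsub>V\<^esub> (-1) \<odot>\<^bsub>V\<^esub> y"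
proof -
  interpret V: vectorspace "class_ring :: 'k ring" V by fact
  show "\<zero>\<^bsub>V\<^esub> \<in> carrier V" by simp
  show "x \<oplus>\<^bsub>V\<^esub> y \<in> carrier V" "x \<ominus>\<^bsub>V\<^esub> y \<in> carrier V"
    if "x \<in> carrier V" "y \<in> carrier V" for x y using that by simp_all
  show "c \<odot>\<^bsub>V\<^esub> x \<in> carrier V" if "x \<in> carrier V" for c x using that V.smult_closed by simp
  show "0 \<odot>\<^bsub>V\<^esub> x = \<zero>\<^bsub>V\<^esub>" if "x \<in> carrier V" for x using V.smult_l_null[OF that] by simp
  show "c \<odot>\<^bsub>V\<^esub> \<zero>\<^bsub>V\<^esub> = \<zero>\<^bsub>V\<^esub>" for c using V.smult_r_null[of c] by simp
  show "x \<ominus>\<^bsub>V\<^esub> y = x \<oplus>\<^bsub>V\<^esub> (-1) \<odot>\<^bsub>V\<^esub> y" if "x \<in> carrier V" "y \<in> carrier V" for x y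
    using V.smult_l_minus[of 1 y] V.smult_one[of y] that
    by (simp add: a_minus_def class_ring_simps)
qed

lemma ksubspace_iff:
  fixes V :: "('k::field, 'x) module"
  assumes "kspace V"
  shows "ksubspace S V \<longleftrightarrow> S \<subseteq> carrier V \<and> \<zero>\<^bsub>V\<^esub> \<in> S \<and>
    (\<forall>x\<in>S. \<forall>y\<in>S. x \<oplus>\<^bsub>V\<^esub> y \<in> S) \<and> (\<forall>c. \<forall>x\<in>S. c \<odot>\<^bsub>V\<^esub> x \<in> S)"
proof -
  interpret V: vectorspace "class_ring :: 'k ring" V by fact
  show ?thesis
    unfolding VectorSpace.subspace_def submodule_def
    using assms V.module_axioms by auto
qed

lemma ksubspaceD:
  fixes V :: "('k::field, 'x) module"
  assumes "ksubspace S V"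
  shows "S \<subseteq> carrier V" and "\<zero>\<^bsub>V\<^esub> \<in> S"
    and "\<And>x y. x \<in> S \<Longrightarrow> y \<in> S \<Longrightarrow> x \<oplus>\<^bsub>V\<^esub> y \<in> S"
    and "\<And>c x. x \<in> S \<Longrightarrow> c \<odot>\<^bsub>V\<^esub> x \<in> S"
  using assms unfolding VectorSpace.subspace_def submodule_def by auto

lemma ksubspace_minus:
  assumes "kspace V" "ksubspace S V" "x \<in> S" "y \<in> S"
  shows "x \<ominus>\<^bsub>V\<^esub> y \<in> S"
  using kspace_closed(7)[OF assms(1), of x y] ksubspaceD[OF assms(2)] assms(3,4)
  by (simp add: subset_eq)

lemma kspace_subspace:
  assumes "kspace V" "ksubspace S V"
  shows "kspace (V\<lparr>carrier := S\<rparr>)"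
  using vectorspace.subspace_is_vs[OF assms] .

lemma ksubspace_zero: "kspace V \<Longrightarrow> ksubspace {\<zero>\<^bsub>V\<^esub>} V"
  using kspace_closed[of V] by (auto simp: ksubspace_iff vectorspace_def module_def
      dest: abelian_group.axioms abelian_monoid.l_zero)

lemma ksubspace_carrier: "kspace V \<Longrightarrow> ksubspace (carrier V) V"
  using kspace_closed[of V] by (auto simp: ksubspace_iff)

text \<open>Transport of structure: every axiom of \<open>W\<close> is the image under
  \<open>p\<close> of the same axiom of \<open>V\<close>. The zero of \<open>W\<close> is a mere
  record field at this point, so its compatibility with \<open>p\<close> is a hypothesis. Through
  this, quotients and relabelled copies become vector spaces.\<close>

lemma kspace_image:
  fixes V :: "('k::field, 'x) module" and W :: "('k, 'y) module"
  assumes V: "kspace V"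
    and im: "p ` carrier V = carrier W"
    and add: "\<And>x y. x \<in> carrier V \<Longrightarrow> y \<in> carrier V \<Longrightarrow> p (x \<oplus>\<^bsub>V\<^esub> y) = p x \<oplus>\<^bsub>W\<^esub> p y"
    and smult: "\<And>c x. x \<in> carrier V \<Longrightarrow> p (c \<odot>\<^bsub>V\<^esub> x) = c \<odot>\<^bsub>W\<^esub> p x"
    and zero: "p \<zero>\<^bsub>V\<^esub> = \<zero>\<^bsub>W\<^esub>"
  shows "kspace W"
proof -
  interpret V: vectorspace "class_ring :: 'k ring" V by fact
  note cl = kspace_closed[OF V]
  show ?thesis
  proof (rule kspaceI)
    show "abelian_group W"
    proof (rule abelian_groupI)
      show "\<zero>\<^bsub>W\<^esub> \<in> carrier W" using im zero cl(1) by (metis imageI)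
      fix x assume "x \<in> carrier W"
      then obtain x' where x: "x' \<in> carrier V" "x = p x'" using im by blast
      show "\<zero>\<^bsub>W\<^esub> \<oplus>\<^bsub>W\<^esub> x = x" using add[of "\<zero>\<^bsub>V\<^esub>" x'] x cl zero by simp
      have "p (\<ominus>\<^bsub>V\<^esub> x') \<oplus>\<^bsub>W\<^esub> x = \<zero>\<^bsub>W\<^esub>"
        using add[of "\<ominus>\<^bsub>V\<^esub> x'" x'] x zero by (simp add: V.l_neg)
      then show "\<exists>y\<in>carrier W. y \<oplus>\<^bsub>W\<^esub> x = \<zero>\<^bsub>W\<^esub>" using im x by blast
      fix y assume "y \<in> carrier W"
      then obtain y' where y: "y' \<in> carrier V" "y = p y'" using im by blast
      show "x \<oplus>\<^bsub>W\<^esub> y \<in> carrier W" using add[of x' y'] x y im cl by (metis imageI)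
      show "x \<oplus>\<^bsub>W\<^esub> y = y \<oplus>\<^bsub>W\<^esub> x" using x y by (simp add: add[symmetric] V.a_comm)
      fix z assume "z \<in> carrier W"
      then obtain z' where z: "z' \<in> carrier V" "z = p z'" using im by blast
      show "x \<oplus>\<^bsub>W\<^esub> y \<oplus>\<^bsub>W\<^esub> z = x \<oplus>\<^bsub>W\<^esub> (y \<oplus>\<^bsub>W\<^esub> z)"
        using x y z cl by (simp add: add[symmetric] V.a_assoc)
    qed
  next
    fix c c' x assume "x \<in> carrier W"
    then obtain x' where x: "x' \<in> carrier V" "x = p x'" using im by blast
    show "c \<odot>\<^bsub>W\<^esub> x \<in> carrier W" using smult[of x' c] x im cl by (metis imageI)
    show "(c + c') \<odot>\<^bsub>W\<^esub> x = c \<odot>\<^bsub>W\<^esub> x \<oplus>\<^bsub>W\<^esub> c' \<odot>\<^bsub>W\<^esub> x"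
      using V.smult_l_distr[of c c' x'] x cl by (simp add: smult[symmetric] add[symmetric])
    show "(c * c') \<odot>\<^bsub>W\<^esub> x = c \<odot>\<^bsub>W\<^esub> (c' \<odot>\<^bsub>W\<^esub> x)"
      using V.smult_assoc1[of c c' x'] x cl by (simp add: smult[symmetric])
    show "1 \<odot>\<^bsub>W\<^esub> x = x" using V.smult_one[of x'] x by (simp add: smult[symmetric])
    fix y assume "y \<in> carrier W"
    then obtain y' where y: "y' \<in> carrier V" "y = p y'" using im by blast
    show "c \<odot>\<^bsub>W\<^esub> (x \<oplus>\<^bsub>W\<^esub> y) = c \<odot>\<^bsub>W\<^esub> x \<oplus>\<^bsub>W\<^esub> c \<odot>\<^bsub>W\<^esub> y"
      using V.smult_r_distr[of c x' y'] x y cl by (simp add: smult[symmetric] add[symmetric])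
  qed
qed

lemma fin_dim_finite:
  fixes V :: "('k::field, 'x) module"
  assumes "kspace V" "finite (carrier V)"
  shows "vectorspace.fin_dim (class_ring :: 'k ring) V"
proof -
  interpret V: vectorspace "class_ring :: 'k ring" V by fact
  have "V.span (carrier V) = carrier V"
    using V.span_is_subset2[of "carrier V"] V.in_own_span[of "carrier V"] by auto
  then show ?thesis unfolding V.fin_dim_def using assms(2) by blast
qed

text \<open>Coordinates with respect to a finite basis identify the space with the functions from
  the basis to the field.\<close>

lemma card_kspace:
  fixes V :: "('k::{field, finite}, 'x) module"
  assumes "kspace V" "vectorspace.fin_dim (class_ring :: 'k ring) V"
  shows "finite (carrier V)"
    and "card (carrier V) = CARD('k) ^ vectorspace.dim (class_ring :: 'k ring) V"
proof -
  interpret V: vectorspace "class_ring :: 'k ring" V by fact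
  obtain B where B: "finite B" "V.basis B" using V.finite_basis_exists assms(2) by auto
  have sub: "B \<subseteq> carrier V" using B(2) unfolding V.basis_def by auto
  have "\<forall>v. v \<in> carrier V \<longrightarrow> (\<exists>!a. a \<in> B \<rightarrow>\<^sub>E (UNIV :: 'k set) \<and> V.lincomb a B = v)"
    using V.basis_criterion[OF B(1) sub] B(2) by simp
  then have ex: "\<exists>!a. a \<in> B \<rightarrow>\<^sub>E (UNIV :: 'k set) \<and> V.lincomb a B = v" if "v \<in> carrier V" for v
    using that by blast
  have cl: "V.lincomb a B \<in> carrier V" for a :: "'x \<Rightarrow> 'k"
    using V.lincomb_closed[OF sub, of a] by simp
  have "bij_betw (\<lambda>a. V.lincomb a B) (B \<rightarrow>\<^sub>E UNIV) (carrier V)"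
    unfolding bij_betw_def inj_on_def
  proof (intro conjI ballI impI)
    show "a = a'" if "a \<in> B \<rightarrow>\<^sub>E UNIV" "a' \<in> B \<rightarrow>\<^sub>E UNIV" "V.lincomb a B = V.lincomb a' B" for a a'
      using ex[OF cl[of a']] that by blast
    show "(\<lambda>a. V.lincomb a B) ` (B \<rightarrow>\<^sub>E UNIV) = carrier V"
      using ex cl by (intro equalityI subsetI) (blast, metis (mono_tags, lifting) image_eqI)
  qed
  moreover have "finite (B \<rightarrow>\<^sub>E (UNIV :: 'k set))" using B(1) by (simp add: finite_PiE)
  moreover have "card (B \<rightarrow>\<^sub>E (UNIV :: 'k set)) = CARD('k) ^ V.dim"
    using card_PiE[OF B(1), of "\<lambda>_. UNIV :: 'k set"] V.dim_basis[OF B] by simp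
  ultimately show "finite (carrier V)" "card (carrier V) = CARD('k) ^ V.dim"
    using bij_betw_finite bij_betw_same_card by metis+
qed

lemma card_field_gt_1: "1 < CARD('k::{field, finite})"
proof -
  have "card {0, 1 :: 'k} \<le> CARD('k)" by (rule card_mono) auto
  then show ?thesis by simp
qed

text \<open>The fibre over p y is the coset A + y, so all fibres have the size of A. The target is a
  bare set in order to cover linear maps (\<open>card_hom\<close>) and functionals into the field
  (\<open>card_functional\<close>) alike.\<close>

lemma card_fibres:
  fixes V :: "('k::field, 'x) module"
  assumes V: "kspace V" "finite (carrier V)" and A: "ksubspace A V" and im: "p ` carrier V = T"
    and fib: "\<And>x y. x \<in> carrier V \<Longrightarrow> y \<in> carrier V \<Longrightarrow> p x = p y \<longleftrightarrow> x \<ominus>\<^bsub>V\<^esub> y \<in> A"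
  shows "card (carrier V) = card A * card T"
proof -
  interpret V: vectorspace "class_ring :: 'k ring" V by fact
  have sub: "A \<subseteq> carrier V" by (rule ksubspaceD[OF A])
  have "card {x \<in> carrier V. p x = t} = card A" if "t \<in> T" for t
  proof -
    have "t \<in> p ` carrier V" using that by (simp add: im)
    then obtain y where y: "y \<in> carrier V" "t = p y" by (rule imageE)
    have "bij_betw (\<lambda>a. a \<oplus>\<^bsub>V\<^esub> y) A {x \<in> carrier V. p x = t}"
    proof (rule bij_betwI[where g = "\<lambda>x. x \<ominus>\<^bsub>V\<^esub> y"])
      have e: "a \<oplus>\<^bsub>V\<^esub> y \<ominus>\<^bsub>V\<^esub> y = a" if "a \<in> carrier V" for a
        using that y by (simp add: a_minus_def V.a_assoc V.r_neg)
      show "(\<lambda>a. a \<oplus>\<^bsub>V\<^esub> y) \<in> A \<rightarrow> {x \<in> carrier V. p x = t}"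
      proof
        fix a assume a: "a \<in> A"
        then have "a \<in> carrier V" using sub by blast
        then show "a \<oplus>\<^bsub>V\<^esub> y \<in> {x \<in> carrier V. p x = t}"
          using fib[of "a \<oplus>\<^bsub>V\<^esub> y" y] y e[of a] a by simp
      qed
      show "(\<lambda>x. x \<ominus>\<^bsub>V\<^esub> y) \<in> {x \<in> carrier V. p x = t} \<rightarrow> A"
      proof
        fix x assume "x \<in> {x \<in> carrier V. p x = t}"
        then show "x \<ominus>\<^bsub>V\<^esub> y \<in> A" using fib[of x y] y by simp
      qed
      show "a \<oplus>\<^bsub>V\<^esub> y \<ominus>\<^bsub>V\<^esub> y = a" if "a \<in> A" for a using e that sub by auto
      show "x \<ominus>\<^bsub>V\<^esub> y \<oplus>\<^bsub>V\<^esub> y = x" if "x \<in> {x \<in> carrier V. p x = t}" for x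
        using that y by (simp add: a_minus_def V.a_assoc V.l_neg)
    qed
    then show ?thesis by (simp add: bij_betw_same_card)
  qed
  moreover have "card (carrier V) = (\<Sum>t\<in>T. card {x \<in> carrier V. p x = t})"
  proof -
    have "finite T" using finite_imageI[OF V(2), of p] by (simp only: im)
    from sum.group[OF V(2) this, of p "\<lambda>_. 1::nat"] show ?thesis by (simp add: im)
  qed
  ultimately show ?thesis by simp
qed

lemma card_hom:
  fixes V :: "('k::field, 'x) module" and W :: "('k, 'y) module"
  assumes V: "kspace V" "finite (carrier V)" and W: "kspace W"
    and im: "p ` carrier V = carrier W"
    and add: "\<And>x y. x \<in> carrier V \<Longrightarrow> y \<in> carrier V \<Longrightarrow> p (x \<oplus>\<^bsub>V\<^esub> y) = p x \<oplus>\<^bsub>W\<^esub> p y"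
    and smult: "\<And>c x. x \<in> carrier V \<Longrightarrow> p (c \<odot>\<^bsub>V\<^esub> x) = c \<odot>\<^bsub>W\<^esub> p x"
  shows "card (carrier V) = card {x \<in> carrier V. p x = \<zero>\<^bsub>W\<^esub>} * card (carrier W)"
proof (rule card_fibres[OF V _ im])
  interpret V: vectorspace "class_ring :: 'k ring" V by fact
  interpret W: vectorspace "class_ring :: 'k ring" W by fact
  note clV = kspace_closed[OF V(1)] and clW = kspace_closed[OF W]
  have p: "p x \<in> carrier W" if "x \<in> carrier V" for x using that im by blast
  have p0: "p \<zero>\<^bsub>V\<^esub> = \<zero>\<^bsub>W\<^esub>"
    using smult[of "\<zero>\<^bsub>V\<^esub>" 0] clV clW p by metis
  show "ksubspace {x \<in> carrier V. p x = \<zero>\<^bsub>W\<^esub>} V"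
    unfolding ksubspace_iff[OF V(1)]
    using clV(1,2,4) clW(1,6) p0 by (simp add: add smult W.l_zero)
  show "p x = p y \<longleftrightarrow> x \<ominus>\<^bsub>V\<^esub> y \<in> {x \<in> carrier V. p x = \<zero>\<^bsub>W\<^esub>}"
    if "x \<in> carrier V" "y \<in> carrier V" for x y
  proof -
    have "p (x \<ominus>\<^bsub>V\<^esub> y) = p x \<ominus>\<^bsub>W\<^esub> p y" 
      using that clV clW p by (simp add: add smult)
    moreover have "p x = p y" if "p x \<ominus>\<^bsub>W\<^esub> p y = \<zero>\<^bsub>W\<^esub>"
    proof -
      have "p x = (p x \<ominus>\<^bsub>W\<^esub> p y) \<oplus>\<^bsub>W\<^esub> p y"
        using p \<open>x \<in> carrier V\<close> \<open>y \<in> carrier V\<close> by (simp add: a_minus_def W.a_assoc W.l_neg)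
      then show ?thesis using that p \<open>y \<in> carrier V\<close> by simp
    qed
    moreover have "p x \<ominus>\<^bsub>W\<^esub> p y = \<zero>\<^bsub>W\<^esub>" if "p x = p y"
      using p \<open>y \<in> carrier V\<close> that by (simp add: a_minus_def W.r_neg)
    ultimately show ?thesis using clV(3)[OF that] by fastforce
  qed
qed

lemma card_functional:
  fixes V :: "('k::{field, finite}, 'x) module"
  assumes V: "kspace V" "finite (carrier V)"
    and add: "\<And>x y. x \<in> carrier V \<Longrightarrow> y \<in> carrier V \<Longrightarrow> b (x \<oplus>\<^bsub>V\<^esub> y) = b x + b y"
    and smult: "\<And>c x. x \<in> carrier V \<Longrightarrow> b (c \<odot>\<^bsub>V\<^esub> x) = c * b x"
    and nz: "\<exists>x\<in>carrier V. b x \<noteq> (0 :: 'k)"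
  shows "card (carrier V) = card {x \<in> carrier V. b x = 0} * CARD('k)"
proof (rule card_fibres[OF V])
  note clV = kspace_closed[OF V(1)]
  have b0: "b \<zero>\<^bsub>V\<^esub> = 0" using smult[of "\<zero>\<^bsub>V\<^esub>" 0] clV by simp
  show "ksubspace {x \<in> carrier V. b x = 0} V"
    unfolding ksubspace_iff[OF V(1)] using clV(1,2,4) b0 by (simp add: add smult)
  obtain x where x: "x \<in> carrier V" "b x \<noteq> 0" using nz by blast
  have "c \<in> b ` carrier V" for c
  proof -
    have "b ((c / b x) \<odot>\<^bsub>V\<^esub> x) = c" using smult[of x "c / b x"] x by simp
    then show ?thesis using clV(4)[of x "c / b x"] x by (metis imageI)
  qed
  then show "b ` carrier V = UNIV" by blast
  show "b x = b y \<longleftrightarrow> x \<ominus>\<^bsub>V\<^esub> y \<in> {x \<in> carrier V. b x = 0}"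
    if "x \<in> carrier V" "y \<in> carrier V" for x y
  proof -
    have "b (x \<ominus>\<^bsub>V\<^esub> y) = b x - b y" using that clV by (simp add: add smult)
    then show ?thesis using that clV(3) by auto
  qed
qed

text \<open>Both sides count the pairs \<open>(x, u)\<close> with \<open>b x u = 0\<close>.\<close>

lemma card_annihilator:
  fixes V :: "('k::{field, finite}, 'x) module" and W :: "('k, 'x) module"
  assumes V: "kspace V" "finite (carrier V)" and W: "kspace W" "finite (carrier W)"
    and U: "ksubspace U W"
    and bil: "bilinear_on V W b"
    and nd: "\<And>y. y \<in> U \<Longrightarrow> (\<And>x. x \<in> carrier V \<Longrightarrow> b x y = 0) \<Longrightarrow> y = \<zero>\<^bsub>W\<^esub>"
  shows "card {x \<in> carrier V. \<forall>u\<in>U. b x u = 0} * card U = card (carrier V)"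
proof -
  define P where "P = {x \<in> carrier V. \<forall>u\<in>U. b x u = 0}"
  define q where "q = CARD('k)"
  have q: "q > 1" unfolding q_def by (rule card_field_gt_1)
  note Us = ksubspaceD[OF U]
  have sub: "U \<subseteq> carrier W" by (rule Us)
  have finU: "finite U" using sub W(2) finite_subset by blast
  have kU: "kspace (W\<lparr>carrier := U\<rparr>)" using kspace_subspace[OF W(1) U] .
  \<comment> \<open>Outside \<open>P\<close> the functional b x is nonzero on U and its kernel has
    |U| / q elements; both sides are multiplied by \<open>q\<close> to stay in the natural
    numbers.\<close>
  have 1: "q * card {u \<in> U. b x u = 0} = (if x \<in> P then q * card U else card U)"
    if x: "x \<in> carrier V" for x
  proof (cases "x \<in> P")
    case True
    then have "{u \<in> U. b x u = 0} = U" by (auto simp: P_def)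
    then show ?thesis using True by simp
  next
    case False
    have "\<exists>u\<in>U. b x u \<noteq> 0" using x False by (auto simp: P_def)
    moreover have "b x (u \<oplus>\<^bsub>W\<^esub> u') = b x u + b x u'" if "u \<in> U" "u' \<in> U" for u u'
      using bil that x sub unfolding bilinear_on_def by blast
    moreover have "b x (c \<odot>\<^bsub>W\<^esub> u) = c * b x u" if "u \<in> U" for c u
      using bil that x sub unfolding bilinear_on_def by blast
    ultimately have "card U = card {u \<in> U. b x u = 0} * q"
      using card_functional[OF kU, of "b x"] finU by (simp add: q_def)
    then show ?thesis using False by (simp add: mult.commute)
  qed
  have 2: "q * card {x \<in> carrier V. b x u = 0} =
      (if u = \<zero>\<^bsub>W\<^esub> then q * card (carrier V) else card (carrier V))"
    if u: "u \<in> U" for u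
  proof (cases "u = \<zero>\<^bsub>W\<^esub>")
    case True
    have "b x \<zero>\<^bsub>W\<^esub> = 0" if "x \<in> carrier V" for x
    proof -
      have "b x (0 \<odot>\<^bsub>W\<^esub> \<zero>\<^bsub>W\<^esub>) = 0 * b x \<zero>\<^bsub>W\<^esub>"
        using bil that kspace_closed(1)[OF W(1)] unfolding bilinear_on_def by blast
      then show ?thesis using kspace_closed(6)[OF W(1)] by simp
    qed
    then have "{x \<in> carrier V. b x u = 0} = carrier V" using True by auto
    then show ?thesis using True by simp
  next
    case False
    have "\<exists>x\<in>carrier V. b x u \<noteq> 0" using nd[OF u] False by blast
    moreover have "b (x \<oplus>\<^bsub>V\<^esub> x') u = b x u + b x' u"
      if "x \<in> carrier V" "x' \<in> carrier V" for x x'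
      using bil that u sub unfolding bilinear_on_def by blast
    moreover have "b (c \<odot>\<^bsub>V\<^esub> x) u = c * b x u" if "x \<in> carrier V" for c x
      using bil that u sub unfolding bilinear_on_def by blast
    ultimately have "card (carrier V) = card {x \<in> carrier V. b x u = 0} * q"
      using card_functional[OF V, of "\<lambda>x. b x u"] by (simp add: q_def)
    then show ?thesis using False by (simp add: mult.commute)
  qed
  have pos: "card (carrier V) > 0" "card U > 0" 
    using V(2) kspace_closed(1)[OF V(1)] finU Us card_gt_0_iff by blast+
  have PV: "P \<subseteq> carrier V" by (auto simp: P_def)
  have "(\<Sum>x\<in>carrier V. card {u \<in> U. b x u = 0}) = (\<Sum>u\<in>U. card {x \<in> carrier V. b x u = 0})"
    by (rule sum_multicount_gen) (use V(2) finU in auto)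
  then have "(\<Sum>x\<in>carrier V. q * card {u \<in> U. b x u = 0}) =
      (\<Sum>u\<in>U. q * card {x \<in> carrier V. b x u = 0})"
    by (simp add: sum_distrib_left[symmetric])
  then have "(\<Sum>x\<in>carrier V. if x \<in> P then q * card U else card U) =
      (\<Sum>u\<in>U. if u = \<zero>\<^bsub>W\<^esub> then q * card (carrier V) else card (carrier V))"
    by (simp add: 1 2)
  moreover have "(\<Sum>x\<in>carrier V. if x \<in> P then q * card U else card U) =
      card P * (q * card U) + card (carrier V - P) * card U"
    using V(2) PV by (simp add: sum.If_cases Int_absorb1 Diff_eq[symmetric])
  moreover have "(\<Sum>u\<in>U. if u = \<zero>\<^bsub>W\<^esub> then q * card (carrier V) else card (carrier V)) =
      q * card (carrier V) + (card U - 1) * card (carrier V)"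
    using Us finU by (simp add: sum.remove)
  ultimately have "card P * (q * card U) + (card (carrier V) - card P) * card U =
      q * card (carrier V) + (card U - 1) * card (carrier V)"
    using card_Diff_subset[OF finite_subset[OF PV V(2)] PV] by simp
  \<comment> \<open>With |V| = |P| + k, |U| = m + 1 and q = r + 1 the equality of the two counts
    collapses to r |P| m = r k, and then |P| |U| = |P| + k = |V|.\<close>
  moreover obtain k where k: "card (carrier V) = card P + k"
    using card_mono[OF V(2) PV] le_Suc_ex by blast
  moreover obtain m where m: "card U = Suc m" using pos(2) gr0_implies_Suc by blast
  moreover obtain r where r: "q = Suc r" "r > 0" using q by (cases q) auto
  ultimately have "r * (card P * m) = r * k" by (simp add: algebra_simps)
  then have "card P * m = k" using r(2) by simp
  then show ?thesis using k m unfolding P_def by simp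
qed

section \<open>Signed chain counts and Harder--Narasimhan chains in a polarised lattice\<close>

text \<open>The empty chain is included, so the signed count of all chains is the negative of the
  reduced Euler characteristic of the order complex. The relation is a parameter because
  \<open>chain_sum_destab\<close> contracts along both the order and its reverse.\<close>

definition chains_in :: "('b \<Rightarrow> 'b \<Rightarrow> bool) \<Rightarrow> 'b set \<Rightarrow> 'b set set" where
  "chains_in R P = {C. C \<subseteq> P \<and> (\<forall>x\<in>C. \<forall>y\<in>C. R x y \<or> R y x)}"

lemma finite_chains_in: "finite P \<Longrightarrow> finite (chains_in R P)"
  by (rule finite_subset[of _ "Pow P"]) (auto simp: chains_in_def)

lemma finite_chain_least:
  assumes "finite C" "C \<noteq> {}"
    and "\<And>x y z. x \<in> C \<Longrightarrow> y \<in> C \<Longrightarrow> z \<in> C \<Longrightarrow> R x y \<Longrightarrow> R y z \<Longrightarrow> R x z"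
    and "\<And>x y. x \<in> C \<Longrightarrow> y \<in> C \<Longrightarrow> R x y \<or> R y x"
  shows "\<exists>x\<in>C. \<forall>y\<in>C. R x y"
  using assms
proof (induction C rule: finite_ne_induct)
  case (singleton x)
  then show ?case by blast
next
  case (insert a C)
  have "\<exists>x\<in>C. \<forall>y\<in>C. R x y"
  proof (rule insert.IH)
    show "R x z" if "x \<in> C" "y \<in> C" "z \<in> C" "R x y" "R y z" for x y z
      using insert.prems(1)[of x y z] that by simp
    show "R x y \<or> R y x" if "x \<in> C" "y \<in> C" for x y
      using insert.prems(2)[of x y] that by simp
  qed
  then obtain x where x: "x \<in> C" "\<forall>y\<in>C. R x y" by blast
  have aa: "R a a" using insert.prems(2)[of a a] by simp
  show ?case
  proof (cases "R a x")
    case True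
    have "R a y" if "y \<in> C" for y
      using insert.prems(1)[of a x y] True x that by simp
    then show ?thesis using aa by blast
  next
    case False
    then have "R x a" using insert.prems(2)[of a x] x by simp
    then show ?thesis using x by blast
  qed
qed

lemma finite_has_max_image:
  fixes f :: "'c \<Rightarrow> 'd::linorder"
  assumes "finite S" "S \<noteq> {}"
  shows "\<exists>x\<in>S. \<forall>y\<in>S. f y \<le> f x"
proof -
  have "Max (f ` S) \<in> f ` S" using assms by simp
  then obtain x where "x \<in> S" "f x = Max (f ` S)" by auto
  then show ?thesis using assms(1) by (intro bexI[of _ x]) auto
qed

lemma sum_sign_involution:
  fixes s :: "'c \<Rightarrow> int"
  assumes "\<And>x. x \<in> S \<Longrightarrow> t x \<in> S" "\<And>x. x \<in> S \<Longrightarrow> t (t x) = x" "\<And>x. x \<in> S \<Longrightarrow> s (t x) = - s x"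
  shows "sum s S = 0"
proof -
  have "sum s S = (\<Sum>x\<in>S. - s x)"
    by (rule sum.reindex_bij_witness[of _ t t]) (use assms in auto)
  then show ?thesis by (simp add: sum_negf)
qed

text \<open>
  Toggling \<open>f x\<close>, for the least non-fixed \<open>x\<close> of a chain, cancels all chains with a non-fixed element.
\<close>

lemma chain_sum_kernel_operator:
  assumes fin: "finite P"
    and trans: "\<And>x y z. x \<in> P \<Longrightarrow> y \<in> P \<Longrightarrow> z \<in> P \<Longrightarrow> R x y \<Longrightarrow> R y z \<Longrightarrow> R x z"
    and refl: "\<And>x. x \<in> P \<Longrightarrow> R x x"
    and antisym: "\<And>x y. x \<in> P \<Longrightarrow> y \<in> P \<Longrightarrow> R x y \<Longrightarrow> R y x \<Longrightarrow> x = y"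
    and f: "\<And>x. x \<in> P \<Longrightarrow> f x \<in> P" "\<And>x. x \<in> P \<Longrightarrow> f (f x) = f x" "\<And>x. x \<in> P \<Longrightarrow> R (f x) x"
      "\<And>x y. x \<in> P \<Longrightarrow> y \<in> P \<Longrightarrow> R x y \<Longrightarrow> R (f x) (f y)"
  shows "(\<Sum>C\<in>chains_in R P. (-1) ^ card C) = (\<Sum>C\<in>chains_in R {x \<in> P. f x = x}. (-1::int) ^ card C)"
proof -
  define D where "D = {C \<in> chains_in R P. \<exists>x\<in>C. f x \<noteq> x}"
  define least where "least B = (THE x. x \<in> B \<and> (\<forall>y\<in>B. R x y))" for B
  define m where "m C = least {y \<in> C. f y \<noteq> y}" for C
  define t where "t C = (if f (m C) \<in> C then C - {f (m C)} else insert (f (m C)) C)" for C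
  have CP: "x \<in> P" if "x \<in> C" "C \<in> D" for x C using that by (auto simp: D_def chains_in_def)
  have finC: "finite C" if "C \<in> D" for C
    using that fin by (auto simp: D_def chains_in_def intro: finite_subset)
  have m: "m C \<in> C \<and> f (m C) \<noteq> m C \<and> (\<forall>y\<in>C. f y \<noteq> y \<longrightarrow> R (m C) y)" if C: "C \<in> D" for C
  proof -
    let ?B = "{y \<in> C. f y \<noteq> y}"
    have "\<exists>x\<in>?B. \<forall>y\<in>?B. R x y"
    proof (rule finite_chain_least)
      show "finite ?B" using finC[OF C] by simp
      show "?B \<noteq> {}" using C by (auto simp: D_def)
      show "R x z" if "x \<in> ?B" "y \<in> ?B" "z \<in> ?B" "R x y" "R y z" for x y z
        using trans[of x y z] CP[OF _ C] that by blast
      show "R x y \<or> R y x" if "x \<in> ?B" "y \<in> ?B" for x y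
        using C that by (auto simp: D_def chains_in_def)
    qed
    then obtain x where x: "x \<in> ?B" "\<forall>y\<in>?B. R x y" by blast
    have "m C = x"
      unfolding m_def least_def
    proof (rule the_equality)
      show "x \<in> ?B \<and> (\<forall>y\<in>?B. R x y)" using x by blast
      show "x' = x" if "x' \<in> ?B \<and> (\<forall>y\<in>?B. R x' y)" for x'
        using that x antisym[of x x'] CP[OF _ C] by blast
    qed
    then show ?thesis using x by blast
  qed
  have fm: "f (m C) \<in> P \<and> f (f (m C)) = f (m C)" if "C \<in> D" for C
    using m[OF that] CP[OF _ that] f(1,2) by blast
  \<comment> \<open>The toggled element \<open>f (m C)\<close> is itself fixed by \<open>f\<close>,
    so toggling leaves the set of non-fixed elements, hence its least element, unchanged. That makes
    \<open>t\<close> an involution.\<close>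
  have nf: "{y \<in> t C. f y \<noteq> y} = {y \<in> C. f y \<noteq> y}" if "C \<in> D" for C
    using fm[OF that] by (auto simp: t_def)
  have mt: "m (t C) = m C" if "C \<in> D" for C
    using nf[OF that] by (simp add: m_def)
  have tD: "t C \<in> D" if C: "C \<in> D" for C
  proof -
    \<comment> \<open>An element above \<open>m C\<close> is above \<open>f (m C)\<close>. An
      element that is not above \<open>m C\<close> lies below it and is fixed, since
      \<open>m C\<close> is least among the non-fixed ones, so monotonicity of \<open>f\<close> puts
      it below \<open>f (m C)\<close>.\<close>
    have comp: "R (f (m C)) y \<or> R y (f (m C))" if y: "y \<in> C" for y
    proof -
      have P: "y \<in> P" "m C \<in> P" using y m[OF C] CP[OF _ C] by auto
      have "R (m C) y \<or> R y (m C)" using C y m[OF C] by (auto simp: D_def chains_in_def)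
      moreover have "R (f (m C)) y" if "R (m C) y"
        using trans[of "f (m C)" "m C" y] that f(1,3) P by blast
      moreover have "R y (f (m C))" if "R y (m C)" "f y = y"
        using f(4)[OF P that(1)] that(2) by simp
      moreover have "R (m C) y" if "f y \<noteq> y" using m[OF C] y that by blast
      ultimately show ?thesis by blast
    qed
    have "t C \<in> chains_in R P"
      using C comp fm[OF C] refl unfolding t_def D_def chains_in_def by auto
    moreover have "m C \<in> t C" using m[OF C] by (auto simp: t_def)
    ultimately show ?thesis using m[OF C] by (auto simp: D_def)
  qed
  have "(\<Sum>C\<in>D. (-1::int) ^ card C) = 0"
  proof (rule sum_sign_involution[where t = t])
    fix C assume C: "C \<in> D"
    show "t C \<in> D" by (rule tD[OF C])
    show "t (t C) = C" using mt[OF C] by (auto simp: t_def)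
    show "(-1::int) ^ card (t C) = - ((-1) ^ card C)"
    proof (cases "f (m C) \<in> C")
      case True
      then have "card C = Suc (card (t C))"
        using card.remove[OF finC[OF C]] by (simp add: t_def)
      then show ?thesis by simp
    next
      case False
      then show ?thesis using finC[OF C] by (simp add: t_def)
    qed
  qed
  moreover have "(\<Sum>C\<in>chains_in R P. (-1::int) ^ card C) =
      (\<Sum>C\<in>D. (-1) ^ card C) + (\<Sum>C\<in>chains_in R P - D. (-1) ^ card C)"
    using sum.subset_diff[of D "chains_in R P"] finite_chains_in[OF fin] by (simp add: D_def add.commute)
  moreover have "chains_in R P - D = chains_in R {x \<in> P. f x = x}"
    by (auto simp: D_def chains_in_def)
  ultimately show ?thesis by simp
qed

lemma sorted_wrt_less_set_inj:
  fixes xs ys :: "'b::order list"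
  assumes "sorted_wrt (<) xs" "sorted_wrt (<) ys" "set xs = set ys"
  shows "xs = ys"
  using assms
proof (induction xs arbitrary: ys)
  case Nil
  then show ?case by simp
next
  case (Cons x xs)
  then obtain y ys' where ys: "ys = y # ys'" by (cases ys) auto
  have "y = x"
  proof (rule ccontr)
    assume "y \<noteq> x"
    then have "y \<in> set xs" "x \<in> set ys'" using Cons.prems(3) ys by auto
    then have "x < y" "y < x" using Cons.prems(1,2) ys by auto
    then show False by simp
  qed
  moreover have "x \<notin> set xs" "y \<notin> set ys'" using Cons.prems(1,2) ys by auto
  ultimately have "set xs = set ys'" using Cons.prems(3) ys by auto
  then show ?case using Cons.IH[of ys'] Cons.prems(1,2) ys \<open>y = x\<close> by simp
qed

text \<open>Lists are what index the Hall products, sets are what the toggling argument acts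
  on.\<close>

lemma bij_betw_sorted_chains:
  fixes P :: "'b::order set"
  assumes "finite P"
  shows "bij_betw set {xs. sorted_wrt (<) xs \<and> set xs \<subseteq> P} (chains_in (\<le>) P)"
  unfolding bij_betw_def
proof (intro conjI equalityI subsetI)
  show "inj_on set {xs. sorted_wrt (<) xs \<and> set xs \<subseteq> P}"
    by (rule inj_onI) (use sorted_wrt_less_set_inj in blast)
next
  fix C assume "C \<in> set ` {xs. sorted_wrt (<) xs \<and> set xs \<subseteq> P}"
  then obtain xs where xs: "C = set xs" "sorted_wrt (<) xs" "set xs \<subseteq> P" by blast
  have "\<forall>x\<in>set xs. \<forall>y\<in>set xs. x \<le> y \<or> y \<le> x"
    using xs(2) by (induction xs) (auto simp: less_imp_le)
  then show "C \<in> chains_in (\<le>) P" using xs by (auto simp: chains_in_def)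
next
  fix C assume "C \<in> chains_in (\<le>) P"
  then have C: "C \<subseteq> P" "\<And>x y. x \<in> C \<Longrightarrow> y \<in> C \<Longrightarrow> x \<le> y \<or> y \<le> x"
    by (auto simp: chains_in_def)
  have "finite C" using C(1) assms finite_subset by blast
  then have "\<exists>xs. sorted_wrt (<) xs \<and> set xs = C" using C
  proof (induction "card C" arbitrary: C)
    case 0
    then show ?case by (intro exI[of _ "[]"]) auto
  next
    case (Suc n)
    have "\<exists>x\<in>C. \<forall>y\<in>C. x \<le> y"
      by (rule finite_chain_least) (use Suc in \<open>auto intro: order_trans\<close>)
    then obtain x where x: "x \<in> C" "\<forall>y\<in>C. x \<le> y" by blast
    have "\<exists>xs. sorted_wrt (<) xs \<and> set xs = C - {x}"
    proof (rule Suc.hyps(1))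
      show "n = card (C - {x})" using Suc.hyps(2) x Suc.prems(1) by simp
      show "finite (C - {x})" "C - {x} \<subseteq> P" using Suc.prems by auto
      show "a \<le> b \<or> b \<le> a" if "a \<in> C - {x}" "b \<in> C - {x}" for a b
        using Suc.prems(3)[of a b] that by simp
    qed
    then obtain xs where xs: "sorted_wrt (<) xs" "set xs = C - {x}" by blast
    have "sorted_wrt (<) (x # xs) \<and> set (x # xs) = C" using xs x by (auto simp: less_le)
    then show ?case by blast
  qed
  then show "C \<in> set ` {xs. sorted_wrt (<) xs \<and> set xs \<subseteq> P}" using C(1) by blast
qed

text \<open>
  Applied to the subrepresentations of a self-dual representation, with \<open>th\<close> the stability and \<open>rk\<close> the
  total dimension.
\<close>

locale polarised_lattice =
  fixes L :: "'b::semilattice_inf set" and join :: "'b \<Rightarrow> 'b \<Rightarrow> 'b" and perp :: "'b \<Rightarrow> 'b"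
    and z :: 'b and th rk :: "'b \<Rightarrow> int"
  assumes fin: "finite L"
    and inf_closed: "\<And>x y. x \<in> L \<Longrightarrow> y \<in> L \<Longrightarrow> inf x y \<in> L"
    and join_closed: "\<And>x y. x \<in> L \<Longrightarrow> y \<in> L \<Longrightarrow> join x y \<in> L"
    and join_ub: "\<And>x y. x \<in> L \<Longrightarrow> y \<in> L \<Longrightarrow> x \<le> join x y" "\<And>x y. x \<in> L \<Longrightarrow> y \<in> L \<Longrightarrow> y \<le> join x y"
    and join_least: "\<And>x y w. x \<in> L \<Longrightarrow> y \<in> L \<Longrightarrow> w \<in> L \<Longrightarrow> x \<le> w \<Longrightarrow> y \<le> w \<Longrightarrow> join x y \<le> w"
    and perp_closed: "\<And>x. x \<in> L \<Longrightarrow> perp x \<in> L"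
    and perp_anti: "\<And>x y. x \<in> L \<Longrightarrow> y \<in> L \<Longrightarrow> x \<le> y \<Longrightarrow> perp y \<le> perp x"
    and perp_perp: "\<And>x. x \<in> L \<Longrightarrow> perp (perp x) = x"
    and z: "z \<in> L" "\<And>x. x \<in> L \<Longrightarrow> z \<le> x" "th z = 0"
    and th_modular: "\<And>x y. x \<in> L \<Longrightarrow> y \<in> L \<Longrightarrow> th (inf x y) + th (join x y) = th x + th y"
    and rk_modular: "\<And>x y. x \<in> L \<Longrightarrow> y \<in> L \<Longrightarrow> rk (inf x y) + rk (join x y) = rk x + rk y"
    and rk_strict: "\<And>x y. x \<in> L \<Longrightarrow> y \<in> L \<Longrightarrow> x < y \<Longrightarrow> rk x < rk y"
    and th_perp: "\<And>x. x \<in> L \<Longrightarrow> th (perp x) = th x"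
begin

definition isotr :: "'b set" where
  "isotr = {x \<in> L. x \<le> perp x}"

definition mu :: "'b \<Rightarrow> 'b \<Rightarrow> rat" where
  "mu a w = of_int (th w - th a) / of_int (rk w - rk a)"

definition ss :: "'b \<Rightarrow> 'b \<Rightarrow> bool" where
  "ss a w \<longleftrightarrow> (\<forall>x\<in>L. a \<le> x \<longrightarrow> x \<le> w \<longrightarrow> x \<noteq> a \<longrightarrow> x \<noteq> w \<longrightarrow> mu a x \<le> mu a w)"

text \<open>Semistability of the reduction at \<open>a\<close>: its isotropic subobjects are the
  isotropic \<open>w\<close> above \<open>a\<close>, and since ranks increase strictly, having slope
  at most 0 is a comparison of degrees.\<close>

definition sd_ss :: "'b \<Rightarrow> bool" where
  "sd_ss a \<longleftrightarrow> (\<forall>w\<in>isotr. a < w \<longrightarrow> th w \<le> th a)"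

fun asc :: "'b \<Rightarrow> 'b list \<Rightarrow> bool" where
  "asc a [] = True"
| "asc a (w # ws) = (a < w \<and> w \<in> isotr \<and> asc w ws)"

fun slopes :: "'b \<Rightarrow> 'b list \<Rightarrow> rat list" where
  "slopes a [] = []"
| "slopes a (w # ws) = mu a w # slopes w ws"

text \<open>The slope conditions say that the list of slopes followed by 0 is strictly decreasing;
  positivity at each step and a comparison with all later slopes are the recursive form of the
  \<open>sorted_wrt (>)\<close> in \<open>HN_tuples\<close>.\<close>

fun HN :: "'b \<Rightarrow> 'b list \<Rightarrow> bool" where
  "HN a [] = sd_ss a"
| "HN a (w # ws) = (a < w \<and> w \<in> isotr \<and> ss a w \<and> 0 < mu a w \<and> (\<forall>x\<in>set (slopes w ws). x < mu a w) \<and> HN w ws)"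

lemma isotr_L: "x \<in> isotr \<Longrightarrow> x \<in> L"
  by (simp add: isotr_def)

lemma finite_isotr: "finite isotr"
  using fin by (simp add: isotr_def)

lemma isotr_down: "w \<in> isotr \<Longrightarrow> x \<in> L \<Longrightarrow> x \<le> w \<Longrightarrow> x \<in> isotr"
  using perp_anti[of x w] unfolding isotr_def by (auto intro: order_trans)

lemma rk_mono: "x \<in> L \<Longrightarrow> y \<in> L \<Longrightarrow> x \<le> y \<Longrightarrow> rk x \<le> rk y"
  using rk_strict[of x y] by (auto simp: less_le)

lemma perp_join:
  assumes "x \<in> L" "y \<in> L"
  shows "perp (join x y) = inf (perp x) (perp y)"
proof (rule antisym)
  show "perp (join x y) \<le> inf (perp x) (perp y)"
    using assms by (simp add: perp_anti join_ub join_closed)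
  let ?i = "inf (perp x) (perp y)"
  have L: "?i \<in> L" using assms by (simp add: inf_closed perp_closed)
  have "perp (perp x) \<le> perp ?i" "perp (perp y) \<le> perp ?i"
    using perp_anti[OF L, of "perp x"] perp_anti[OF L, of "perp y"] assms
    by (simp_all add: perp_closed)
  then have "join x y \<le> perp ?i"
    using assms L by (simp add: perp_perp join_least perp_closed)
  then have "perp (perp ?i) \<le> perp (join x y)"
    using assms L by (simp add: perp_anti perp_closed join_closed)
  then show "?i \<le> perp (join x y)" using L by (simp add: perp_perp)
qed

text \<open>Orthogonality is symmetric because \<open>perp\<close> is an order-reversing involution,
  so both x and y lie below both complements.\<close>

lemma join_isotr:
  assumes "x \<in> isotr" "y \<in> isotr" "x \<le> perp y"
  shows "join x y \<in> isotr"
proof -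
  note L = isotr_L[OF assms(1)] isotr_L[OF assms(2)]
  have "y \<le> perp x" using perp_anti[OF L(1) perp_closed[OF L(2)] assms(3)] L perp_perp by simp
  then have "join x y \<le> inf (perp x) (perp y)"
    using assms L by (intro join_least) (auto simp: isotr_def inf_closed perp_closed)
  then show ?thesis using L by (simp add: isotr_def perp_join join_closed)
qed

text \<open>Modularity for \<open>w\<close> and \<open>perp v\<close>, with the join reflected: its
  complement is \<open>inf (perp w) v\<close>, which has the same degree. The join may be far from
  isotropic, whereas \<open>inf (perp w) v\<close> lies below \<open>v\<close>.\<close>

lemma th_inf_perp:
  assumes "w \<in> L" "v \<in> L"
  shows "th (inf w (perp v)) = th w + th v - th (inf (perp w) v)"
proof -
  have "perp (join w (perp v)) = inf (perp w) v"
    using assms by (simp add: perp_join perp_closed perp_perp)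
  then have "th (join w (perp v)) = th (inf (perp w) v)"
    using th_perp[of "join w (perp v)"] assms by (simp add: join_closed perp_closed)
  then show ?thesis
    using th_modular[of w "perp v"] th_perp[of v] assms by (simp add: perp_closed)
qed

lemma mu_eq:
  assumes "a \<in> L" "w \<in> L" "a < w"
  shows "mu a w * of_int (rk w - rk a) = of_int (th w - th a)"
  using rk_strict[OF assms] by (simp add: mu_def)

lemma mu_le_iff:
  assumes "a \<in> L" "w \<in> L" "a < w"
  shows "mu a w \<le> c \<longleftrightarrow> of_int (th w - th a) \<le> c * of_int (rk w - rk a)"
  using rk_strict[OF assms] unfolding mu_def by (subst pos_divide_le_eq) auto

lemma mu_pos_iff:
  assumes "a \<in> L" "w \<in> L" "a < w"
  shows "0 < mu a w \<longleftrightarrow> th a < th w"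
  using rk_strict[OF assms] by (simp add: mu_def zero_less_divide_iff)

lemma ss_le:
  assumes "a \<in> L" "w \<in> L" "a < w" "ss a w" "x \<in> L" "a \<le> x" "x \<le> w"
  shows "of_int (th x - th a) \<le> mu a w * of_int (rk x - rk a)"
proof -
  consider "x = a" | "x = w" | "x \<noteq> a" "x \<noteq> w" by blast
  then show ?thesis
  proof cases
    case 1
    then show ?thesis by simp
  next
    case 2
    then show ?thesis using mu_eq assms by simp
  next
    case 3
    then have "mu a x \<le> mu a w" "a < x" using assms by (auto simp: ss_def)
    then show ?thesis using mu_le_iff assms by blast
  qed
qed

section \<open>Existence and uniqueness of Harder-Narasimhan chains\<close>

lemma HN_last:
  assumes "a \<in> isotr" "HN a ws"
  shows "last (a # ws) \<in> isotr \<and> a \<le> last (a # ws) \<and> sd_ss (last (a # ws))"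
  using assms
proof (induction ws arbitrary: a)
  case Nil
  then show ?case by simp
next
  case (Cons w ws)
  then have "last (w # ws) \<in> isotr \<and> w \<le> last (w # ws) \<and> sd_ss (last (w # ws))" by simp
  then show ?case using Cons.prems by (auto dest: less_imp_le order_trans)
qed

text \<open>Positive slopes make the degree grow along the chain. An \<open>x\<close> below the last
  term splits into \<open>inf x w\<close>, of degree at most th w by semistability and positivity of
  the slope of w, and \<open>join x w\<close> above w, which is left to the rest of the
  chain.\<close>

lemma HN_sub_th_le:
  assumes "a \<in> isotr" "HN a ws" "x \<in> L" "a \<le> x" "x \<le> last (a # ws)"
  shows "th x \<le> th (last (a # ws))"
  using assms
proof (induction ws arbitrary: a x)
  case Nil
  then show ?case by (simp add: antisym)
next
  case (Cons w ws)
  let ?v = "last (w # ws)"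
  have w: "w \<in> isotr" "HN w ws" "a < w" "ss a w" "0 < mu a w" using Cons.prems by auto
  note L = isotr_L[OF Cons.prems(1)] isotr_L[OF w(1)]
  have v: "?v \<in> isotr" "w \<le> ?v" using HN_last[OF w(1,2)] by auto
  have xv: "x \<le> ?v" using Cons.prems(5) by simp
  have 1: "th (join x w) \<le> th ?v"
    using Cons.IH[OF w(1,2), of "join x w"] v xv Cons.prems(3) L
    by (simp add: join_closed join_ub join_least isotr_L)
  have y: "inf x w \<in> L" "a \<le> inf x w" "inf x w \<le> w"
    using Cons.prems L w by (auto simp: inf_closed)
  have "of_int (th (inf x w) - th a) \<le> mu a w * of_int (rk (inf x w) - rk a)"
    by (rule ss_le[OF L w(3,4) y])
  also have "\<dots> \<le> mu a w * of_int (rk w - rk a)"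
    using rk_mono[OF y(1) L(2) y(3)] w(5) by (intro mult_left_mono) auto
  also have "\<dots> = of_int (th w - th a)" by (rule mu_eq[OF L w(3)])
  finally have "th (inf x w) \<le> th w" by simp
  then show ?case using 1 th_modular[OF Cons.prems(3) L(2)] by simp
qed

text \<open>The same splitting as in \<open>HN_sub_th_le\<close>, now with the degree weighed
  against \<open>c\<close> times the rank. Both are additive over the two pieces, and each
  nontrivial piece has slope below \<open>c\<close>.\<close>

lemma HN_sub_less:
  assumes "a \<in> isotr" "HN a ws" "\<forall>s\<in>set (slopes a ws). s < c"
    and "x \<in> L" "a < x" "x \<le> last (a # ws)"
  shows "of_int (th x - th a) < c * of_int (rk x - rk a)"
  using assms
proof (induction ws arbitrary: a x)
  case Nil
  then show ?case by simp
next
  case (Cons w ws)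
  let ?v = "last (w # ws)" and ?x = "join x w" and ?y = "inf x w"
  have w: "w \<in> isotr" "HN w ws" "a < w" "ss a w" "mu a w < c" using Cons.prems by auto
  note L = isotr_L[OF Cons.prems(1)] isotr_L[OF w(1)]
  have v: "?v \<in> isotr" "w \<le> ?v" using HN_last[OF w(1,2)] by auto
  have xv: "x \<le> ?v" using Cons.prems(6) by simp
  have X: "?x \<in> L" "w \<le> ?x" "?x \<le> ?v" using Cons.prems(4) L v xv
    by (auto simp: join_closed join_ub join_least isotr_L)
  have y: "?y \<in> L" "a \<le> ?y" "?y \<le> w" using Cons.prems L w by (auto simp: inf_closed)
  have 1: "of_int (th ?x - th w) < c * of_int (rk ?x - rk w)" if "?x \<noteq> w"
    using Cons.IH[OF w(1,2), of ?x] X Cons.prems(3) that by auto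
  have 2: "of_int (th ?y - th a) < c * of_int (rk ?y - rk a)" if "?y \<noteq> a"
  proof -
    have "of_int (th ?y - th a) \<le> mu a w * of_int (rk ?y - rk a)"
      by (rule ss_le[OF L w(3,4) y])
    also have "\<dots> < c * of_int (rk ?y - rk a)"
      using w(5) rk_strict[OF L(1) y(1)] order.not_eq_order_implies_strict[OF that[symmetric] y(2)]
      by (intro mult_strict_right_mono) auto
    finally show ?thesis .
  qed
  \<comment> \<open>Strictness needs one nontrivial piece: if both were trivial, \<open>x\<close>
    would have the rank of \<open>a\<close>.\<close>
  have 3: "?x \<noteq> w \<or> ?y \<noteq> a"
  proof (rule ccontr)
    assume "\<not> (?x \<noteq> w \<or> ?y \<noteq> a)"
    then have "rk x = rk a" using rk_modular[OF Cons.prems(4) L(2)] by simp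
    then show False using rk_strict[OF L(1) Cons.prems(4,5)] by simp
  qed
  have e: "of_int (th x - th a) = (of_int (th ?x - th w) + of_int (th ?y - th a) :: rat)"
    using th_modular[OF Cons.prems(4) L(2)] by (simp flip: of_int_add)
  have e': "c * of_int (rk x - rk a) = c * of_int (rk ?x - rk w) + c * of_int (rk ?y - rk a)"
    using rk_modular[OF Cons.prems(4) L(2)] by (simp flip: of_int_add distrib_left)
  show ?case unfolding e e' using 1 2 3 by (cases "?x = w"; cases "?y = a") auto
qed

text \<open>Let v be the last term. Replacing w by its part in \<open>perp v\<close> costs no
  degree, by \<open>th_inf_perp\<close>, because \<open>inf (perp w) v\<close> has degree at most th
  v (\<open>HN_sub_th_le\<close>). That part is orthogonal to v, so its join with v is isotropic,
  and semistability at v bounds the degree of the join by th v; modularity then moves the degree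
  into \<open>inf w v\<close>.\<close>

lemma HN_isotr_th_le:
  assumes "a \<in> isotr" "HN a ws" "w \<in> isotr" "a \<le> w"
  shows "th w \<le> th (inf w (last (a # ws)))"
proof -
  define v where "v = last (a # ws)"
  have v: "v \<in> isotr" "a \<le> v" "sd_ss v" using HN_last[OF assms(1,2)] by (auto simp: v_def)
  note L = isotr_L[OF assms(3)] isotr_L[OF v(1)] isotr_L[OF assms(1)]
  let ?u = "inf w (perp v)"
  have "a \<le> perp w" using assms by (auto simp: isotr_def intro: order_trans)
  then have "th (inf (perp w) v) \<le> th v"
    using HN_sub_th_le[OF assms(1,2), of "inf (perp w) v", folded v_def] v(2) L
    by (simp add: inf_closed perp_closed)
  then have 1: "th w \<le> th ?u" using th_inf_perp[OF L(1,2)] by simp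
  have u: "?u \<in> isotr" "?u \<le> perp v"
    using isotr_down[OF assms(3)] L by (auto simp: inf_closed perp_closed)
  have j: "join ?u v \<in> isotr" by (rule join_isotr[OF u(1) v(1) u(2)])
  have "v \<le> join ?u v" using u v by (simp add: join_ub isotr_L)
  then have "th (join ?u v) \<le> th v" using v(3) j by (auto simp: sd_ss_def less_le)
  then have "th ?u \<le> th (inf ?u v)"
    using th_modular[OF isotr_L[OF u(1)] L(2)] by simp
  moreover have "inf ?u v = inf w v"
    using v(1) by (simp add: isotr_def inf.absorb2 inf.assoc)
  ultimately show ?thesis using 1 by (simp add: v_def)
qed

text \<open>
  Cut \<open>w\<close> along the chain \<open>a \<le> v \<le> \<dots> \<le> l \<le> l\<^sup>\<bottom>\<close>: the pieces below \<open>l\<close> have slope at most \<open>mu a v\<close>,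
  strictly above \<open>v\<close>, and the pieces above \<open>l\<close> have nonpositive degree.
\<close>

lemma HN_first:
  assumes "a \<in> isotr" "HN a (v # vs)" "w \<in> isotr" "a < w"
  shows "mu a w \<le> mu a v" and "mu a w = mu a v \<Longrightarrow> w \<le> v"
proof -
  let ?l = "last (v # vs)" and ?c = "mu a v"
  have v: "v \<in> isotr" "HN v vs" "a < v" "ss a v" "0 < mu a v" "\<forall>x\<in>set (slopes v vs). x < mu a v"
    using assms(2) by auto
  have l: "?l \<in> isotr" "v \<le> ?l" using HN_last[OF v(1,2)] by auto
  note L = isotr_L[OF assms(1)] isotr_L[OF v(1)] isotr_L[OF assms(3)] isotr_L[OF l(1)]
  define x where "x = inf w ?l"
  have x: "x \<in> L" "a \<le> x" "x \<le> ?l" "x \<le> w"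
    using L assms v l by (auto simp: x_def inf_closed)
  have y: "inf x v \<in> L" "a \<le> inf x v" "inf x v \<le> v" using x v L by (auto simp: inf_closed)
  have j: "join x v \<in> L" "v \<le> join x v" "join x v \<le> ?l"
    using x v l L by (auto simp: join_closed join_ub join_least)
  have 1: "of_int (th (inf x v) - th a) \<le> ?c * of_int (rk (inf x v) - rk a)"
    by (rule ss_le[OF L(1,2) v(3,4) y])
  have 2: "of_int (th (join x v) - th v) < ?c * of_int (rk (join x v) - rk v)" if "join x v \<noteq> v"
    using HN_sub_less[OF v(1,2,6) j(1)] j that by auto
  have e: "of_int (th x - th a) = (of_int (th (join x v) - th v) + of_int (th (inf x v) - th a) :: rat)"
    using th_modular[OF x(1) L(2)] by (simp flip: of_int_add)
  have e': "?c * of_int (rk x - rk a) =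
      ?c * of_int (rk (join x v) - rk v) + ?c * of_int (rk (inf x v) - rk a)"
    using rk_modular[OF x(1) L(2)] by (simp flip: of_int_add distrib_left)
  have 3: "of_int (th x - th a) \<le> ?c * of_int (rk x - rk a)"
    unfolding e e' using 1 2 by (cases "join x v = v") auto
  have 4: "of_int (th x - th a) < ?c * of_int (rk x - rk a)" if "\<not> x \<le> v"
  proof -
    have "join x v \<noteq> v" using that join_ub(1)[OF x(1) L(2)] by auto
    then show ?thesis unfolding e e' using 1 2 by simp
  qed
  have 5: "?c * of_int (rk x - rk a) \<le> ?c * of_int (rk w - rk a)"
    using rk_mono[OF x(1) L(3) x(4)] v(5) by (intro mult_left_mono) auto
  have 6: "?c * of_int (rk x - rk a) < ?c * of_int (rk w - rk a)" if "x \<noteq> w"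
    using rk_strict[OF x(1) L(3)] x(4) that v(5) by (intro mult_strict_left_mono) auto
  have 7: "(of_int (th w - th a) :: rat) \<le> of_int (th x - th a)"
    using HN_isotr_th_le[OF assms(1,2,3)] assms(4) by (simp add: x_def)
  show "mu a w \<le> mu a v"
    using 3 5 7 mu_le_iff[OF L(1,3) assms(4)] by (meson order_trans)
  show "w \<le> v" if "mu a w = mu a v"
  proof (rule ccontr)
    assume nw: "\<not> w \<le> v"
    \<comment> \<open>Either \<open>w\<close> is below the last term, and then it is not below
      \<open>v\<close>, so that (4) is strict, or cutting \<open>w\<close> loses rank and (6) is
      strict.\<close>
    have "(of_int (th w - th a) :: rat) < ?c * of_int (rk w - rk a)"
    proof (cases "x = w")
      case True
      then show ?thesis using 4 5 7 nw by simp
    next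
      case False
      show ?thesis using 3 6[OF False] 7 by linarith
    qed
    then show False using mu_eq[OF L(1,3) assms(4)] that by simp
  qed
qed

text \<open>Applying \<open>HN_first\<close> to each chain against the first term of the other gives
  equal slopes, and the equality case then gives both inclusions. An empty chain means semistability
  at \<open>a\<close>, which excludes a step of positive slope.\<close>

lemma HN_unique:
  assumes "a \<in> isotr" "HN a vs" "HN a ws"
  shows "vs = ws"
  using assms
proof (induction vs arbitrary: a ws)
  case Nil
  then show ?case
  proof (cases ws)
    case (Cons w ws')
    then have w: "a < w" "w \<in> isotr" "0 < mu a w" using Nil.prems by auto
    then have "th w \<le> th a" using Nil.prems by (auto simp: sd_ss_def)
    then show ?thesis using mu_pos_iff w Nil.prems(1) isotr_L by (meson not_less)
  qed simp
next
  case (Cons v vs)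
  have v: "a < v" "v \<in> isotr" "0 < mu a v" "HN v vs" using Cons.prems by auto
  show ?case
  proof (cases ws)
    case Nil
    then have "th v \<le> th a" using Cons.prems v by (auto simp: sd_ss_def)
    then show ?thesis using mu_pos_iff v Cons.prems(1) isotr_L by (meson not_less)
  next
    case (Cons w ws')
    have w: "a < w" "w \<in> isotr" "HN w ws'" using Cons.prems Cons by auto
    note V = HN_first[OF Cons.prems(1,2) w(2,1)]
    note W = HN_first[OF Cons.prems(1) Cons.prems(3)[unfolded Cons] v(2,1)]
    have "v = w" using V W by (intro antisym) auto
    then show ?thesis using Cons.IH[OF v(2,4)] w Cons by blast
  qed
qed

lemma HN_slopes_le: "HN a (w # ws) \<Longrightarrow> s \<in> set (slopes a (w # ws)) \<Longrightarrow> s \<le> mu a w"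
  by (auto simp: less_imp_le)

text \<open>Induction on the number of isotropic elements above \<open>a\<close>. Maximising the
  rank among the elements of maximal slope is what makes the next slope strictly smaller.\<close>

lemma HN_exists:
  assumes "a \<in> isotr"
  shows "\<exists>ws. HN a ws"
  using assms
proof (induction "card {w \<in> isotr. a < w}" arbitrary: a rule: less_induct)
  case less
  show ?case
  proof (cases "sd_ss a")
    case True
    then show ?thesis by (intro exI[of _ "[]"]) simp
  next
    case False
    let ?S = "{w \<in> isotr. a < w}"
    have finS: "finite ?S" using finite_isotr by simp
    obtain w0 where w0: "w0 \<in> isotr" "a < w0" "th a < th w0"
      using False by (auto simp: sd_ss_def)
    define M where "M = Max (mu a ` ?S)"
    have M: "mu a w \<le> M" if "w \<in> ?S" for w using finS that by (simp add: M_def)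
    have "M \<in> mu a ` ?S" unfolding M_def using finS w0 by (intro Max_in) auto
    then have "{w \<in> ?S. mu a w = M} \<noteq> {}" by auto
    then obtain u where u: "u \<in> {w \<in> ?S. mu a w = M}" "\<And>w. w \<in> {w \<in> ?S. mu a w = M} \<Longrightarrow> rk w \<le> rk u"
    proof -
      assume ne: "{w \<in> ?S. mu a w = M} \<noteq> {}"
      have "finite {w \<in> ?S. mu a w = M}" using finite_isotr by simp
      from finite_has_max_image[OF this ne, of rk] show thesis using that by blast
    qed
    have u': "u \<in> isotr" "a < u" "mu a u = M" using u(1) by auto
    note L = isotr_L[OF less.prems] isotr_L[OF u'(1)]
    have "0 < M" using M[of w0] w0 mu_pos_iff[OF L(1) isotr_L[OF w0(1)] w0(2)] by simp
    have "{w \<in> isotr. u < w} \<subset> ?S" using u' by (auto intro: less_trans)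
    then obtain ws where ws: "HN u ws"
      using less.hyps[OF _ u'(1)] psubset_card_mono[OF finS] by blast
    have "ss a u" unfolding ss_def
    proof (intro ballI impI)
      fix x assume x: "x \<in> L" "a \<le> x" "x \<le> u" "x \<noteq> a"
      then have "x \<in> ?S" using isotr_down[OF u'(1)] by auto
      then show "mu a x \<le> mu a u" using M u'(3) by blast
    qed
    moreover have "s < mu a u" if "s \<in> set (slopes u ws)" for s
    proof (cases ws)
      case (Cons v vs)
      have v: "v \<in> isotr" "u < v" using ws Cons by auto
      note Lv = isotr_L[OF v(1)]
      have av: "a < v" using u'(2) v(2) by simp
      \<comment> \<open>If v over u had slope at least M, so would v over a, by adding numerators
        and denominators; v would then attain the maximal slope with a rank larger than that of
        u.\<close>
      have "mu u v < M"
      proof (rule ccontr)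
        assume "\<not> mu u v < M"
        then have "M * of_int (rk v - rk u) \<le> mu u v * of_int (rk v - rk u)"
          using rk_strict[OF L(2) Lv v(2)] by (intro mult_right_mono) auto
        then have "M * of_int (rk v - rk u) \<le> of_int (th v - th u)"
          using mu_eq[OF L(2) Lv v(2)] by simp
        moreover have "M * of_int (rk u - rk a) = of_int (th u - th a)"
          using mu_eq[OF L u'(2)] u'(3) by simp
        ultimately have "M * of_int (rk v - rk a) \<le> of_int (th v - th a)"
          by (simp add: algebra_simps)
        then have "M \<le> mu a v"
          using rk_strict[OF L(1) Lv av] unfolding mu_def by (subst pos_le_divide_eq) auto
        then have "mu a v = M" using M[of v] v(1) av by simp
        then have "rk v \<le> rk u" using u(2)[of v] v(1) av by simp
        then show False using rk_strict[OF L(2) Lv v(2)] by simp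
      qed
      moreover have "s \<le> mu u v" using HN_slopes_le ws that Cons by blast
      ultimately show ?thesis using u'(3) by simp
    qed (use that in simp)
    ultimately have "HN a (u # ws)" using u' ws \<open>0 < M\<close> by simp
    then show ?thesis by blast
  qed
qed

lemma card_HN: "a \<in> isotr \<Longrightarrow> card {ws. HN a ws} = 1"
  using HN_exists[of a] HN_unique[of a] by (auto simp: card_1_singleton_iff)

section \<open>The signed count of destabilising chains\<close>

definition destab :: "'b set" where
  "destab = {x \<in> isotr. 0 < th x}"

lemma chain_sum_destab:
  assumes "destab \<noteq> {}"
  shows "(\<Sum>C\<in>chains_in (\<le>) destab. (-1::int) ^ card C) = 0"
proof -
  have finP: "finite destab" using finite_isotr by (simp add: destab_def)
  obtain u where u: "u \<in> destab" "\<And>w. w \<in> destab \<Longrightarrow> th w \<le> th u"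
    using finite_has_max_image[OF finP assms, of th] by blast
  have ui: "u \<in> isotr" "0 < th u" using u(1) by (auto simp: destab_def)
  note uL = isotr_L[OF ui(1)]
  \<comment> \<open>Isotropic elements outside \<open>destab\<close> have degree at most 0 < th u,
    so \<open>u\<close> is maximal among all isotropic elements.\<close>
  have max: "th w \<le> th u" if "w \<in> isotr" for w
    using u(2)[of w] that ui(2) by (cases "0 < th w") (auto simp: destab_def)
  have P: "w \<in> isotr" "w \<in> L" if "w \<in> destab" for w using that by (auto simp: destab_def isotr_L)
  let ?f = "\<lambda>w. inf w (perp u)"
  let ?Q = "{w \<in> destab. ?f w = w}"
  have Q: "?Q = {w \<in> destab. w \<le> perp u}" by (auto simp: inf.absorb_iff1)
  have 1: "(\<Sum>C\<in>chains_in (\<le>) destab. (-1::int) ^ card C) = (\<Sum>C\<in>chains_in (\<le>) ?Q. (-1) ^ card C)"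
  proof (rule chain_sum_kernel_operator[OF finP])
    fix x assume x: "x \<in> destab"
    \<comment> \<open>This element lies below \<open>u\<close>, so its degree is at most th u. By
      \<open>th_inf_perp\<close>, cutting \<open>x\<close> with \<open>perp u\<close> then does not
      lower the degree, and the cut stays in \<open>destab\<close>.\<close>
    have "inf (perp x) u \<in> isotr"
      using isotr_down[OF ui(1)] P[OF x] uL by (simp add: inf_closed perp_closed)
    then have "th x \<le> th (?f x)" using th_inf_perp[OF P(2)[OF x] uL] max by fastforce
    then show "?f x \<in> destab"
      using x isotr_down[OF P(1)[OF x], of "?f x"] P[OF x] uL
      by (auto simp: destab_def inf_closed perp_closed)
    show "?f (?f x) = ?f x" by (simp add: inf.assoc)
  qed (auto intro: inf.coboundedI1 order_trans)
  let ?g = "\<lambda>w. join w u"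
  let ?R = "{w \<in> ?Q. ?g w = w}"
  have R: "u \<le> w" if "w \<in> ?R" for w
  proof -
    have "w \<in> L" "join w u = w" using that P by auto
    then show ?thesis using join_ub(2)[OF _ uL, of w] by simp
  qed
  have uR: "u \<in> ?R"
    using u(1) ui uL by (auto simp: Q isotr_def join_ub join_least inf.absorb1 intro!: antisym)
  \<comment> \<open>Adding \<open>u\<close> increases elements, so it is a kernel operator for the
    reversed order; a chain for one order is a chain for the other.\<close>
  have 2: "(\<Sum>C\<in>chains_in (\<ge>) ?Q. (-1::int) ^ card C) = (\<Sum>C\<in>chains_in (\<ge>) ?R. (-1) ^ card C)"
  proof (rule chain_sum_kernel_operator)
    show "finite ?Q" using finP by simp
    fix x assume "x \<in> ?Q"
    then have x: "x \<in> destab" "x \<le> perp u" unfolding Q by auto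
    note xi = P(1)[OF x(1)] and xL = P(2)[OF x(1)]
    have "inf x u \<in> isotr" using isotr_down[OF xi] xL uL by (simp add: inf_closed)
    then have "th x \<le> th (?g x)" using max[of "inf x u"] th_modular[OF xL uL] by simp
    then have "?g x \<in> destab"
      using join_isotr[OF xi ui(1) x(2)] x(1) by (auto simp: destab_def)
    moreover have "?g x \<le> perp u"
      using ui(1) x(2) xL uL by (intro join_least) (auto simp: isotr_def perp_closed)
    ultimately show "?g x \<in> ?Q" unfolding Q by blast
    show "?g (?g x) = ?g x"
    proof (rule antisym)
      show "?g (?g x) \<le> ?g x" using xL uL by (intro join_least) (auto simp: join_ub join_closed)
      show "?g x \<le> ?g (?g x)" using join_ub(1)[OF join_closed[OF xL uL] uL] .
    qed
    show "x \<le> ?g x" using xL uL by (simp add: join_ub)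
    fix y assume "y \<in> ?Q" "y \<le> x"
    then have "y \<in> L" using P by auto
    then show "?g y \<le> ?g x"
      using xL uL \<open>y \<le> x\<close> by (intro join_least) (auto simp: join_closed join_ub intro: order_trans)
  qed (auto intro: order_trans)
  have sw: "chains_in (\<ge>) X = chains_in (\<le>) X" for X :: "'b set" by (auto simp: chains_in_def)
  \<comment> \<open>\<open>u\<close> is the least element of what remains, so the constant map to
    \<open>u\<close> is a kernel operator; the two chains {} and {u} that survive cancel.\<close>
  have 3: "(\<Sum>C\<in>chains_in (\<le>) ?R. (-1::int) ^ card C) =
      (\<Sum>C\<in>chains_in (\<le>) {x \<in> ?R. u = x}. (-1) ^ card C)"
    by (rule chain_sum_kernel_operator[where f = "\<lambda>_. u"])
       (use finP uR R in \<open>auto intro: order_trans\<close>)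
  have "{x \<in> ?R. u = x} = {u}" using uR by blast
  moreover have "chains_in (\<le>) {u} = {{}, {u}}" by (auto simp: chains_in_def)
  ultimately show ?thesis using 1 2 3 by (simp add: sw)
qed

lemma asc_iff:
  "asc a ws \<longleftrightarrow> sorted_wrt (<) (a # ws) \<and> set ws \<subseteq> isotr"
proof (induction ws arbitrary: a)
  case (Cons w ws)
  then show ?case by (auto intro: less_trans)
qed simp

text \<open>As \<open>th z\<close> = 0, an element of positive degree differs from \<open>z\<close>,
  so these lists enumerate exactly the chains in \<open>destab\<close>. If \<open>destab\<close> is
  empty only the empty chain counts, and this is the semistable case.\<close>

lemma asc_destab_sum:
  "(\<Sum>ws | asc z ws \<and> (\<forall>w\<in>set ws. 0 < th w). (-1::int) ^ length ws) = of_bool (sd_ss z)"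
proof -
  have finP: "finite destab" using finite_isotr by (simp add: destab_def)
  have gt: "z < w" if "w \<in> destab" for w
    using that z(2)[of w] z(3) isotr_L[of w] by (auto simp: destab_def less_le)
  have e: "{ws. asc z ws \<and> (\<forall>w\<in>set ws. 0 < th w)} = {ws. sorted_wrt (<) ws \<and> set ws \<subseteq> destab}"
    using gt by (auto simp: asc_iff destab_def)
  have "(\<Sum>ws | sorted_wrt (<) ws \<and> set ws \<subseteq> destab. (-1::int) ^ length ws) =
      (\<Sum>ws | sorted_wrt (<) ws \<and> set ws \<subseteq> destab. (-1::int) ^ card (set ws))"
  proof (rule sum.cong[OF refl])
    fix ws :: "'b list" assume "ws \<in> {ws. sorted_wrt (<) ws \<and> set ws \<subseteq> destab}"
    then have "sorted_wrt (<) ws" by simp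
    then have "distinct ws" by (induction ws) auto
    then show "(-1::int) ^ length ws = (-1) ^ card (set ws)" by (simp add: distinct_card)
  qed
  also have "\<dots> = (\<Sum>C\<in>chains_in (\<le>) destab. (-1) ^ card C)"
    by (rule sum.reindex_bij_betw[OF bij_betw_sorted_chains[OF finP]])
  also have "\<dots> = of_bool (sd_ss z)"
  proof (cases "destab = {}")
    case True
    then have "sd_ss z" using z(3) by (force simp: sd_ss_def destab_def)
    moreover have "chains_in (\<le>) ({} :: 'b set) = {{}}" by (auto simp: chains_in_def)
    ultimately show ?thesis using True by simp
  next
    case False
    then have "\<not> sd_ss z" using gt z(3) by (force simp: sd_ss_def destab_def)
    then show ?thesis using chain_sum_destab[OF False] by simp
  qed
  finally show ?thesis by (simp add: e)
qed

end

section \<open>Subquotients of representations\<close>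

locale finite_quiver =
  fixes Q :: "('v, 'a) dquiver"
  assumes finite_verts: "finite (verts Q)" and finite_arcs: "finite (arcs Q)"
    and arc_verts: "\<And>a. a \<in> arcs Q \<Longrightarrow> tail Q a \<in> verts Q" "\<And>a. a \<in> arcs Q \<Longrightarrow> head Q a \<in> verts Q"

lemma finite_quiverI:
  assumes "quiver_with_involution Q"
  shows "finite_quiver Q"
proof -
  interpret fin_digraph "pre_digraph.truncate Q"
    using assms by (simp add: quiver_with_involution_def)
  show ?thesis
    using finite_verts finite_arcs wellformed
    by unfold_locales (auto simp: pre_digraph.truncate_def)
qed

text \<open>
  \<open>p : B \<rightarrow> Y\<close> is onto with kernel \<open>A\<close>. Isomorphisms, subrepresentations, quotients and copies on \<open>nat\<close> are
  all of this form, and two \<open>Y\<close> with the same \<open>A\<close> and \<open>B\<close> are isomorphic.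
\<close>

definition subquo ::
  "('v, 'a) dquiver \<Rightarrow> ('k::field, 'v, 'a, 'x, 'm) rep_scheme \<Rightarrow> ('v \<Rightarrow> 'x set) \<Rightarrow> ('v \<Rightarrow> 'x set) \<Rightarrow>
     ('k, 'v, 'a, 'y, 'n) rep_scheme \<Rightarrow> ('v \<Rightarrow> 'x \<Rightarrow> 'y) \<Rightarrow> bool" where
  "subquo Q X A B Y p \<longleftrightarrow> A \<in> subreps Q X \<and> B \<in> subreps Q X \<and>
     (\<forall>i\<in>verts Q. A i \<subseteq> B i \<and> p i ` B i = carrier (node_space Y i) \<and>
        (\<forall>x\<in>B i. \<forall>y\<in>B i. p i (x \<oplus>\<^bsub>node_space X i\<^esub> y) = p i x \<oplus>\<^bsub>node_space Y i\<^esub> p i y) \<and>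
        (\<forall>c. \<forall>x\<in>B i. p i (c \<odot>\<^bsub>node_space X i\<^esub> x) = c \<odot>\<^bsub>node_space Y i\<^esub> p i x) \<and>
        (\<forall>x\<in>B i. p i x = \<zero>\<^bsub>node_space Y i\<^esub> \<longleftrightarrow> x \<in> A i)) \<and>
     (\<forall>a\<in>arcs Q. \<forall>x\<in>B (tail Q a). p (head Q a) (arrow_map X a x) = arrow_map Y a (p (tail Q a) x))"

text \<open>\<open>p\<close> carries information only on \<open>B\<close>, hence the intersection
  with \<open>B\<close>; the restriction to nodes makes the result extensional, as membership in
  \<open>subreps\<close> demands.\<close>

definition preim ::
  "('v, 'a) dquiver \<Rightarrow> ('v \<Rightarrow> 'x set) \<Rightarrow> ('v \<Rightarrow> 'x \<Rightarrow> 'y) \<Rightarrow> ('v \<Rightarrow> 'y set) \<Rightarrow> 'v \<Rightarrow> 'x set" where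
  "preim Q B p C = (\<lambda>i\<in>verts Q. {x \<in> B i. p i x \<in> C i})"

text \<open>The subquotient B / A built from cosets. Flags in X refer to it at every step, so that
  element types do not grow along the flag.\<close>

abbreviation sq ::
  "('v, 'a) dquiver \<Rightarrow> ('k::field, 'v, 'a, 'x, 'm) rep_scheme \<Rightarrow> ('v \<Rightarrow> 'x set) \<Rightarrow> ('v \<Rightarrow> 'x set) \<Rightarrow>
     ('k, 'v, 'a, 'x set) rep" where
  "sq Q X A B \<equiv> quot_rep Q (sub_rep X B) A"

lemma rep_spaceD:
  fixes X :: "('k::{field, finite}, 'v, 'a, 'x, 'm) rep_scheme"
  assumes "representation Q X" "i \<in> verts Q"
  shows "kspace (node_space X i)" "finite (carrier (node_space X i))"
    and "card (carrier (node_space X i)) =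
      CARD('k) ^ vectorspace.dim (class_ring :: 'k ring) (node_space X i)"
  using assms card_kspace unfolding representation_def by blast+

lemma linear_mapD:
  fixes V :: "('k::field, 'x) module" and W :: "('k, 'y) module"
  assumes "linear_map (class_ring :: 'k ring) V W f"
  shows "kspace V" "kspace W"
    and "\<And>x. x \<in> carrier V \<Longrightarrow> f x \<in> carrier W"
    and "\<And>x y. x \<in> carrier V \<Longrightarrow> y \<in> carrier V \<Longrightarrow> f (x \<oplus>\<^bsub>V\<^esub> y) = f x \<oplus>\<^bsub>W\<^esub> f y"
    and "\<And>c x. x \<in> carrier V \<Longrightarrow> f (c \<odot>\<^bsub>V\<^esub> x) = c \<odot>\<^bsub>W\<^esub> f x"
  using assms unfolding linear_map_def mod_hom_def mod_hom_axioms_def module_hom_def by auto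

lemma linear_mapI:
  fixes V :: "('k::field, 'x) module" and W :: "('k, 'y) module"
  assumes "kspace V" "kspace W"
    and "\<And>x. x \<in> carrier V \<Longrightarrow> f x \<in> carrier W"
    and "\<And>x y. x \<in> carrier V \<Longrightarrow> y \<in> carrier V \<Longrightarrow> f (x \<oplus>\<^bsub>V\<^esub> y) = f x \<oplus>\<^bsub>W\<^esub> f y"
    and "\<And>c x. x \<in> carrier V \<Longrightarrow> f (c \<odot>\<^bsub>V\<^esub> x) = c \<odot>\<^bsub>W\<^esub> f x"
  shows "linear_map (class_ring :: 'k ring) V W f"
  using assms
  unfolding linear_map_def mod_hom_def mod_hom_axioms_def module_hom_def vectorspace_def
  by simp

lemma rep_arrowD:
  assumes "representation Q X" "a \<in> arcs Q" "x \<in> carrier (node_space X (tail Q a))"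
  shows "arrow_map X a x \<in> carrier (node_space X (head Q a))"
    and "\<And>y. y \<in> carrier (node_space X (tail Q a)) \<Longrightarrow>
      arrow_map X a (x \<oplus>\<^bsub>node_space X (tail Q a)\<^esub> y) =
      arrow_map X a x \<oplus>\<^bsub>node_space X (head Q a)\<^esub> arrow_map X a y"
    and "arrow_map X a (c \<odot>\<^bsub>node_space X (tail Q a)\<^esub> x) =
      c \<odot>\<^bsub>node_space X (head Q a)\<^esub> arrow_map X a x"
proof -
  have l: "linear_map class_ring (node_space X (tail Q a)) (node_space X (head Q a)) (arrow_map X a)"
    using assms(1,2) by (simp add: representation_def)
  show "arrow_map X a x \<in> carrier (node_space X (head Q a))"
    and "\<And>y. y \<in> carrier (node_space X (tail Q a)) \<Longrightarrow>
      arrow_map X a (x \<oplus>\<^bsub>node_space X (tail Q a)\<^esub> y) =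
      arrow_map X a x \<oplus>\<^bsub>node_space X (head Q a)\<^esub> arrow_map X a y"
    and "arrow_map X a (c \<odot>\<^bsub>node_space X (tail Q a)\<^esub> x) =
      c \<odot>\<^bsub>node_space X (head Q a)\<^esub> arrow_map X a x"
    using linear_mapD(3-5)[OF l] assms(3) by auto
qed

lemma subrepsD:
  assumes "U \<in> subreps Q X"
  shows "\<And>i. i \<in> verts Q \<Longrightarrow> ksubspace (U i) (node_space X i)"
    and "\<And>i. i \<notin> verts Q \<Longrightarrow> U i = undefined"
    and "\<And>a x. a \<in> arcs Q \<Longrightarrow> x \<in> U (tail Q a) \<Longrightarrow> arrow_map X a x \<in> U (head Q a)"
  using assms unfolding subreps_def PiE_iff extensional_def by blast+

lemma subrepsI:
  assumes "\<And>i. i \<in> verts Q \<Longrightarrow> ksubspace (U i) (node_space X i)"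
    and "\<And>i. i \<notin> verts Q \<Longrightarrow> U i = undefined"
    and "\<And>a x. a \<in> arcs Q \<Longrightarrow> x \<in> U (tail Q a) \<Longrightarrow> arrow_map X a x \<in> U (head Q a)"
  shows "U \<in> subreps Q X"
  using assms unfolding subreps_def by (auto simp: PiE_iff extensional_def)

lemma subreps_eqI:
  assumes "U \<in> subreps Q X" "W \<in> subreps Q Y" "\<And>i. i \<in> verts Q \<Longrightarrow> U i = W i"
  shows "U = W"
  using assms subrepsD(2) by (metis ext)

lemma subreps_le_iff:
  assumes "U \<in> subreps Q X" "W \<in> subreps Q Y"
  shows "U \<le> W \<longleftrightarrow> (\<forall>i\<in>verts Q. U i \<subseteq> W i)"
  using subrepsD(2)[OF assms(1)] subrepsD(2)[OF assms(2)] by (auto simp: le_fun_def)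

lemma subquoD:
  assumes "subquo Q X A B Y p"
  shows "A \<in> subreps Q X" "B \<in> subreps Q X"
    and "\<And>i. i \<in> verts Q \<Longrightarrow> A i \<subseteq> B i"
    and "\<And>i. i \<in> verts Q \<Longrightarrow> p i ` B i = carrier (node_space Y i)"
    and "\<And>i x y. i \<in> verts Q \<Longrightarrow> x \<in> B i \<Longrightarrow> y \<in> B i \<Longrightarrow>
      p i (x \<oplus>\<^bsub>node_space X i\<^esub> y) = p i x \<oplus>\<^bsub>node_space Y i\<^esub> p i y"
    and "\<And>i c x. i \<in> verts Q \<Longrightarrow> x \<in> B i \<Longrightarrow>
      p i (c \<odot>\<^bsub>node_space X i\<^esub> x) = c \<odot>\<^bsub>node_space Y i\<^esub> p i x"
    and "\<And>i x. i \<in> verts Q \<Longrightarrow> x \<in> B i \<Longrightarrow> p i x = \<zero>\<^bsub>node_space Y i\<^esub> \<longleftrightarrow> x \<in> A i"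
    and "\<And>a x. a \<in> arcs Q \<Longrightarrow> x \<in> B (tail Q a) \<Longrightarrow>
      p (head Q a) (arrow_map X a x) = arrow_map Y a (p (tail Q a) x)"
  using assms unfolding subquo_def by auto

lemma subquoI:
  assumes "A \<in> subreps Q X" "B \<in> subreps Q X"
    and "\<And>i. i \<in> verts Q \<Longrightarrow> A i \<subseteq> B i"
    and "\<And>i. i \<in> verts Q \<Longrightarrow> p i ` B i = carrier (node_space Y i)"
    and "\<And>i x y. i \<in> verts Q \<Longrightarrow> x \<in> B i \<Longrightarrow> y \<in> B i \<Longrightarrow>
      p i (x \<oplus>\<^bsub>node_space X i\<^esub> y) = p i x \<oplus>\<^bsub>node_space Y i\<^esub> p i y"
    and "\<And>i c x. i \<in> verts Q \<Longrightarrow> x \<in> B i \<Longrightarrow>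
      p i (c \<odot>\<^bsub>node_space X i\<^esub> x) = c \<odot>\<^bsub>node_space Y i\<^esub> p i x"
    and "\<And>i x. i \<in> verts Q \<Longrightarrow> x \<in> B i \<Longrightarrow> p i x = \<zero>\<^bsub>node_space Y i\<^esub> \<longleftrightarrow> x \<in> A i"
    and "\<And>a x. a \<in> arcs Q \<Longrightarrow> x \<in> B (tail Q a) \<Longrightarrow>
      p (head Q a) (arrow_map X a x) = arrow_map Y a (p (tail Q a) x)"
  shows "subquo Q X A B Y p"
  using assms unfolding subquo_def by simp

lemma subquo_lift:
  assumes "subquo Q X A B Y p" "i \<in> verts Q" "y \<in> carrier (node_space Y i)"
  obtains x where "x \<in> B i" "p i x = y"
proof -
  have "y \<in> p i ` B i" using subquoD(4)[OF assms(1,2)] assms(3) by simp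
  then show thesis using that by blast
qed

context finite_quiver
begin

context
  fixes X :: "('k::{field, finite}, 'v, 'a, 'x, 'm) rep_scheme"
  assumes X: "representation Q X"
begin

lemma finite_subreps: "finite (subreps Q X)"
proof -
  have "finite (\<Pi>\<^sub>E i\<in>verts Q. Pow (carrier (node_space X i)))"
    using finite_verts rep_spaceD(2)[OF X] by (intro finite_PiE) auto
  moreover have "subreps Q X \<subseteq> (\<Pi>\<^sub>E i\<in>verts Q. Pow (carrier (node_space X i)))"
  proof
    fix U assume U: "U \<in> subreps Q X"
    then show "U \<in> (\<Pi>\<^sub>E i\<in>verts Q. Pow (carrier (node_space X i)))"
      using ksubspaceD(1)[OF subrepsD(1)[OF U]] subrepsD(2)[OF U]
      unfolding PiE_iff extensional_def by blast
  qed
  ultimately show ?thesis by (rule finite_subset[rotated])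
qed

lemma zero_sub_subrep: "zero_sub Q X \<in> subreps Q X"
proof (rule subrepsI)
  fix a x assume a: "a \<in> arcs Q" and "x \<in> zero_sub Q X (tail Q a)"
  then have x: "x = \<zero>\<^bsub>node_space X (tail Q a)\<^esub>" using arc_verts by (simp add: zero_sub_def)
  note t = rep_spaceD(1)[OF X arc_verts(1)[OF a]] and h = rep_spaceD(1)[OF X arc_verts(2)[OF a]]
  have "arrow_map X a x = 0 \<odot>\<^bsub>node_space X (head Q a)\<^esub> arrow_map X a x"
    using rep_arrowD(3)[OF X a kspace_closed(1)[OF t], of 0] kspace_closed(6)[OF t, of 0] x by simp
  also have "\<dots> = \<zero>\<^bsub>node_space X (head Q a)\<^esub>"
    using kspace_closed(5)[OF h] rep_arrowD(1)[OF X a] kspace_closed(1)[OF t] x by simp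
  finally show "arrow_map X a x \<in> zero_sub Q X (head Q a)" using arc_verts[OF a] by (simp add: zero_sub_def)
qed (use rep_spaceD[OF X] in \<open>auto simp: zero_sub_def ksubspace_zero\<close>)

lemma full_sub_subrep: "full_sub Q X \<in> subreps Q X"
  by (rule subrepsI)
     (use rep_spaceD[OF X] rep_arrowD(1)[OF X] arc_verts in \<open>auto simp: full_sub_def ksubspace_carrier\<close>)

lemma subrep_bounds:
  assumes "U \<in> subreps Q X"
  shows "zero_sub Q X \<le> U" "U \<le> full_sub Q X"
  using ksubspaceD(1,2)[OF subrepsD(1)[OF assms]]
    subreps_le_iff[OF zero_sub_subrep assms] subreps_le_iff[OF assms full_sub_subrep]
  by (auto simp: zero_sub_def full_sub_def)

text \<open>\<open>Y\<close> is only a record with a surjection from \<open>B\<close> that respects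
  the operations; its axioms are the images of those of \<open>B\<close>. Quotients, copies and
  reductions thereby become representations at once.\<close>

lemma subquo_rep:
  assumes p: "subquo Q X A B (Y :: ('k, 'v, 'a, 'y, 'n) rep_scheme) p"
  shows "representation Q Y"
proof -
  note B = subrepsD[OF subquoD(2)[OF p]] and pD = subquoD[OF p]
  have Y: "kspace (node_space Y i) \<and> finite (carrier (node_space Y i))" if i: "i \<in> verts Q" for i
  proof
    note Vi = rep_spaceD[OF X i]
    note Bi = ksubspaceD[OF B(1)[OF i]]
    have "p i \<zero>\<^bsub>node_space X i\<^esub> = \<zero>\<^bsub>node_space Y i\<^esub>"
      using pD(7)[OF i Bi(2)] ksubspaceD(2)[OF subrepsD(1)[OF pD(1) i]] by blast
    then show "kspace (node_space Y i)"
      by (intro kspace_image[OF kspace_subspace[OF Vi(1) B(1)[OF i]], of "p i"])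
         (simp_all add: pD(4-6)[OF i])
    have "finite (B i)" using Bi(1) Vi(2) finite_subset by blast
    then show "finite (carrier (node_space Y i))" using pD(4)[OF i] by (metis finite_imageI)
  qed
  have "linear_map class_ring (node_space Y (tail Q a)) (node_space Y (head Q a)) (arrow_map Y a)"
    if a: "a \<in> arcs Q" for a
  proof (rule linear_mapI)
    note t = arc_verts(1)[OF a] and h = arc_verts(2)[OF a]
    show "kspace (node_space Y (tail Q a))" "kspace (node_space Y (head Q a))" using Y t h by auto
    note Bt = ksubspaceD[OF B(1)[OF t]] and Bh = ksubspaceD[OF B(1)[OF h]]
    fix y assume "y \<in> carrier (node_space Y (tail Q a))"
    then obtain x where x: "x \<in> B (tail Q a)" "p (tail Q a) x = y" by (rule subquo_lift[OF p t])
    have xX: "x \<in> carrier (node_space X (tail Q a))" using x Bt(1) by blast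
    have ax: "arrow_map X a x \<in> B (head Q a)" by (rule B(3)[OF a x(1)])
    show "arrow_map Y a y \<in> carrier (node_space Y (head Q a))"
      using pD(8)[OF a x(1)] pD(4)[OF h] ax x by (metis imageI)
    show "arrow_map Y a (c \<odot>\<^bsub>node_space Y (tail Q a)\<^esub> y) =
        c \<odot>\<^bsub>node_space Y (head Q a)\<^esub> arrow_map Y a y" for c
      using pD(8)[OF a Bt(4)[OF x(1)], of c] pD(6)[OF t x(1)] rep_arrowD(3)[OF X a xX]
        pD(6)[OF h ax] pD(8)[OF a x(1)] x(2) by simp
    fix y' assume "y' \<in> carrier (node_space Y (tail Q a))"
    then obtain x' where x': "x' \<in> B (tail Q a)" "p (tail Q a) x' = y'" by (rule subquo_lift[OF p t])
    have xX': "x' \<in> carrier (node_space X (tail Q a))" using x' Bt(1) by blast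
    show "arrow_map Y a (y \<oplus>\<^bsub>node_space Y (tail Q a)\<^esub> y') =
        arrow_map Y a y \<oplus>\<^bsub>node_space Y (head Q a)\<^esub> arrow_map Y a y'"
      using pD(8)[OF a Bt(3)[OF x(1) x'(1)]] pD(5)[OF t x(1) x'(1)] rep_arrowD(2)[OF X a xX xX']
        pD(5)[OF h ax B(3)[OF a x'(1)]] pD(8)[OF a x(1)] pD(8)[OF a x'(1)] x(2) x'(2) by simp
  qed
  then show ?thesis using Y fin_dim_finite unfolding representation_def by blast
qed

lemma subquo_eq_iff:
  assumes p: "subquo Q X A B (Y :: ('k, 'v, 'a, 'y, 'n) rep_scheme) p" and i: "i \<in> verts Q"
    and x: "x \<in> B i" "x' \<in> B i"
  shows "p i x = p i x' \<longleftrightarrow> x \<ominus>\<^bsub>node_space X i\<^esub> x' \<in> A i"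
proof -
  note Vi = rep_spaceD(1)[OF X i] and Wi = rep_spaceD(1)[OF subquo_rep[OF p] i]
  interpret Y: vectorspace "class_ring :: 'k ring" "node_space Y i" by (rule Wi)
  note Bi = ksubspaceD[OF subrepsD(1)[OF subquoD(2)[OF p] i]]
  have c: "p i x \<in> carrier (node_space Y i)" "p i x' \<in> carrier (node_space Y i)"
    using x subquoD(4)[OF p i] by blast+
  have xc: "x \<in> carrier (node_space X i)" "x' \<in> carrier (node_space X i)" using x Bi(1) by blast+
  have d: "x \<ominus>\<^bsub>node_space X i\<^esub> x' \<in> B i"
    using ksubspace_minus[OF Vi subrepsD(1)[OF subquoD(2)[OF p] i]] x by blast
  have e: "p i (x \<ominus>\<^bsub>node_space X i\<^esub> x') = p i x \<ominus>\<^bsub>node_space Y i\<^esub> p i x'"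
    unfolding kspace_closed(7)[OF Vi xc] kspace_closed(7)[OF Wi c]
    using subquoD(5)[OF p i x(1) Bi(4)[OF x(2)]] subquoD(6)[OF p i x(2)] by simp
  have "p i x = p i x' \<longleftrightarrow> p i x \<ominus>\<^bsub>node_space Y i\<^esub> p i x' = \<zero>\<^bsub>node_space Y i\<^esub>"
  proof
    assume "p i x \<ominus>\<^bsub>node_space Y i\<^esub> p i x' = \<zero>\<^bsub>node_space Y i\<^esub>"
    moreover have "p i x = (p i x \<ominus>\<^bsub>node_space Y i\<^esub> p i x') \<oplus>\<^bsub>node_space Y i\<^esub> p i x'"
      using c by (simp add: a_minus_def Y.a_assoc Y.l_neg)
    ultimately show "p i x = p i x'" using c by simp
  qed (use c in \<open>simp add: a_minus_def Y.r_neg\<close>)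
  then show ?thesis using subquoD(7)[OF p i d] e by simp
qed

lemma subquo_sub:
  assumes U: "U \<in> subreps Q X"
  shows "subquo Q X (zero_sub Q X) U (sub_rep X U) (\<lambda>i x. x)"
  by (rule subquoI)
     (use U zero_sub_subrep ksubspaceD(2)[OF subrepsD(1)[OF U]] in \<open>auto simp: zero_sub_def sub_rep_def\<close>)

lemma subquo_quot:
  assumes U: "U \<in> subreps Q X"
  shows "subquo Q X U (full_sub Q X) (quot_rep Q X U) (\<lambda>i x. U i +>\<^bsub>node_space X i\<^esub> x)"
proof (rule subquoI)
  have sub: "U i \<subseteq> carrier (node_space X i)" if "i \<in> verts Q" for i
    using ksubspaceD(1)[OF subrepsD(1)[OF U that]] .
  show "U \<in> subreps Q X" "full_sub Q X \<in> subreps Q X" by (fact U, fact full_sub_subrep)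
  fix i assume i: "i \<in> verts Q"
  let ?V = "node_space X i"
  note V = rep_spaceD(1)[OF X i] and Ui = ksubspaceD[OF subrepsD(1)[OF U i]]
  interpret V: vectorspace "class_ring :: 'k ring" ?V by (rule V)
  have full: "full_sub Q X i = carrier ?V" using i by (simp add: full_sub_def)
  show "U i \<subseteq> full_sub Q X i" using sub[OF i] full by simp
  show "(\<lambda>x. U i +>\<^bsub>?V\<^esub> x) ` full_sub Q X i = carrier (node_space (quot_rep Q X U) i)"
    by (auto simp: quot_rep_def quot_space_def A_RCOSETS_def' full)
  fix x assume "x \<in> full_sub Q X i"
  then have x: "x \<in> carrier ?V" using full by simp
  show "U i +>\<^bsub>?V\<^esub> x = \<zero>\<^bsub>node_space (quot_rep Q X U) i\<^esub> \<longleftrightarrow> x \<in> U i"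
  proof -
    have "x \<in> U i +>\<^bsub>?V\<^esub> x" using Ui(2) x by (force simp: a_r_coset_def')
    moreover have "U i +>\<^bsub>?V\<^esub> x = U i" if "x \<in> U i"
    proof (intro equalityI subsetI)
      fix y assume "y \<in> U i"
      then have "y \<ominus>\<^bsub>?V\<^esub> x \<in> U i" "y = (y \<ominus>\<^bsub>?V\<^esub> x) \<oplus>\<^bsub>?V\<^esub> x"
        using ksubspace_minus[OF V subrepsD(1)[OF U i]] that sub[OF i]
        by (auto simp: a_minus_def V.a_assoc V.l_neg subset_eq)
      then show "y \<in> U i +>\<^bsub>?V\<^esub> x" by (auto simp: a_r_coset_def')
    qed (use Ui(3) that in \<open>auto simp: a_r_coset_def'\<close>)
    ultimately show ?thesis by (auto simp: quot_rep_def quot_space_def)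
  qed
  have "U i <+>\<^bsub>?V\<^esub> ((\<lambda>x. c \<odot>\<^bsub>?V\<^esub> x) ` (U i +>\<^bsub>?V\<^esub> x)) = U i +>\<^bsub>?V\<^esub> (c \<odot>\<^bsub>?V\<^esub> x)" for c
  proof (intro equalityI subsetI)
    fix y assume "y \<in> U i <+>\<^bsub>?V\<^esub> ((\<lambda>x. c \<odot>\<^bsub>?V\<^esub> x) ` (U i +>\<^bsub>?V\<^esub> x))"
    then obtain u v where uv: "u \<in> U i" "v \<in> U i" "y = u \<oplus>\<^bsub>?V\<^esub> c \<odot>\<^bsub>?V\<^esub> (v \<oplus>\<^bsub>?V\<^esub> x)"
      by (auto simp: a_r_coset_def' set_add_def')
    have cv: "u \<in> carrier ?V" "v \<in> carrier ?V" using uv sub[OF i] by blast+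
    have "y = (u \<oplus>\<^bsub>?V\<^esub> c \<odot>\<^bsub>?V\<^esub> v) \<oplus>\<^bsub>?V\<^esub> c \<odot>\<^bsub>?V\<^esub> x"
      using uv(3) cv x V.smult_r_distr[of c v x] kspace_closed(4)[OF V] by (simp add: V.a_assoc)
    moreover have "u \<oplus>\<^bsub>?V\<^esub> c \<odot>\<^bsub>?V\<^esub> v \<in> U i" using uv Ui by blast
    ultimately show "y \<in> U i +>\<^bsub>?V\<^esub> (c \<odot>\<^bsub>?V\<^esub> x)" by (auto simp: a_r_coset_def')
  next
    fix y assume "y \<in> U i +>\<^bsub>?V\<^esub> (c \<odot>\<^bsub>?V\<^esub> x)"
    then obtain u where u: "u \<in> U i" "y = u \<oplus>\<^bsub>?V\<^esub> c \<odot>\<^bsub>?V\<^esub> x" by (auto simp: a_r_coset_def')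
    have "x \<in> U i +>\<^bsub>?V\<^esub> x" using Ui(2) x by (force simp: a_r_coset_def')
    then show "y \<in> U i <+>\<^bsub>?V\<^esub> ((\<lambda>x. c \<odot>\<^bsub>?V\<^esub> x) ` (U i +>\<^bsub>?V\<^esub> x))"
      using u unfolding set_add_def' by blast
  qed
  then show "U i +>\<^bsub>?V\<^esub> (c \<odot>\<^bsub>?V\<^esub> x) = c \<odot>\<^bsub>node_space (quot_rep Q X U) i\<^esub> (U i +>\<^bsub>?V\<^esub> x)" for c
    by (simp add: quot_rep_def quot_space_def)
  fix y assume "y \<in> full_sub Q X i"
  then have y: "y \<in> carrier ?V" using full by simp
  have "U i +>\<^bsub>?V\<^esub> (x \<oplus>\<^bsub>?V\<^esub> y) = (U i +>\<^bsub>?V\<^esub> x) <+>\<^bsub>?V\<^esub> (U i +>\<^bsub>?V\<^esub> y)"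
  proof (intro equalityI subsetI)
    fix w assume "w \<in> U i +>\<^bsub>?V\<^esub> (x \<oplus>\<^bsub>?V\<^esub> y)"
    then obtain u where u: "u \<in> U i" "w = u \<oplus>\<^bsub>?V\<^esub> (x \<oplus>\<^bsub>?V\<^esub> y)" by (auto simp: a_r_coset_def')
    then have "w = (u \<oplus>\<^bsub>?V\<^esub> x) \<oplus>\<^bsub>?V\<^esub> (\<zero>\<^bsub>?V\<^esub> \<oplus>\<^bsub>?V\<^esub> y)"
      using sub[OF i] x y by (auto simp: V.a_assoc subset_eq)
    then show "w \<in> (U i +>\<^bsub>?V\<^esub> x) <+>\<^bsub>?V\<^esub> (U i +>\<^bsub>?V\<^esub> y)"
      using u(1) Ui(2) unfolding set_add_def' a_r_coset_def' by blast
  next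
    fix w assume "w \<in> (U i +>\<^bsub>?V\<^esub> x) <+>\<^bsub>?V\<^esub> (U i +>\<^bsub>?V\<^esub> y)"
    then obtain u v where uv: "u \<in> U i" "v \<in> U i" "w = (u \<oplus>\<^bsub>?V\<^esub> x) \<oplus>\<^bsub>?V\<^esub> (v \<oplus>\<^bsub>?V\<^esub> y)"
      by (auto simp: a_r_coset_def' set_add_def')
    have cv: "u \<in> carrier ?V" "v \<in> carrier ?V" using uv sub[OF i] by blast+
    have "w = (u \<oplus>\<^bsub>?V\<^esub> v) \<oplus>\<^bsub>?V\<^esub> (x \<oplus>\<^bsub>?V\<^esub> y)"
      using uv(3) cv x y by (simp add: V.a_ac)
    then show "w \<in> U i +>\<^bsub>?V\<^esub> (x \<oplus>\<^bsub>?V\<^esub> y)" using Ui(3)[OF uv(1,2)] by (auto simp: a_r_coset_def')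
  qed
  then show "U i +>\<^bsub>?V\<^esub> (x \<oplus>\<^bsub>?V\<^esub> y) =
      (U i +>\<^bsub>?V\<^esub> x) \<oplus>\<^bsub>node_space (quot_rep Q X U) i\<^esub> (U i +>\<^bsub>?V\<^esub> y)"
    by (simp add: quot_rep_def quot_space_def)
next
  fix a x assume a: "a \<in> arcs Q" and "x \<in> full_sub Q X (tail Q a)"
  note t = arc_verts(1)[OF a] and h = arc_verts(2)[OF a]
  let ?T = "node_space X (tail Q a)" and ?H = "node_space X (head Q a)"
  interpret T: vectorspace "class_ring :: 'k ring" ?T by (rule rep_spaceD[OF X t])
  interpret H: vectorspace "class_ring :: 'k ring" ?H by (rule rep_spaceD[OF X h])
  have x: "x \<in> carrier ?T" using \<open>x \<in> full_sub Q X (tail Q a)\<close> t by (simp add: full_sub_def)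
  note Ut = ksubspaceD[OF subrepsD(1)[OF U t]] and Uh = ksubspaceD[OF subrepsD(1)[OF U h]]
  let ?m = "arrow_map X a"
  have "U (head Q a) +>\<^bsub>?H\<^esub> ?m x = U (head Q a) <+>\<^bsub>?H\<^esub> (?m ` (U (tail Q a) +>\<^bsub>?T\<^esub> x))"
  proof (intro equalityI subsetI)
    fix y assume "y \<in> U (head Q a) +>\<^bsub>?H\<^esub> ?m x"
    then obtain u where u: "u \<in> U (head Q a)" "y = u \<oplus>\<^bsub>?H\<^esub> ?m x" by (auto simp: a_r_coset_def')
    have "x \<in> U (tail Q a) +>\<^bsub>?T\<^esub> x" using Ut(2) x by (force simp: a_r_coset_def')
    then show "y \<in> U (head Q a) <+>\<^bsub>?H\<^esub> (?m ` (U (tail Q a) +>\<^bsub>?T\<^esub> x))"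
      using u unfolding set_add_def' by blast
  next
    fix y assume "y \<in> U (head Q a) <+>\<^bsub>?H\<^esub> (?m ` (U (tail Q a) +>\<^bsub>?T\<^esub> x))"
    then obtain u v where uv: "u \<in> U (head Q a)" "v \<in> U (tail Q a)" "y = u \<oplus>\<^bsub>?H\<^esub> ?m (v \<oplus>\<^bsub>?T\<^esub> x)"
      by (auto simp: a_r_coset_def' set_add_def')
    have cv: "u \<in> carrier ?H" "v \<in> carrier ?T" using uv Ut(1) Uh(1) by blast+
    have "y = (u \<oplus>\<^bsub>?H\<^esub> ?m v) \<oplus>\<^bsub>?H\<^esub> ?m x"
      using uv(3) cv x rep_arrowD(1,2)[OF X a] by (simp add: H.a_assoc)
    moreover have "u \<oplus>\<^bsub>?H\<^esub> ?m v \<in> U (head Q a)" using uv Uh(3) subrepsD(3)[OF U a] by blast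
    ultimately show "y \<in> U (head Q a) +>\<^bsub>?H\<^esub> ?m x" by (auto simp: a_r_coset_def')
  qed
  then show "U (head Q a) +>\<^bsub>?H\<^esub> ?m x = arrow_map (quot_rep Q X U) a (U (tail Q a) +>\<^bsub>?T\<^esub> x)"
    by (simp add: quot_rep_def)
qed

lemma preim_subrep:
  assumes p: "subquo Q X A B (Y :: ('k, 'v, 'a, 'y, 'n) rep_scheme) p" and C: "C \<in> subreps Q Y"
  shows "preim Q B p C \<in> subreps Q X" "A \<le> preim Q B p C" "preim Q B p C \<le> B"
proof -
  note pD = subquoD[OF p] and BD = subrepsD[OF subquoD(2)[OF p]] and CD = subrepsD[OF C]
  show P: "preim Q B p C \<in> subreps Q X"
  proof (rule subrepsI)
    fix i assume i: "i \<in> verts Q"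
    note Vi = rep_spaceD(1)[OF X i]
    note Bi = ksubspaceD[OF BD(1)[OF i]] and Ci = ksubspaceD[OF CD(1)[OF i]]
      and Ai = ksubspaceD[OF subrepsD(1)[OF pD(1) i]]
    show "ksubspace (preim Q B p C i) (node_space X i)"
      unfolding ksubspace_iff[OF Vi]
    proof (intro conjI allI ballI)
      show "preim Q B p C i \<subseteq> carrier (node_space X i)" using i Bi(1) by (auto simp: preim_def)
      have "p i \<zero>\<^bsub>node_space X i\<^esub> = \<zero>\<^bsub>node_space Y i\<^esub>" using pD(7)[OF i Bi(2)] Ai(2) by blast
      then show "\<zero>\<^bsub>node_space X i\<^esub> \<in> preim Q B p C i" using i Bi(2) Ci(2) by (simp add: preim_def)
      fix x assume x: "x \<in> preim Q B p C i"
      show "c \<odot>\<^bsub>node_space X i\<^esub> x \<in> preim Q B p C i" for c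
        using x i pD(6) Bi(4) Ci(4) by (simp add: preim_def)
      show "x \<oplus>\<^bsub>node_space X i\<^esub> y \<in> preim Q B p C i" if "y \<in> preim Q B p C i" for y
        using x that i pD(5) Bi(3) Ci(3) by (simp add: preim_def)
    qed
  next
    fix a x assume "a \<in> arcs Q" "x \<in> preim Q B p C (tail Q a)"
    then show "arrow_map X a x \<in> preim Q B p C (head Q a)"
      using arc_verts pD(8)[of a x] BD(3)[of a x] CD(3)[of a] by (simp add: preim_def)
  qed (simp add: preim_def)
  show "preim Q B p C \<le> B"
    unfolding subreps_le_iff[OF P pD(2)] by (auto simp: preim_def)
  show "A \<le> preim Q B p C"
    unfolding subreps_le_iff[OF pD(1) P]
  proof
    fix i assume i: "i \<in> verts Q"
    note Ci = ksubspaceD[OF CD(1)[OF i]]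
    show "A i \<subseteq> preim Q B p C i"
    proof
      fix x assume x: "x \<in> A i"
      then have "x \<in> B i" "p i x = \<zero>\<^bsub>node_space Y i\<^esub>" using pD(3)[OF i] pD(7)[OF i] by auto
      then show "x \<in> preim Q B p C i" using i Ci(2) by (simp add: preim_def)
    qed
  qed
qed

text \<open>A subquotient of a subquotient of \<open>X\<close> is again presented by
  \<open>X\<close>, with the preimages of its two ends. Every iterated construction can thus be
  pulled back to the original representation.\<close>

lemma subquo_trans:
  assumes p: "subquo Q X A B (Y :: ('k, 'v, 'a, 'y, 'n) rep_scheme) p"
    and r: "subquo Q Y C D (Z :: ('k, 'v, 'a, 'w, 'l) rep_scheme) r"
  shows "subquo Q X (preim Q B p C) (preim Q B p D) Z (\<lambda>i x. r i (p i x))"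
proof (rule subquoI)
  note pD = subquoD[OF p] and rD = subquoD[OF r]
  show "preim Q B p C \<in> subreps Q X" "preim Q B p D \<in> subreps Q X"
    using preim_subrep[OF p] rD by auto
  fix i assume i: "i \<in> verts Q"
  show "preim Q B p C i \<subseteq> preim Q B p D i" using i rD(3)[OF i] by (auto simp: preim_def)
  have "p i ` preim Q B p D i = D i"
    using i pD(4)[OF i] ksubspaceD(1)[OF subrepsD(1)[OF rD(2) i]] by (auto simp: preim_def image_iff)
  then show "(\<lambda>x. r i (p i x)) ` preim Q B p D i = carrier (node_space Z i)"
    using rD(4)[OF i] by (simp flip: image_image[of "r i" "p i"])
  fix x assume x: "x \<in> preim Q B p D i"
  then have x': "x \<in> B i" "p i x \<in> D i" using i by (auto simp: preim_def)
  show "r i (p i (c \<odot>\<^bsub>node_space X i\<^esub> x)) = c \<odot>\<^bsub>node_space Z i\<^esub> r i (p i x)" for c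
    using x' by (simp add: pD(6)[OF i] rD(6)[OF i])
  show "r i (p i x) = \<zero>\<^bsub>node_space Z i\<^esub> \<longleftrightarrow> x \<in> preim Q B p C i"
    using x' i by (simp add: rD(7)[OF i] preim_def)
  fix y assume "y \<in> preim Q B p D i"
  then show "r i (p i (x \<oplus>\<^bsub>node_space X i\<^esub> y)) = r i (p i x) \<oplus>\<^bsub>node_space Z i\<^esub> r i (p i y)"
    using x' i by (simp add: preim_def pD(5)[OF i] rD(5)[OF i])
next
  fix a x assume "a \<in> arcs Q" "x \<in> preim Q B p D (tail Q a)"
  then show "r (head Q a) (p (head Q a) (arrow_map X a x)) = arrow_map Z a (r (tail Q a) (p (tail Q a) x))"
    using arc_verts by (simp add: preim_def subquoD(8)[OF p] subquoD(8)[OF r])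
qed

lemma preim_zero:
  assumes p: "subquo Q X A B (Y :: ('k, 'v, 'a, 'y, 'n) rep_scheme) p"
  shows "preim Q B p (zero_sub Q Y) = A"
  using subquoD(3,7)[OF p] subrepsD(2)[OF subquoD(1)[OF p]]
  by (intro ext) (auto simp: preim_def zero_sub_def subset_eq)

lemma preim_full:
  assumes p: "subquo Q X A B (Y :: ('k, 'v, 'a, 'y, 'n) rep_scheme) p"
  shows "preim Q B p (full_sub Q Y) = B"
  using subquoD(4)[OF p] subrepsD(2)[OF subquoD(2)[OF p]]
  by (intro ext) (auto simp: preim_def full_sub_def)

text \<open>First isomorphism theorem: both maps have kernel \<open>A\<close> on \<open>B\<close>,
  so any lift along \<open>p\<close> followed by \<open>r\<close> is well defined. The relation
  between \<open>f\<close>, \<open>p\<close> and \<open>r\<close> is exported because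
  \<open>reduction_map_isometric\<close> needs it to compare forms.\<close>

lemma subquo_unique:
  assumes p: "subquo Q X A B (Y :: ('k, 'v, 'a, 'y, 'n) rep_scheme) p"
    and r: "subquo Q X A B (Z :: ('k, 'v, 'a, 'w, 'l) rep_scheme) r"
  obtains f where "rep_isomorphism Q Y Z f" "\<And>i x. i \<in> verts Q \<Longrightarrow> x \<in> B i \<Longrightarrow> f i (p i x) = r i x"
proof -
  note pD = subquoD[OF p] and rD = subquoD[OF r] and BD = subrepsD[OF subquoD(2)[OF p]]
  define f where "f i y = r i (SOME x. x \<in> B i \<and> p i x = y)" for i y
  have f: "f i (p i x) = r i x" if i: "i \<in> verts Q" and x: "x \<in> B i" for i x
  proof -
    let ?x = "SOME x'. x' \<in> B i \<and> p i x' = p i x"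
    have s: "?x \<in> B i \<and> p i ?x = p i x" by (rule someI[of _ x]) (use x in simp)
    then have "r i ?x = r i x"
      using subquo_eq_iff[OF p i, of ?x x] subquo_eq_iff[OF r i, of ?x x] x by blast
    then show ?thesis by (simp add: f_def)
  qed
  have "rep_isomorphism Q Y Z f"
    unfolding rep_isomorphism_def
  proof (intro conjI ballI)
    fix i assume i: "i \<in> verts Q"
    note Bi = ksubspaceD[OF BD(1)[OF i]]
    show "linear_map class_ring (node_space Y i) (node_space Z i) (f i)"
    proof (rule linear_mapI)
      show "kspace (node_space Y i)" "kspace (node_space Z i)"
        using rep_spaceD(1)[OF subquo_rep[OF p] i] rep_spaceD(1)[OF subquo_rep[OF r] i] by auto
      fix y assume "y \<in> carrier (node_space Y i)"
      then obtain x where x: "x \<in> B i" "p i x = y" by (rule subquo_lift[OF p i])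
      show "f i y \<in> carrier (node_space Z i)" using f[OF i x(1)] x rD(4)[OF i] by auto
      show "f i (c \<odot>\<^bsub>node_space Y i\<^esub> y) = c \<odot>\<^bsub>node_space Z i\<^esub> f i y" for c
        using pD(6)[OF i x(1), of c] rD(6)[OF i x(1), of c] f[OF i x(1)] f[OF i Bi(4)[OF x(1)], of c] x(2)
        by simp
      fix y' assume "y' \<in> carrier (node_space Y i)"
      then obtain x' where x': "x' \<in> B i" "p i x' = y'" by (rule subquo_lift[OF p i])
      show "f i (y \<oplus>\<^bsub>node_space Y i\<^esub> y') = f i y \<oplus>\<^bsub>node_space Z i\<^esub> f i y'"
        using pD(5)[OF i x(1) x'(1)] rD(5)[OF i x(1) x'(1)] f[OF i x(1)] f[OF i x'(1)]
          f[OF i Bi(3)[OF x(1) x'(1)]] x(2) x'(2) by simp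
    qed
    show "bij_betw (f i) (carrier (node_space Y i)) (carrier (node_space Z i))"
      unfolding bij_betw_def
    proof
      show "inj_on (f i) (carrier (node_space Y i))"
      proof (rule inj_onI)
        fix y y' assume y: "y \<in> carrier (node_space Y i)" "y' \<in> carrier (node_space Y i)" "f i y = f i y'"
        obtain x where x: "x \<in> B i" "p i x = y" by (rule subquo_lift[OF p i y(1)])
        obtain x' where x': "x' \<in> B i" "p i x' = y'" by (rule subquo_lift[OF p i y(2)])
        have "r i x = r i x'" using y(3) f[OF i x(1)] f[OF i x'(1)] x x' by simp
        then show "y = y'"
          using subquo_eq_iff[OF p i x(1) x'(1)] subquo_eq_iff[OF r i x(1) x'(1)] x(2) x'(2) by blast
      qed
      show "f i ` carrier (node_space Y i) = carrier (node_space Z i)"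
        using f[OF i] by (simp add: image_image flip: pD(4)[OF i] rD(4)[OF i])
    qed
  next
    fix a y assume a: "a \<in> arcs Q" and "y \<in> carrier (node_space Y (tail Q a))"
    then obtain x where x: "x \<in> B (tail Q a)" "p (tail Q a) x = y"
      using subquo_lift[OF p arc_verts(1)] by metis
    show "f (head Q a) (arrow_map Y a y) = arrow_map Z a (f (tail Q a) y)"
      using f[OF arc_verts(1)[OF a] x(1)] f[OF arc_verts(2)[OF a] BD(3)[OF a x(1)]]
        pD(8)[OF a x(1)] rD(8)[OF a x(1)] x(2) by simp
  qed
  then show thesis using that f by blast
qed

lemma subquo_isomorphic:
  assumes "subquo Q X A B (Y :: ('k, 'v, 'a, 'y, 'n) rep_scheme) p"
    and "subquo Q X A B (Z :: ('k, 'v, 'a, 'w, 'l) rep_scheme) r"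
  shows "isomorphic Q Y Z"
  using subquo_unique[OF assms] unfolding isomorphic_def by metis

text \<open>Isomorphism becomes the case A = 0, B = X of a presentation, so that its symmetry and
  transitivity are instances of \<open>subquo_unique\<close> and
  \<open>subquo_trans\<close>.\<close>

lemma rep_isomorphism_iff_subquo:
  assumes "representation Q (Y :: ('k, 'v, 'a, 'y, 'n) rep_scheme)"
  shows "rep_isomorphism Q X Y f \<longleftrightarrow> subquo Q X (zero_sub Q X) (full_sub Q X) Y f"
proof
  assume f: "rep_isomorphism Q X Y f"
  show "subquo Q X (zero_sub Q X) (full_sub Q X) Y f"
  proof (rule subquoI)
    show "zero_sub Q X \<in> subreps Q X" "full_sub Q X \<in> subreps Q X"
      by (fact zero_sub_subrep, fact full_sub_subrep)
    fix i assume i: "i \<in> verts Q"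
    have l: "linear_map class_ring (node_space X i) (node_space Y i) (f i)"
      and b: "bij_betw (f i) (carrier (node_space X i)) (carrier (node_space Y i))"
      using f i unfolding rep_isomorphism_def by auto
    note lD = linear_mapD[OF l]
    have full: "full_sub Q X i = carrier (node_space X i)" using i by (simp add: full_sub_def)
    show "zero_sub Q X i \<subseteq> full_sub Q X i"
      using i kspace_closed(1)[OF lD(1)] by (simp add: full zero_sub_def)
    show "f i ` full_sub Q X i = carrier (node_space Y i)"
      using b unfolding full bij_betw_def by blast
    fix x assume x: "x \<in> full_sub Q X i"
    show "f i (c \<odot>\<^bsub>node_space X i\<^esub> x) = c \<odot>\<^bsub>node_space Y i\<^esub> f i x" for c
      using x lD(5) full by simp
    have f0: "f i \<zero>\<^bsub>node_space X i\<^esub> = \<zero>\<^bsub>node_space Y i\<^esub>"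
      using lD(5)[OF kspace_closed(1)[OF lD(1)], of 0] kspace_closed(6)[OF lD(1), of 0]
        kspace_closed(5)[OF lD(2) lD(3)[OF kspace_closed(1)[OF lD(1)]]] by simp
    show "f i x = \<zero>\<^bsub>node_space Y i\<^esub> \<longleftrightarrow> x \<in> zero_sub Q X i"
      using b x i full f0 kspace_closed(1)[OF lD(1)]
      by (auto simp: zero_sub_def bij_betw_def inj_on_def)
    fix y assume "y \<in> full_sub Q X i"
    then show "f i (x \<oplus>\<^bsub>node_space X i\<^esub> y) = f i x \<oplus>\<^bsub>node_space Y i\<^esub> f i y"
      using x lD(4) full by simp
  next
    fix a x assume "a \<in> arcs Q" "x \<in> full_sub Q X (tail Q a)"
    then show "f (head Q a) (arrow_map X a x) = arrow_map Y a (f (tail Q a) x)"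
      using f arc_verts(1) unfolding rep_isomorphism_def by (simp add: full_sub_def)
  qed
next
  assume f: "subquo Q X (zero_sub Q X) (full_sub Q X) Y f"
  note fD = subquoD[OF f]
  show "rep_isomorphism Q X Y f"
    unfolding rep_isomorphism_def
  proof (intro conjI ballI)
    fix i assume i: "i \<in> verts Q"
    have full: "full_sub Q X i = carrier (node_space X i)" using i by (simp add: full_sub_def)
    note Vi = rep_spaceD(1)[OF X i]
    interpret V: vectorspace "class_ring :: 'k ring" "node_space X i" by (rule Vi)
    show "linear_map class_ring (node_space X i) (node_space Y i) (f i)"
      by (rule linear_mapI)
         (use Vi rep_spaceD(1)[OF assms i] fD(4-6)[OF i] full in auto)
    have "x = y" if "x \<in> carrier (node_space X i)" "y \<in> carrier (node_space X i)" "f i x = f i y" for x y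
    proof -
      have "x \<ominus>\<^bsub>node_space X i\<^esub> y = \<zero>\<^bsub>node_space X i\<^esub>"
        using subquo_eq_iff[OF f i, of x y] that full i by (simp add: zero_sub_def)
      moreover have "x = (x \<ominus>\<^bsub>node_space X i\<^esub> y) \<oplus>\<^bsub>node_space X i\<^esub> y"
        using that by (simp add: a_minus_def V.a_assoc V.l_neg)
      ultimately show ?thesis using that by simp
    qed
    then show "bij_betw (f i) (carrier (node_space X i)) (carrier (node_space Y i))"
      using fD(4)[OF i] full by (auto simp: bij_betw_def inj_on_def)
  next
    fix a x assume "a \<in> arcs Q" "x \<in> carrier (node_space X (tail Q a))"
    then show "f (head Q a) (arrow_map X a x) = arrow_map Y a (f (tail Q a) x)"
      using fD(8) arc_verts(1) by (simp add: full_sub_def)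
  qed
qed

lemma subquo_refl: "subquo Q X (zero_sub Q X) (full_sub Q X) X (\<lambda>i x. x)"
  by (rule subquoI)
     (use zero_sub_subrep full_sub_subrep subrep_bounds[OF zero_sub_subrep] rep_spaceD(1)[OF X] in
       \<open>auto simp: zero_sub_def full_sub_def kspace_closed(1)\<close>)

lemma isomorphic_sym:
  assumes "representation Q (Y :: ('k, 'v, 'a, 'y, 'n) rep_scheme)" "isomorphic Q X Y"
  shows "isomorphic Q Y X"
  using assms subquo_isomorphic[OF _ subquo_refl] rep_isomorphism_iff_subquo[OF assms(1)]
  unfolding isomorphic_def by blast

lemma subquo_isomorphism:
  assumes p: "subquo Q X A B (Y :: ('k, 'v, 'a, 'y, 'n) rep_scheme) p"
    and f: "subquo Q Y (zero_sub Q Y) (full_sub Q Y) (Z :: ('k, 'v, 'a, 'w, 'l) rep_scheme) f"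
  shows "subquo Q X A B Z (\<lambda>i x. f i (p i x))"
  using subquo_trans[OF p f] by (simp add: preim_zero[OF p] preim_full[OF p])

lemma sub_subrepI:
  assumes "A \<in> subreps Q X" "B \<in> subreps Q X" "A \<le> B"
  shows "A \<in> subreps Q (sub_rep X B)"
proof (rule subrepsI)
  fix i assume i: "i \<in> verts Q"
  note Vi = rep_spaceD(1)[OF X i] and Bi = subrepsD(1)[OF assms(2) i] and Ai = subrepsD(1)[OF assms(1) i]
  have "A i \<subseteq> B i" using assms(3) by (simp add: le_fun_def)
  then show "ksubspace (A i) (node_space (sub_rep X B) i)"
    using ksubspaceD[OF Ai] kspace_subspace[OF Vi Bi]
    by (simp add: sub_rep_def ksubspace_iff)
qed (use subrepsD(2,3)[OF assms(1)] in \<open>auto simp: sub_rep_def\<close>)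

end

end

section \<open>Isomorphism classes and coefficients in the Hall algebra\<close>

text \<open>Common to the algebra and the module: a structure constant counts subobjects
  \<open>W\<close> by the pair \<open>a W\<close>, \<open>b W\<close>, so summing over pairs of
  classes is summing over \<open>W\<close>, and a \<open>W\<close> whose pair is outside the
  supports contributes 0. The finiteness hypothesis matters because a sum over an infinite set is 0
  by convention.\<close>

lemma lookup_structure_sum:
  fixes f :: "'c \<Rightarrow>\<^sub>0 rat" and g :: "'d \<Rightarrow>\<^sub>0 rat" and F :: "'c \<Rightarrow> 'd \<Rightarrow> 'e \<Rightarrow> nat"
  assumes fin: "\<And>A B. A \<in> Poly_Mapping.keys f \<Longrightarrow> B \<in> Poly_Mapping.keys g \<Longrightarrow> finite {C \<in> Cs. F A B C \<noteq> 0}"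
    and S: "finite S"
    and F: "\<And>A B. C \<in> Cs \<Longrightarrow> A \<in> Poly_Mapping.keys f \<Longrightarrow> B \<in> Poly_Mapping.keys g \<Longrightarrow>
      F A B C = card {W \<in> S. a W = A \<and> b W = B}"
  shows "Poly_Mapping.lookup (\<Sum>A\<in>Poly_Mapping.keys f. \<Sum>B\<in>Poly_Mapping.keys g. \<Sum>C\<in>{C \<in> Cs. F A B C \<noteq> 0}.
      Poly_Mapping.single C (Poly_Mapping.lookup f A * Poly_Mapping.lookup g B * of_nat (F A B C))) C =
    (if C \<in> Cs then (\<Sum>W\<in>S. Poly_Mapping.lookup f (a W) * Poly_Mapping.lookup g (b W)) else 0)"
    (is "?lhs = _")
proof -
  have "?lhs = (\<Sum>A\<in>Poly_Mapping.keys f. \<Sum>B\<in>Poly_Mapping.keys g.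
      Poly_Mapping.lookup f A * Poly_Mapping.lookup g B * of_nat (if C \<in> Cs then F A B C else 0))"
    unfolding lookup_sum
  proof (intro sum.cong refl)
    fix A B assume "A \<in> Poly_Mapping.keys f" "B \<in> Poly_Mapping.keys g"
    then have "finite {C \<in> Cs. F A B C \<noteq> 0}" by (rule fin)
    then show "(\<Sum>C'\<in>{C \<in> Cs. F A B C \<noteq> 0}. Poly_Mapping.lookup (Poly_Mapping.single C'
        (Poly_Mapping.lookup f A * Poly_Mapping.lookup g B * of_nat (F A B C'))) C) =
        Poly_Mapping.lookup f A * Poly_Mapping.lookup g B * of_nat (if C \<in> Cs then F A B C else 0)"
      by (simp add: lookup_single when_def)
  qed
  also have "\<dots> = (if C \<in> Cs then (\<Sum>W\<in>S. Poly_Mapping.lookup f (a W) * Poly_Mapping.lookup g (b W)) else 0)"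
  proof (cases "C \<in> Cs")
    case True
    have "(\<Sum>A\<in>Poly_Mapping.keys f. \<Sum>B\<in>Poly_Mapping.keys g.
        Poly_Mapping.lookup f A * Poly_Mapping.lookup g B * of_nat (F A B C)) =
      (\<Sum>A\<in>Poly_Mapping.keys f. \<Sum>B\<in>Poly_Mapping.keys g. \<Sum>W\<in>S.
        (Poly_Mapping.lookup f A * of_bool (a W = A)) * (Poly_Mapping.lookup g B * of_bool (b W = B)))"
    proof (intro sum.cong refl)
      fix A B assume "A \<in> Poly_Mapping.keys f" "B \<in> Poly_Mapping.keys g"
      then have "of_nat (F A B C) = (\<Sum>W\<in>S. of_bool (a W = A \<and> b W = B) :: rat)"
        using S F[OF True] by (simp add: of_bool_def sum.If_cases Int_def)
      also have "\<dots> = (\<Sum>W\<in>S. of_bool (a W = A) * of_bool (b W = B))"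
        by (simp only: of_bool_conj)
      finally show "Poly_Mapping.lookup f A * Poly_Mapping.lookup g B * of_nat (F A B C) =
        (\<Sum>W\<in>S. (Poly_Mapping.lookup f A * of_bool (a W = A)) * (Poly_Mapping.lookup g B * of_bool (b W = B)))"
        by (simp add: sum_distrib_left mult_ac)
    qed
    also have "\<dots> = (\<Sum>W\<in>S. \<Sum>A\<in>Poly_Mapping.keys f. \<Sum>B\<in>Poly_Mapping.keys g.
        (Poly_Mapping.lookup f A * of_bool (a W = A)) * (Poly_Mapping.lookup g B * of_bool (b W = B)))"
      by (rule trans[OF sum.cong[OF refl sum.swap] sum.swap])
    also have "\<dots> = (\<Sum>W\<in>S. (\<Sum>A\<in>Poly_Mapping.keys f. Poly_Mapping.lookup f A * of_bool (a W = A)) *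
        (\<Sum>B\<in>Poly_Mapping.keys g. Poly_Mapping.lookup g B * of_bool (b W = B)))"
      by (simp only: sum_product)
    also have "\<dots> = (\<Sum>W\<in>S. Poly_Mapping.lookup f (a W) * Poly_Mapping.lookup g (b W))"
      by (intro sum.cong refl) (auto simp: of_bool_def if_distrib[of "\<lambda>x. _ * x"] in_keys_iff cong: if_cong)
    finally show ?thesis using True by simp
  qed simp
  finally show ?thesis .
qed

lemma card_nonzero_ex: "card S \<noteq> 0 \<Longrightarrow> \<exists>x. x \<in> S"
  by (metis card.empty ex_in_conv)

lemma keys_sum_single_subset: "Poly_Mapping.keys (\<Sum>A\<in>S. Poly_Mapping.single A (1::rat)) \<subseteq> S"
proof -
  have "Poly_Mapping.lookup (\<Sum>A\<in>S. Poly_Mapping.single A (1::rat)) C = 0" if "C \<notin> S" for C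
    unfolding lookup_sum by (rule sum.neutral) (use that in \<open>auto simp: lookup_single when_def\<close>)
  then show ?thesis by (auto simp: in_keys_iff)
qed

context finite_quiver
begin

lemma subquo_sq:
  assumes X: "representation Q (X :: ('k::{field, finite}, 'v, 'a, 'x, 'm) rep_scheme)"
    and AB: "A \<in> subreps Q X" "B \<in> subreps Q X" "A \<le> B"
  shows "subquo Q X A B (sq Q X A B) (\<lambda>i x. A i +>\<^bsub>node_space (sub_rep X B) i\<^esub> x)"
proof -
  note s = subquo_sub[OF X AB(2)]
  note q = subquo_quot[OF subquo_rep[OF X s] sub_subrepI[OF X AB]]
  have "preim Q B (\<lambda>i x. x) A = A"
    using AB(3) subrepsD(2)[OF AB(1)] by (intro ext) (auto simp: preim_def le_fun_def)
  then show ?thesis using subquo_trans[OF X s q] preim_full[OF X s] by simp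
qed

lemma subquo_subrep:
  assumes X: "representation Q (X :: ('k::{field, finite}, 'v, 'a, 'x, 'm) rep_scheme)"
    and p: "subquo Q X A B (Y :: ('k, 'v, 'a, 'y, 'n) rep_scheme) p" and V: "V \<in> subreps Q Y"
  shows "subquo Q X A (preim Q B p V) (sub_rep Y V) p"
    and "\<exists>r. subquo Q X (preim Q B p V) B (quot_rep Q Y V) r"
proof -
  note Y = subquo_rep[OF X p]
  show "subquo Q X A (preim Q B p V) (sub_rep Y V) p"
    using subquo_trans[OF X p subquo_sub[OF Y V]] by (simp add: preim_zero[OF X p])
  show "\<exists>r. subquo Q X (preim Q B p V) B (quot_rep Q Y V) r"
    using subquo_trans[OF X p subquo_quot[OF Y V]] by (auto simp: preim_full[OF X p])
qed

section \<open>The correspondence theorem for subquotients\<close>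

lemma preim_image:
  assumes X: "representation Q (X :: ('k::{field, finite}, 'v, 'a, 'x, 'm) rep_scheme)"
    and p: "subquo Q X A B (Y :: ('k, 'v, 'a, 'y, 'n) rep_scheme) p"
    and W: "W \<in> subreps Q X" "A \<le> W" "W \<le> B"
  shows "(\<lambda>i\<in>verts Q. p i ` W i) \<in> subreps Q Y" "preim Q B p (\<lambda>i\<in>verts Q. p i ` W i) = W"
proof -
  note pD = subquoD[OF p] and WD = subrepsD[OF W(1)]
  have WB: "W i \<subseteq> B i" and AW: "A i \<subseteq> W i" for i using W(2,3) by (auto simp: le_fun_def)
  show "(\<lambda>i\<in>verts Q. p i ` W i) \<in> subreps Q Y"
  proof (rule subrepsI)
    fix i assume i: "i \<in> verts Q"
    note Wi = ksubspaceD[OF WD(1)[OF i]] and Yi = rep_spaceD(1)[OF subquo_rep[OF X p] i]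
      and Ai = ksubspaceD[OF subrepsD(1)[OF pD(1) i]]
    have "ksubspace (p i ` W i) (node_space Y i)"
      unfolding ksubspace_iff[OF Yi]
    proof (intro conjI allI ballI)
      show "p i ` W i \<subseteq> carrier (node_space Y i)" using pD(4)[OF i] WB by blast
      have "p i \<zero>\<^bsub>node_space X i\<^esub> = \<zero>\<^bsub>node_space Y i\<^esub>" using pD(3,7)[OF i] Ai(2) by blast
      then show "\<zero>\<^bsub>node_space Y i\<^esub> \<in> p i ` W i" using Wi(2) by (metis imageI)
      fix y assume "y \<in> p i ` W i"
      then obtain x where x: "x \<in> W i" "y = p i x" by blast
      then have xB: "x \<in> B i" using WB by blast
      show "c \<odot>\<^bsub>node_space Y i\<^esub> y \<in> p i ` W i" for c
        using pD(6)[OF i xB, of c] x(2) Wi(4)[OF x(1), of c] by (metis imageI)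
      fix y' assume "y' \<in> p i ` W i"
      then obtain x' where x': "x' \<in> W i" "y' = p i x'" by blast
      then have xB': "x' \<in> B i" using WB by blast
      show "y \<oplus>\<^bsub>node_space Y i\<^esub> y' \<in> p i ` W i"
        using pD(5)[OF i xB xB'] x(2) x'(2) Wi(3)[OF x(1) x'(1)] by (metis imageI)
    qed
    then show "ksubspace ((\<lambda>i\<in>verts Q. p i ` W i) i) (node_space Y i)" using i by simp
  next
    fix a y assume a: "a \<in> arcs Q" and "y \<in> (\<lambda>i\<in>verts Q. p i ` W i) (tail Q a)"
    then obtain x where x: "x \<in> W (tail Q a)" "y = p (tail Q a) x" using arc_verts(1) by auto
    then have "arrow_map Y a y = p (head Q a) (arrow_map X a x)" using pD(8)[OF a] WB by fastforce
    then show "arrow_map Y a y \<in> (\<lambda>i\<in>verts Q. p i ` W i) (head Q a)"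
      using arc_verts(2)[OF a] WD(3)[OF a x(1)] by simp
  qed simp
  have "x \<in> W i" if i: "i \<in> verts Q" and x: "x \<in> B i" "p i x \<in> p i ` W i" for i x
  proof -
    interpret V: vectorspace "class_ring :: 'k ring" "node_space X i" by (rule rep_spaceD(1)[OF X i])
    obtain x' where x': "x' \<in> W i" "p i x = p i x'" using x(2) by blast
    have B': "x' \<in> B i" using x'(1) WB by blast
    have c: "x \<in> carrier (node_space X i)" "x' \<in> carrier (node_space X i)"
      using x(1) B' ksubspaceD(1)[OF subrepsD(1)[OF pD(2) i]] by blast+
    have "x \<ominus>\<^bsub>node_space X i\<^esub> x' \<in> W i" using subquo_eq_iff[OF X p i x(1) B'] x'(2) AW by blast
    moreover have "x = (x \<ominus>\<^bsub>node_space X i\<^esub> x') \<oplus>\<^bsub>node_space X i\<^esub> x'"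
      using c by (simp add: a_minus_def V.a_assoc V.l_neg)
    ultimately show ?thesis using ksubspaceD(3)[OF WD(1)[OF i] _ x'(1)] by metis
  qed
  then show "preim Q B p (\<lambda>i\<in>verts Q. p i ` W i) = W"
    using WB WD(2) by (intro ext) (auto simp: preim_def)
qed

lemma image_preim:
  assumes p: "subquo Q (X :: ('k::{field, finite}, 'v, 'a, 'x, 'm) rep_scheme) A B (Y :: ('k, 'v, 'a, 'y, 'n) rep_scheme) p"
    and V: "V \<in> subreps Q Y"
  shows "(\<lambda>i\<in>verts Q. p i ` preim Q B p V i) = V"
proof (rule ext)
  fix i
  show "(\<lambda>i\<in>verts Q. p i ` preim Q B p V i) i = V i"
  proof (cases "i \<in> verts Q")
    case True
    then have "V i \<subseteq> p i ` B i"
      using subquoD(4)[OF p True] ksubspaceD(1)[OF subrepsD(1)[OF V True]] by simp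
    then show ?thesis using True by (auto simp: preim_def)
  qed (simp add: subrepsD(2)[OF V])
qed

lemma bij_betw_preim:
  assumes X: "representation Q (X :: ('k::{field, finite}, 'v, 'a, 'x, 'm) rep_scheme)"
    and p: "subquo Q X A B (Y :: ('k, 'v, 'a, 'y, 'n) rep_scheme) p"
  shows "bij_betw (preim Q B p) (subreps Q Y) {W \<in> subreps Q X. A \<le> W \<and> W \<le> B}"
  by (rule bij_betwI[where g = "\<lambda>W. \<lambda>i\<in>verts Q. p i ` W i"])
     (use preim_subrep[OF X p] preim_image[OF X p] image_preim[OF p] in auto)

lemma subquo_card:
  assumes X: "representation Q (X :: ('k::{field, finite}, 'v, 'a, 'x, 'm) rep_scheme)"
    and p: "subquo Q X A B (Y :: ('k, 'v, 'a, 'y, 'n) rep_scheme) p" and i: "i \<in> verts Q"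
  shows "card (B i) = card (A i) * card (carrier (node_space Y i))"
proof -
  note pD = subquoD[OF p] and Bi = subrepsD(1)[OF subquoD(2)[OF p] i]
  note Vi = rep_spaceD[OF X i]
  have "finite (B i)" using ksubspaceD(1)[OF Bi] Vi(2) finite_subset by blast
  moreover have "{x \<in> B i. p i x = \<zero>\<^bsub>node_space Y i\<^esub>} = A i" using pD(3,7)[OF i] by blast
  ultimately show ?thesis
    using card_hom[OF kspace_subspace[OF Vi(1) Bi] _ rep_spaceD(1)[OF subquo_rep[OF X p] i], of "p i"]
      pD(4-6)[OF i] by simp
qed

lemma lookup_dimvec:
  "Poly_Mapping.lookup (dimvec Q (M :: ('k::field, 'v, 'a, 'x, 'm) rep_scheme)) i =
    (if i \<in> verts Q then int (vectorspace.dim (class_ring :: 'k ring) (node_space M i)) else 0)"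
  using finite_verts by (simp add: dimvec_def lookup_sum if_distrib[of "\<lambda>x. _ * x"] cong: if_cong)

lemma dimvec_carrier: "dimvec Q (M :: ('k::field, 'v, 'a, 'x, 'm) rep_scheme) \<in> dimvecs Q"
proof -
  have "Poly_Mapping.keys (dimvec Q M) \<subseteq> verts Q"
    by (auto simp: in_keys_iff lookup_dimvec split: if_splits)
  then show ?thesis by (auto simp: dimvecs_def lookup_dimvec)
qed

lemma card_node_space:
  assumes "representation Q (M :: ('k::{field, finite}, 'v, 'a, 'x, 'm) rep_scheme)" "i \<in> verts Q"
  shows "card (carrier (node_space M i)) = CARD('k) ^ nat (Poly_Mapping.lookup (dimvec Q M) i)"
  using rep_spaceD(3)[OF assms] assms(2) by (simp add: lookup_dimvec)

text \<open>Multiplicativity of cardinalities, read on the exponents of the order of the field,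
  which exceeds 1.\<close>

lemma dimvec_subquo:
  assumes X: "representation Q (X :: ('k::{field, finite}, 'v, 'a, 'x, 'm) rep_scheme)"
    and p: "subquo Q X A B (Y :: ('k, 'v, 'a, 'y, 'n) rep_scheme) p"
  shows "dimvec Q (sub_rep X B) = dimvec Q (sub_rep X A) + dimvec Q Y"
proof (rule poly_mapping_eqI)
  fix i
  show "Poly_Mapping.lookup (dimvec Q (sub_rep X B)) i = Poly_Mapping.lookup (dimvec Q (sub_rep X A) + dimvec Q Y) i"
  proof (cases "i \<in> verts Q")
    case True
    note A = subquo_rep[OF X subquo_sub[OF X subquoD(1)[OF p]]]
      and B = subquo_rep[OF X subquo_sub[OF X subquoD(2)[OF p]]]
    let ?d = "\<lambda>M. vectorspace.dim (class_ring :: 'k ring) M"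
    have "card (B i) = card (A i) * card (carrier (node_space Y i))" by (rule subquo_card[OF X p True])
    then have "CARD('k) ^ ?d (node_space (sub_rep X B) i) =
        CARD('k) ^ (?d (node_space (sub_rep X A) i) + ?d (node_space Y i))"
      using rep_spaceD(3)[OF A True] rep_spaceD(3)[OF B True] rep_spaceD(3)[OF subquo_rep[OF X p] True]
      by (simp add: sub_rep_def power_add)
    then have "?d (node_space (sub_rep X B) i) = ?d (node_space (sub_rep X A) i) + ?d (node_space Y i)"
      using card_field_gt_1[where 'k = 'k] power_inject_exp by blast
    then show ?thesis using True by (simp add: lookup_add lookup_dimvec)
  qed (simp add: lookup_add lookup_dimvec)
qed

lemma dimvec_full_sub:
  "dimvec Q (sub_rep X (full_sub Q X)) = dimvec Q (X :: ('k::{field, finite}, 'v, 'a, 'x, 'm) rep_scheme)"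
  by (intro poly_mapping_eqI) (simp add: lookup_dimvec sub_rep_def full_sub_def)

lemma dimvec_zero_sub:
  assumes X: "representation Q (X :: ('k::{field, finite}, 'v, 'a, 'x, 'm) rep_scheme)"
  shows "dimvec Q (sub_rep X (zero_sub Q X)) = 0"
  using dimvec_subquo[OF X subquo_sub[OF X zero_sub_subrep[OF X]]] by simp

lemma isomorphic_trans:
  assumes X: "representation Q (X :: ('k::{field, finite}, 'v, 'a, 'x, 'm) rep_scheme)"
    and Y: "representation Q (Y :: ('k, 'v, 'a, 'y, 'n) rep_scheme)"
    and Z: "representation Q (Z :: ('k, 'v, 'a, 'w, 'l) rep_scheme)"
    and "isomorphic Q X Y" "isomorphic Q Y Z"
  shows "isomorphic Q X Z"
proof -
  obtain f g where f: "subquo Q X (zero_sub Q X) (full_sub Q X) Y f"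
    and g: "subquo Q Y (zero_sub Q Y) (full_sub Q Y) Z g"
    using assms(4,5) unfolding isomorphic_def rep_isomorphism_iff_subquo[OF X Y]
      rep_isomorphism_iff_subquo[OF Y Z] by blast
  show ?thesis
    using subquo_isomorphism[OF X f g] unfolding isomorphic_def rep_isomorphism_iff_subquo[OF X Z]
    by blast
qed

text \<open>Defined for representations over any element type, but with members over
  \<open>nat\<close> only: it names the basis element of the Hall algebra that belongs to a
  subrepresentation or to a quotient made of cosets.\<close>

definition iso_class :: "('k::field, 'v, 'a, 'x, 'm) rep_scheme \<Rightarrow> ('k, 'v, 'a) rep_class" where
  "iso_class M = {N. representation Q N \<and> isomorphic Q M N}"

text \<open>Two empty classes would be equal for no reason, hence the hypothesis \<open>ne\<close>;
  \<open>iso_class_nonempty\<close> discharges it by a copy on \<open>nat\<close>.\<close>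

lemma iso_class_eq_iff:
  assumes X: "representation Q (X :: ('k::{field, finite}, 'v, 'a, 'x, 'm) rep_scheme)"
    and Y: "representation Q (Y :: ('k, 'v, 'a, 'y, 'n) rep_scheme)"
    and ne: "iso_class Y \<noteq> {}"
  shows "iso_class X = iso_class Y \<longleftrightarrow> isomorphic Q X Y"
proof
  assume e: "iso_class X = iso_class Y"
  obtain N where N: "N \<in> iso_class Y" using ne by blast
  then have "representation Q N" "isomorphic Q X N" "isomorphic Q Y N"
    using e by (auto simp: iso_class_def)
  then show "isomorphic Q X Y" using isomorphic_trans[OF X _ Y] isomorphic_sym[OF Y] by blast
next
  assume "isomorphic Q X Y"
  then show "iso_class X = iso_class Y"
    using isomorphic_trans[OF X Y] isomorphic_trans[OF Y X] isomorphic_sym[OF X Y]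
    unfolding iso_class_def by blast
qed

definition copy_rep ::
  "('v \<Rightarrow> 'x \<Rightarrow> 'y) \<Rightarrow> ('k::field, 'v, 'a, 'x, 'm) rep_scheme \<Rightarrow> ('k, 'v, 'a, 'y) rep" where
  "copy_rep g M =
     (let h = (\<lambda>i. inv_into (carrier (node_space M i)) (g i)) in
     \<lparr>node_space = (\<lambda>i. \<lparr>carrier = g i ` carrier (node_space M i), mult = undefined, one = undefined,
        zero = g i \<zero>\<^bsub>node_space M i\<^esub>, add = (\<lambda>x y. g i (h i x \<oplus>\<^bsub>node_space M i\<^esub> h i y)),
        smult = (\<lambda>c x. g i (c \<odot>\<^bsub>node_space M i\<^esub> h i x))\<rparr>),
      arrow_map = (\<lambda>a x. g (head Q a) (arrow_map M a (h (tail Q a) x)))\<rparr>)"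

lemma subquo_copy:
  assumes X: "representation Q (X :: ('k::{field, finite}, 'v, 'a, 'x, 'm) rep_scheme)"
    and g: "\<And>i. i \<in> verts Q \<Longrightarrow> inj_on (g i) (carrier (node_space X i))"
  shows "subquo Q X (zero_sub Q X) (full_sub Q X) (copy_rep g X) g"
proof (rule subquoI)
  fix i x assume i: "i \<in> verts Q" and x: "x \<in> full_sub Q X i"
  then show "g i x = \<zero>\<^bsub>node_space (copy_rep g X) i\<^esub> \<longleftrightarrow> x \<in> zero_sub Q X i"
    using inj_on_eq_iff[OF g[OF i], of x "\<zero>\<^bsub>node_space X i\<^esub>"] kspace_closed(1)[OF rep_spaceD(1)[OF X i]]
    by (simp add: copy_rep_def Let_def zero_sub_def full_sub_def)
qed (use zero_sub_subrep[OF X] full_sub_subrep[OF X] rep_spaceD(1)[OF X, THEN kspace_closed(1)] g arc_verts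
      in \<open>auto simp: copy_rep_def Let_def zero_sub_def full_sub_def\<close>)

lemma nat_copy:
  assumes X: "representation Q (X :: ('k::{field, finite}, 'v, 'a, 'x, 'm) rep_scheme)"
  obtains g :: "'v \<Rightarrow> 'x \<Rightarrow> nat" where
    "\<And>i. i \<in> verts Q \<Longrightarrow> bij_betw (g i) (carrier (node_space X i)) {..<card (carrier (node_space X i))}"
proof -
  have "\<exists>f. bij_betw f (carrier (node_space X i)) {..<card (carrier (node_space X i))}"
    if "i \<in> verts Q" for i
    using ex_bij_betw_finite_nat[OF rep_spaceD(2)[OF X that]] by (simp add: atLeast0LessThan)
  then show thesis using that by metis
qed

text \<open>The bound depends only on the dimension vector, so all classes of that vector have
  members inside one finite set of structures; this feeds
  \<open>finite_iso_classes_dimvec\<close>.\<close>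

lemma iso_class_bounded_member:
  assumes X: "representation Q (X :: ('k::{field, finite}, 'v, 'a, 'x, 'm) rep_scheme)"
  shows "\<exists>N\<in>iso_class X. \<forall>i\<in>verts Q. carrier (node_space N i) \<subseteq> {..<card (carrier (node_space X i))}"
proof -
  obtain g :: "'v \<Rightarrow> 'x \<Rightarrow> nat" where
    g: "\<And>i. i \<in> verts Q \<Longrightarrow> bij_betw (g i) (carrier (node_space X i)) {..<card (carrier (node_space X i))}"
    using nat_copy[OF X] by blast
  have c: "subquo Q X (zero_sub Q X) (full_sub Q X) (copy_rep g X) g"
    by (rule subquo_copy[OF X bij_betw_imp_inj_on[OF g]])
  have N: "copy_rep g X \<in> iso_class X"
    using subquo_rep[OF X c] c rep_isomorphism_iff_subquo[OF X subquo_rep[OF X c]]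
    unfolding iso_class_def isomorphic_def by blast
  show ?thesis
  proof (rule bexI[OF _ N], rule ballI)
    fix i assume "i \<in> verts Q"
    then show "carrier (node_space (copy_rep g X) i) \<subseteq> {..<card (carrier (node_space X i))}"
      using g by (simp add: copy_rep_def Let_def bij_betw_def)
  qed
qed

lemma iso_class_nonempty:
  assumes X: "representation Q (X :: ('k::{field, finite}, 'v, 'a, 'x, 'm) rep_scheme)"
  shows "iso_class X \<noteq> {}"
  using iso_class_bounded_member[OF X] by blast

lemma iso_rel_image: "representation Q M \<Longrightarrow> iso_rel Q `` {M} = iso_class M"
  by (auto simp: iso_rel_def iso_class_def)

lemma iso_class_in_iso_classes:
  assumes X: "representation Q (X :: ('k::{field, finite}, 'v, 'a, 'x, 'm) rep_scheme)"
  shows "iso_class X \<in> iso_classes Q"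
proof -
  obtain N :: "('k, 'v, 'a, nat) rep" where N: "representation Q N" "isomorphic Q X N"
    using iso_class_nonempty[OF X] unfolding iso_class_def by blast
  then have "iso_class X = iso_class N"
    using iso_class_eq_iff[OF X N(1)] iso_class_nonempty[OF N(1)] by blast
  then show ?thesis
    using N(1) iso_rel_image[OF N(1)] unfolding iso_classes_def quotient_def by blast
qed

lemma iso_classesD:
  assumes "C \<in> (iso_classes Q :: ('k::{field, finite}, 'v, 'a) rep_class set)"
  shows "class_repr C \<in> C" "representation Q (class_repr C)" "iso_class (class_repr C) = C"
    and "N \<in> C \<Longrightarrow> representation Q N \<and> iso_class N = C"
proof -
  obtain M :: "('k, 'v, 'a, nat) rep" where M: "representation Q M" "C = iso_class M"
    using assms unfolding iso_classes_def quotient_def by (auto simp: iso_rel_image)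
  show 1: "representation Q N \<and> iso_class N = C" if "N \<in> C" for N
    using that M iso_class_eq_iff[OF M(1) _ iso_class_nonempty]
    unfolding M(2) iso_class_def by blast
  show 2: "class_repr C \<in> C"
    using iso_class_nonempty[OF M(1)] unfolding M(2) class_repr_def by (simp add: some_in_eq)
  show "representation Q (class_repr C)" "iso_class (class_repr C) = C" using 1[OF 2] by auto
qed

lemma class_repr_subquo:
  assumes X: "representation Q (X :: ('k::{field, finite}, 'v, 'a, 'x, 'm) rep_scheme)"
    and p: "subquo Q X A B (Y :: ('k, 'v, 'a, 'y, 'n) rep_scheme) p"
  shows "\<exists>r. subquo Q X A B (class_repr (iso_class Y)) r"
proof -
  note Y = subquo_rep[OF X p]
  note C = iso_classesD[OF iso_class_in_iso_classes[OF Y]]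
  have "isomorphic Q Y (class_repr (iso_class Y))" using C(1) by (simp add: iso_class_def)
  then show ?thesis
    using subquo_isomorphism[OF X p] unfolding isomorphic_def rep_isomorphism_iff_subquo[OF Y C(2)]
    by blast
qed

lemma iso_class_subquo:
  assumes X: "representation Q (X :: ('k::{field, finite}, 'v, 'a, 'x, 'm) rep_scheme)"
    and "subquo Q X A B (Y :: ('k, 'v, 'a, 'y, 'n) rep_scheme) p"
    and "subquo Q X A B (Z :: ('k, 'v, 'a, 'w, 'l) rep_scheme) r"
  shows "iso_class Y = iso_class Z"
  using iso_class_eq_iff[OF subquo_rep[OF X assms(2)] subquo_rep[OF X assms(3)]]
    iso_class_nonempty[OF subquo_rep[OF X assms(3)]] subquo_isomorphic[OF X assms(2,3)] by blast

lemma dimvec_class_repr: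
  assumes X: "representation Q (X :: ('k::{field, finite}, 'v, 'a, 'x, 'm) rep_scheme)"
  shows "dimvec Q (class_repr (iso_class X)) = dimvec Q X"
  using class_repr_subquo[OF X subquo_refl[OF X]] dimvec_subquo[OF X] subquo_refl[OF X]
  by (metis add_left_cancel)

section \<open>Finiteness of the set of classes with a given dimension vector\<close>

lemma finite_by_code:
  assumes "finite T" "\<And>C. C \<in> Cs \<Longrightarrow> \<exists>N\<in>C. good N \<and> code N \<in> T"
    and "\<And>C D N N'. C \<in> Cs \<Longrightarrow> D \<in> Cs \<Longrightarrow> N \<in> C \<Longrightarrow> N' \<in> D \<Longrightarrow> good N \<Longrightarrow> good N' \<Longrightarrow>
      code N = code N' \<Longrightarrow> C = D"
  shows "finite Cs"
proof -
  obtain h where h: "\<And>C. C \<in> Cs \<Longrightarrow> h C \<in> C \<and> good (h C) \<and> code (h C) \<in> T"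
    using assms(2) by metis
  have "inj_on (\<lambda>C. code (h C)) Cs"
    by (rule inj_onI) (use h assms(3) in blast)
  moreover have "(\<lambda>C. code (h C)) ` Cs \<subseteq> T" using h by blast
  ultimately show ?thesis using assms(1) inj_on_finite by blast
qed

text \<open>The structure of a representation carried by \<open>{..n}\<close>, with junk outside the carriers removed.\<close>

definition rep_code :: "nat \<Rightarrow> ('k::field, 'v, 'a, nat, 'm) rep_scheme \<Rightarrow>
  ('v \<Rightarrow> nat set) \<times> ('v \<Rightarrow> nat \<Rightarrow> nat \<Rightarrow> nat) \<times> ('v \<Rightarrow> 'k \<Rightarrow> nat \<Rightarrow> nat) \<times> ('a \<Rightarrow> nat \<Rightarrow> nat)" where
  "rep_code n M = ((\<lambda>i\<in>verts Q. carrier (node_space M i)),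
     (\<lambda>i\<in>verts Q. \<lambda>x\<in>{..n}. \<lambda>y\<in>{..n}.
        if x \<in> carrier (node_space M i) \<and> y \<in> carrier (node_space M i) then x \<oplus>\<^bsub>node_space M i\<^esub> y else 0),
     (\<lambda>i\<in>verts Q. \<lambda>c. \<lambda>x\<in>{..n}. if x \<in> carrier (node_space M i) then c \<odot>\<^bsub>node_space M i\<^esub> x else 0),
     (\<lambda>a\<in>arcs Q. \<lambda>x\<in>{..n}. if x \<in> carrier (node_space M (tail Q a)) then arrow_map M a x else 0))"

definition rep_codes :: "nat \<Rightarrow>
  (('v \<Rightarrow> nat set) \<times> ('v \<Rightarrow> nat \<Rightarrow> nat \<Rightarrow> nat) \<times> ('v \<Rightarrow> 'k \<Rightarrow> nat \<Rightarrow> nat) \<times> ('a \<Rightarrow> nat \<Rightarrow> nat)) set" where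
  "rep_codes n = (verts Q \<rightarrow>\<^sub>E Pow {..n}) \<times> (verts Q \<rightarrow>\<^sub>E {..n} \<rightarrow>\<^sub>E {..n} \<rightarrow>\<^sub>E {..n}) \<times>
     (verts Q \<rightarrow>\<^sub>E UNIV \<rightarrow>\<^sub>E {..n} \<rightarrow>\<^sub>E {..n}) \<times> (arcs Q \<rightarrow>\<^sub>E {..n} \<rightarrow>\<^sub>E {..n})"

lemma finite_rep_codes:
  "finite (rep_codes n :: (_ \<times> _ \<times> ('v \<Rightarrow> 'k::finite \<Rightarrow> nat \<Rightarrow> nat) \<times> _) set)"
  unfolding rep_codes_def using finite_verts finite_arcs
  by (intro finite_cartesian_product finite_PiE) auto

lemma rep_code_in:
  assumes M: "representation Q (M :: ('k::{field, finite}, 'v, 'a, nat, 'm) rep_scheme)"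
    and n: "\<And>i. i \<in> verts Q \<Longrightarrow> carrier (node_space M i) \<subseteq> {..n}"
  shows "rep_code n M \<in> rep_codes n"
proof -
  have "x \<oplus>\<^bsub>node_space M i\<^esub> y \<le> n"
    if "i \<in> verts Q" "x \<in> carrier (node_space M i)" "y \<in> carrier (node_space M i)" for i x y
    using kspace_closed(2)[OF rep_spaceD(1)[OF M that(1)] that(2,3)] n[OF that(1)] by auto
  moreover have "c \<odot>\<^bsub>node_space M i\<^esub> x \<le> n" if "i \<in> verts Q" "x \<in> carrier (node_space M i)" for i x c
    using kspace_closed(4)[OF rep_spaceD(1)[OF M that(1)] that(2), of c] n[OF that(1)] by auto
  moreover have "arrow_map M a x \<le> n" if "a \<in> arcs Q" "x \<in> carrier (node_space M (tail Q a))" for a x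
    using rep_arrowD(1)[OF M that] n[OF arc_verts(2)[OF that(1)]] by auto
  ultimately show ?thesis using n by (auto simp: rep_code_def rep_codes_def PiE_iff extensional_def)
qed

lemma rep_code_eq:
  assumes M: "representation Q (M :: ('k::{field, finite}, 'v, 'a, nat, 'm) rep_scheme)"
    and N: "representation Q (N :: ('k, 'v, 'a, nat, 'l) rep_scheme)"
    and n: "\<And>i. i \<in> verts Q \<Longrightarrow> carrier (node_space M i) \<subseteq> {..n}"
    and e: "rep_code n M = rep_code n N"
  shows "rep_isomorphism Q M N (\<lambda>i x. x)"
proof -
  have c: "carrier (node_space M i) = carrier (node_space N i)" if "i \<in> verts Q" for i
    using arg_cong[OF e, of "\<lambda>(c, _). c i"] that by (simp add: rep_code_def)
  have a: "x \<oplus>\<^bsub>node_space M i\<^esub> y = x \<oplus>\<^bsub>node_space N i\<^esub> y"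
    if "i \<in> verts Q" "x \<in> carrier (node_space M i)" "y \<in> carrier (node_space M i)" for i x y
    using arg_cong[OF e, of "\<lambda>(_, f, _). f i x y"] that n[OF that(1)] c[OF that(1)]
    by (auto simp: rep_code_def subset_eq)
  have s: "k \<odot>\<^bsub>node_space M i\<^esub> x = k \<odot>\<^bsub>node_space N i\<^esub> x"
    if "i \<in> verts Q" "x \<in> carrier (node_space M i)" for i x k
    using arg_cong[OF e, of "\<lambda>(_, _, f, _). f i k x"] that n[OF that(1)] c[OF that(1)]
    by (auto simp: rep_code_def subset_eq)
  have m: "arrow_map M b x = arrow_map N b x"
    if "b \<in> arcs Q" "x \<in> carrier (node_space M (tail Q b))" for b x
    using arg_cong[OF e, of "\<lambda>(_, _, _, f). f b x"] that n[OF arc_verts(1)[OF that(1)]]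
      c[OF arc_verts(1)[OF that(1)]]
    by (auto simp: rep_code_def subset_eq)
  show ?thesis unfolding rep_isomorphism_def
    using rep_spaceD(1)[OF M] rep_spaceD(1)[OF N] a s m c
    by (auto intro!: linear_mapI simp: bij_betw_def)
qed

lemma finite_iso_classes_dimvec:
  "finite {C \<in> iso_classes Q. dimvec Q (class_repr C :: ('k::{field, finite}, 'v, 'a, nat) rep) = d}"
proof -
  \<comment> \<open>The sum of the cardinalities of the node spaces, a common bound for each of
    them.\<close>
  define n where "n = (\<Sum>i\<in>verts Q. CARD('k) ^ nat (Poly_Mapping.lookup d i))"
  have n: "CARD('k) ^ nat (Poly_Mapping.lookup d i) \<le> n" if "i \<in> verts Q" for i
    unfolding n_def by (rule member_le_sum[OF that]) (use finite_verts in auto)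
  let ?good = "\<lambda>N :: ('k, 'v, 'a, nat) rep. \<forall>i\<in>verts Q. carrier (node_space N i) \<subseteq> {..n}"
  show ?thesis
  proof (rule finite_by_code[where good = ?good and code = "rep_code n" and T = "rep_codes n"])
    show "finite (rep_codes n :: (_ \<times> _ \<times> ('v \<Rightarrow> 'k \<Rightarrow> nat \<Rightarrow> nat) \<times> _) set)" by (rule finite_rep_codes)
  next
    fix C :: "('k, 'v, 'a) rep_class"
    assume "C \<in> {C \<in> iso_classes Q. dimvec Q (class_repr C) = d}"
    then have C: "C \<in> iso_classes Q" "dimvec Q (class_repr C) = d" by auto
    note CD = iso_classesD[OF C(1)]
    obtain N where N: "N \<in> C" "\<forall>i\<in>verts Q. carrier (node_space N i) \<subseteq> {..<card (carrier (node_space (class_repr C) i))}"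
      using iso_class_bounded_member[OF CD(2)] CD(3) by auto
    have "?good N"
    proof
      fix i assume i: "i \<in> verts Q"
      have "card (carrier (node_space (class_repr C) i)) \<le> n"
        using n[OF i] card_node_space[OF CD(2) i] C(2) by simp
      then show "carrier (node_space N i) \<subseteq> {..n}" using N(2) i by fastforce
    qed
    then show "\<exists>N\<in>C. ?good N \<and> rep_code n N \<in> rep_codes n"
      using N(1) CD(4)[OF N(1)] rep_code_in[of N n] by blast
  next
    fix C D :: "('k, 'v, 'a) rep_class" and N N' :: "('k, 'v, 'a, nat) rep"
    assume "C \<in> {C \<in> iso_classes Q. dimvec Q (class_repr C) = d}" "N \<in> C"
      and "D \<in> {C \<in> iso_classes Q. dimvec Q (class_repr C) = d}" "N' \<in> D"
      and g: "?good N" "?good N'" and e: "rep_code n N = rep_code n N'"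
    then have N: "representation Q N" "iso_class N = C" "representation Q N'" "iso_class N' = D"
      using iso_classesD(4)[of C N] iso_classesD(4)[of D N'] by simp_all
    have "isomorphic Q N N'" using rep_code_eq[OF N(1,3) _ e] g(1) unfolding isomorphic_def by blast
    then show "C = D" using iso_class_eq_iff[OF N(1,3) iso_class_nonempty[OF N(3)]] N by blast
  qed
qed

section \<open>Coefficients of Hall products as weighted flag counts\<close>

lemma lookup_hall_mult:
  fixes f g :: "('k::{field, finite}, 'v, 'a) hall_algebra"
  assumes f: "Poly_Mapping.keys f \<subseteq> iso_classes Q" and g: "Poly_Mapping.keys g \<subseteq> iso_classes Q"
  shows "Poly_Mapping.lookup (hall_mult Q f g) C =
    (if C \<in> iso_classes Q then
      (\<Sum>W\<in>subreps Q (class_repr C). Poly_Mapping.lookup f (iso_class (sub_rep (class_repr C) W)) *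
        Poly_Mapping.lookup g (iso_class (quot_rep Q (class_repr C) W))) else 0)"
proof (cases "C \<in> iso_classes Q")
  case False
  then show ?thesis
    unfolding hall_mult_def Let_def lookup_sum by (auto intro!: sum.neutral simp: lookup_single when_def)
next
  case True
  have eq: "hall_number Q (class_repr C) (class_repr A) (class_repr B) =
      card {W \<in> subreps Q (class_repr C). iso_class (sub_rep (class_repr C) W) = A \<and>
        iso_class (quot_rep Q (class_repr C) W) = B}"
    if C: "C \<in> iso_classes Q" and A: "A \<in> iso_classes Q" and B: "B \<in> iso_classes Q"
    for A B C :: "('k, 'v, 'a) rep_class"
  proof -
    note X = iso_classesD(2)[OF C]
    have "isomorphic Q (sub_rep (class_repr C) W) (class_repr A) \<longleftrightarrow> iso_class (sub_rep (class_repr C) W) = A"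
      "isomorphic Q (quot_rep Q (class_repr C) W) (class_repr B) \<longleftrightarrow> iso_class (quot_rep Q (class_repr C) W) = B"
      if W: "W \<in> subreps Q (class_repr C)" for W
      using iso_class_eq_iff[OF subquo_rep[OF X subquo_sub[OF X W]] iso_classesD(2)[OF A]]
        iso_class_eq_iff[OF subquo_rep[OF X subquo_quot[OF X W]] iso_classesD(2)[OF B]]
        iso_classesD(1,3)[OF A] iso_classesD(1,3)[OF B]
      by blast+
    then show ?thesis
      unfolding hall_number_def by (metis (no_types, lifting))
  qed
  \<comment> \<open>A nonzero Hall number forces the middle term to have the sum of the two
    dimension vectors.\<close>
  have fin: "finite {C \<in> iso_classes Q. hall_number Q (class_repr C) (class_repr A) (class_repr B) \<noteq> 0}"
    if A: "A \<in> iso_classes Q" and B: "B \<in> iso_classes Q" for A B :: "('k, 'v, 'a) rep_class"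
  proof (rule finite_subset[OF _ finite_iso_classes_dimvec])
    show "{C \<in> iso_classes Q. hall_number Q (class_repr C) (class_repr A) (class_repr B) \<noteq> 0} \<subseteq>
      {C \<in> iso_classes Q. dimvec Q (class_repr C) = dimvec Q (class_repr A) + dimvec Q (class_repr B)}"
    proof
      fix C assume "C \<in> {C \<in> iso_classes Q. hall_number Q (class_repr C) (class_repr A) (class_repr B) \<noteq> 0}"
      then have C: "C \<in> iso_classes Q" and "hall_number Q (class_repr C) (class_repr A) (class_repr B) \<noteq> 0"
        by auto
      from card_nonzero_ex[OF this(2)[unfolded eq[OF C A B]]]
      obtain W where W: "W \<in> subreps Q (class_repr C)" "iso_class (sub_rep (class_repr C) W) = A"
        "iso_class (quot_rep Q (class_repr C) W) = B" by auto
      note X = iso_classesD(2)[OF C]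
      note s = subquo_sub[OF X W(1)] and q = subquo_quot[OF X W(1)]
      have "dimvec Q (class_repr A) = dimvec Q (sub_rep (class_repr C) W)"
        "dimvec Q (class_repr B) = dimvec Q (quot_rep Q (class_repr C) W)"
        using dimvec_class_repr[OF subquo_rep[OF X s]] dimvec_class_repr[OF subquo_rep[OF X q]] W(2,3)
        by auto
      then show "C \<in> {C \<in> iso_classes Q. dimvec Q (class_repr C) = dimvec Q (class_repr A) + dimvec Q (class_repr B)}"
        using C dimvec_subquo[OF X q] by (simp add: dimvec_full_sub)
    qed
  qed
  show ?thesis
    unfolding hall_mult_def Let_def
    by (rule lookup_structure_sum[where a = "\<lambda>W. iso_class (sub_rep (class_repr C) W)"
          and b = "\<lambda>W. iso_class (quot_rep Q (class_repr C) W)"])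
       (use fin eq f g finite_subreps[OF iso_classesD(2)[OF True]] in blast)+
qed

lemma keys_hall_mult:
  fixes f g :: "('k::{field, finite}, 'v, 'a) hall_algebra"
  assumes "Poly_Mapping.keys f \<subseteq> iso_classes Q" "Poly_Mapping.keys g \<subseteq> iso_classes Q"
  shows "Poly_Mapping.keys (hall_mult Q f g) \<subseteq> iso_classes Q"
  using lookup_hall_mult[OF assms] by (auto simp: in_keys_iff split: if_splits)

text \<open>The sum over subrepresentations of a chosen representative is reindexed, by the
  correspondence theorem, over the W between \<open>A\<close> and \<open>B\<close> in
  \<open>X\<close>. Both factors are then evaluated at subquotients of the same \<open>X\<close>,
  which allows iteration.\<close>

lemma lookup_hall_mult_subquo:
  fixes f g :: "('k::{field, finite}, 'v, 'a) hall_algebra"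
  assumes f: "Poly_Mapping.keys f \<subseteq> iso_classes Q" and g: "Poly_Mapping.keys g \<subseteq> iso_classes Q"
    and X: "representation Q (X :: ('k, 'v, 'a, 'x, 'm) rep_scheme)"
    and p: "subquo Q X A B (Y :: ('k, 'v, 'a, 'y, 'n) rep_scheme) p"
  shows "Poly_Mapping.lookup (hall_mult Q f g) (iso_class Y) =
    (\<Sum>W | W \<in> subreps Q X \<and> A \<le> W \<and> W \<le> B.
      Poly_Mapping.lookup f (iso_class (sq Q X A W)) * Poly_Mapping.lookup g (iso_class (sq Q X W B)))"
proof -
  let ?Z = "class_repr (iso_class Y)"
  obtain r where r: "subquo Q X A B ?Z r" using class_repr_subquo[OF X p] by blast
  have "Poly_Mapping.lookup (hall_mult Q f g) (iso_class Y) = (\<Sum>V\<in>subreps Q ?Z.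
      Poly_Mapping.lookup f (iso_class (sub_rep ?Z V)) * Poly_Mapping.lookup g (iso_class (quot_rep Q ?Z V)))"
    using lookup_hall_mult[OF f g] iso_class_in_iso_classes[OF subquo_rep[OF X p]] by simp
  also have "\<dots> = (\<Sum>V\<in>subreps Q ?Z. Poly_Mapping.lookup f (iso_class (sq Q X A (preim Q B r V))) *
      Poly_Mapping.lookup g (iso_class (sq Q X (preim Q B r V) B)))"
  proof (rule sum.cong[OF refl])
    fix V assume V: "V \<in> subreps Q ?Z"
    note W = preim_subrep[OF X r V] and AB = subquoD(1,2)[OF r]
    obtain t where t: "subquo Q X (preim Q B r V) B (quot_rep Q ?Z V) t"
      using subquo_subrep(2)[OF X r V] by blast
    have "iso_class (sub_rep ?Z V) = iso_class (sq Q X A (preim Q B r V))"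
      by (rule iso_class_subquo[OF X subquo_subrep(1)[OF X r V] subquo_sq[OF X AB(1) W(1,2)]])
    moreover have "iso_class (quot_rep Q ?Z V) = iso_class (sq Q X (preim Q B r V) B)"
      by (rule iso_class_subquo[OF X t subquo_sq[OF X W(1) AB(2) W(3)]])
    ultimately show "Poly_Mapping.lookup f (iso_class (sub_rep ?Z V)) *
        Poly_Mapping.lookup g (iso_class (quot_rep Q ?Z V)) =
      Poly_Mapping.lookup f (iso_class (sq Q X A (preim Q B r V))) *
        Poly_Mapping.lookup g (iso_class (sq Q X (preim Q B r V) B))" by simp
  qed
  also have "\<dots> = (\<Sum>W | W \<in> subreps Q X \<and> A \<le> W \<and> W \<le> B.
      Poly_Mapping.lookup f (iso_class (sq Q X A W)) * Poly_Mapping.lookup g (iso_class (sq Q X W B)))"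
    by (rule sum.reindex_bij_betw[OF bij_betw_preim[OF X r]])
  finally show ?thesis .
qed

lemma subquo_zero_rep:
  assumes X: "representation Q (X :: ('k::{field, finite}, 'v, 'a, 'x, 'm) rep_scheme)" and A: "A \<in> subreps Q X"
  shows "subquo Q X A A (zero_rep :: ('k, 'v, 'a, nat) rep) (\<lambda>i x. 0)"
  by (rule subquoI) (use A ksubspaceD(2)[OF subrepsD(1)[OF A]] in \<open>auto simp: zero_rep_def\<close>)

lemma representation_zero_rep: "representation Q (zero_rep :: ('k::{field, finite}, 'v, 'a, nat) rep)"
proof -
  let ?Z = "zero_rep :: ('k, 'v, 'a, nat) rep"
  have Z: "kspace (node_space ?Z i)" for i
    by (rule kspaceI, rule abelian_groupI) (auto simp: zero_rep_def)
  show ?thesis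
    unfolding representation_def using Z
    by (auto intro!: linear_mapI fin_dim_finite Z simp: zero_rep_def)
qed

lemma lookup_hall_one:
  assumes X: "representation Q (X :: ('k::{field, finite}, 'v, 'a, 'x, 'm) rep_scheme)"
    and p: "subquo Q X A B (Y :: ('k, 'v, 'a, 'y, 'n) rep_scheme) p"
  shows "Poly_Mapping.lookup (hall_one Q) (iso_class Y) = of_bool (A = B)"
proof -
  note pD = subquoD[OF p]
  note z = subquo_zero_rep[OF X pD(1)]
  have "A = B" if e: "iso_class zero_rep = iso_class Y"
  proof (rule subreps_eqI[OF pD(1,2)])
    fix i assume i: "i \<in> verts Q"
    have "isomorphic Q (zero_rep :: ('k, 'v, 'a, nat) rep) Y"
      using iso_class_eq_iff[OF representation_zero_rep subquo_rep[OF X p] iso_class_nonempty[OF subquo_rep[OF X p]]] e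
      by simp
    then have "card (carrier (node_space Y i)) = 1"
      using i unfolding isomorphic_def rep_isomorphism_def by (auto simp: zero_rep_def dest!: bij_betw_same_card)
    then have "card (B i) = card (A i)" using subquo_card[OF X p i] by simp
    moreover have "finite (B i)"
      using ksubspaceD(1)[OF subrepsD(1)[OF pD(2) i]] rep_spaceD(2)[OF X i] finite_subset by blast
    ultimately show "A i = B i" using card_subset_eq pD(3)[OF i] by metis
  qed
  moreover have "iso_class (zero_rep :: ('k, 'v, 'a, nat) rep) = iso_class Y" if "A = B"
    using iso_class_subquo[OF X z] p that by blast
  ultimately show ?thesis
    unfolding hall_one_def iso_rel_image[OF representation_zero_rep] by (auto simp: lookup_single when_def)
qed

lemma keys_hall_prod:
  fixes fs :: "('k::{field, finite}, 'v, 'a) hall_algebra list"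
  assumes "\<forall>f\<in>set fs. Poly_Mapping.keys f \<subseteq> iso_classes Q"
  shows "Poly_Mapping.keys (hall_prod Q fs) \<subseteq> iso_classes Q"
  using assms
proof (induction fs)
  case Nil
  have "iso_class (zero_rep :: ('k, 'v, 'a, nat) rep) \<in> iso_classes Q"
    by (rule iso_class_in_iso_classes[OF representation_zero_rep])
  then show ?case by (simp add: hall_prod_def hall_one_def iso_rel_image[OF representation_zero_rep])
next
  case (Cons f fs)
  then show ?case using keys_hall_mult[of f "hall_prod Q fs"] by (simp add: hall_prod_def)
qed

text \<open>Weighted count of flags from \<open>A\<close> up to \<open>B\<close>, trivial steps
  allowed. The base case forces the last term to be \<open>B\<close>, matching the unit of the
  algebra.\<close>

fun flag_sum :: "('k::field, 'v, 'a, 'x, 'm) rep_scheme \<Rightarrow> ('k, 'v, 'a) hall_algebra list \<Rightarrow>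
  ('v \<Rightarrow> 'x set) \<Rightarrow> ('v \<Rightarrow> 'x set) \<Rightarrow> rat" where
  "flag_sum X [] A B = of_bool (A = B)"
| "flag_sum X (f # fs) A B = (\<Sum>W | W \<in> subreps Q X \<and> A \<le> W \<and> W \<le> B.
     Poly_Mapping.lookup f (iso_class (sq Q X A W)) * flag_sum X fs W B)"

text \<open>In a product the left factor is the subobject and \<open>hall_prod\<close> folds to the
  right, so each factor peels off the lowest step of the flag.\<close>

lemma lookup_hall_prod:
  fixes fs :: "('k::{field, finite}, 'v, 'a) hall_algebra list"
  assumes "\<forall>f\<in>set fs. Poly_Mapping.keys f \<subseteq> iso_classes Q"
    and X: "representation Q (X :: ('k, 'v, 'a, 'x, 'm) rep_scheme)"
    and "subquo Q X A B (Y :: ('k, 'v, 'a, 'y, 'n) rep_scheme) p"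
  shows "Poly_Mapping.lookup (hall_prod Q fs) (iso_class Y) = flag_sum X fs A B"
proof -
  have *: "Poly_Mapping.lookup (hall_prod Q fs) (iso_class (sq Q X A B)) = flag_sum X fs A B"
    if "A \<in> subreps Q X" "B \<in> subreps Q X" "A \<le> B" for A
    using assms(1) that
  proof (induction fs arbitrary: A)
    case Nil
    then show ?case using lookup_hall_one[OF X subquo_sq[OF X Nil.prems(2-4)]] by (simp add: hall_prod_def)
  next
    case (Cons f fs)
    have k: "Poly_Mapping.keys f \<subseteq> iso_classes Q" "Poly_Mapping.keys (hall_prod Q fs) \<subseteq> iso_classes Q"
      using Cons.prems(1) keys_hall_prod[of fs] by auto
    have "Poly_Mapping.lookup (hall_prod Q (f # fs)) (iso_class (sq Q X A B)) =
      (\<Sum>W | W \<in> subreps Q X \<and> A \<le> W \<and> W \<le> B. Poly_Mapping.lookup f (iso_class (sq Q X A W)) *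
        Poly_Mapping.lookup (hall_prod Q fs) (iso_class (sq Q X W B)))"
      using lookup_hall_mult_subquo[OF k X subquo_sq[OF X Cons.prems(2-4)]] by (simp add: hall_prod_def)
    also have "\<dots> = flag_sum X (f # fs) A B"
      unfolding flag_sum.simps by (rule sum.cong[OF refl]) (use Cons in auto)
    finally show ?case .
  qed
  have AB: "A \<in> subreps Q X" "B \<in> subreps Q X" "A \<le> B"
    using subquoD(1-3)[OF assms(3)] subreps_le_iff by blast+
  show ?thesis using *[OF AB] iso_class_subquo[OF X assms(3) subquo_sq[OF X AB]] by simp
qed

text \<open>By the correspondence theorem the condition can be tested between \<open>A\<close> and
  \<open>B\<close>. The right-hand side does not mention \<open>Y\<close>, which also gives
  invariance under isomorphism.\<close>

lemma semistable_iff: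
  assumes X: "representation Q (X :: ('k::{field, finite}, 'v, 'a, 'x, 'm) rep_scheme)"
    and p: "subquo Q X A B (Y :: ('k, 'v, 'a, 'y, 'n) rep_scheme) p"
  shows "semistable Q \<theta> Y \<longleftrightarrow> (\<forall>W\<in>subreps Q X. A \<le> W \<longrightarrow> W \<le> B \<longrightarrow> W \<noteq> A \<longrightarrow> W \<noteq> B \<longrightarrow>
    slope Q \<theta> (dimvec Q (sub_rep X W) - dimvec Q (sub_rep X A)) \<le>
    slope Q \<theta> (dimvec Q (sub_rep X B) - dimvec Q (sub_rep X A)))"
proof -
  note Y = subquo_rep[OF X p] and b = bij_betw_preim[OF X p]
  have inj: "preim Q B p V = preim Q B p V' \<longleftrightarrow> V = V'" if "V \<in> subreps Q Y" "V' \<in> subreps Q Y" for V V'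
    using b that by (auto simp: bij_betw_def inj_on_def)
  have dY: "dimvec Q Y = dimvec Q (sub_rep X B) - dimvec Q (sub_rep X A)"
    using dimvec_subquo[OF X p] by simp
  have dV: "dimvec Q (sub_rep Y V) = dimvec Q (sub_rep X (preim Q B p V)) - dimvec Q (sub_rep X A)"
    if "V \<in> subreps Q Y" for V
    using dimvec_subquo[OF X subquo_subrep(1)[OF X p that]] by simp
  have "semistable Q \<theta> Y \<longleftrightarrow> (\<forall>V\<in>subreps Q Y. preim Q B p V \<noteq> A \<longrightarrow> preim Q B p V \<noteq> B \<longrightarrow>
    slope Q \<theta> (dimvec Q (sub_rep X (preim Q B p V)) - dimvec Q (sub_rep X A)) \<le>
    slope Q \<theta> (dimvec Q (sub_rep X B) - dimvec Q (sub_rep X A)))"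
    unfolding semistable_def dY
    using inj[OF _ zero_sub_subrep[OF Y]] inj[OF _ full_sub_subrep[OF Y]] dV
    by (simp add: preim_zero[OF X p] preim_full[OF X p])
  also have "\<dots> \<longleftrightarrow> (\<forall>W\<in>preim Q B p ` subreps Q Y. W \<noteq> A \<longrightarrow> W \<noteq> B \<longrightarrow>
    slope Q \<theta> (dimvec Q (sub_rep X W) - dimvec Q (sub_rep X A)) \<le>
    slope Q \<theta> (dimvec Q (sub_rep X B) - dimvec Q (sub_rep X A)))" by simp
  also have "preim Q B p ` subreps Q Y = {W \<in> subreps Q X. A \<le> W \<and> W \<le> B}"
    using b by (simp add: bij_betw_def)
  finally show ?thesis by auto
qed

lemma lookup_char_all:
  assumes Y: "representation Q (Y :: ('k::{field, finite}, 'v, 'a, 'y, 'n) rep_scheme)"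
  shows "Poly_Mapping.lookup (char_all Q d) (iso_class Y) = of_bool (dimvec Q Y = d)"
proof -
  have "finite {C \<in> iso_classes Q. dimvec Q (class_repr C :: ('k, 'v, 'a, nat) rep) = d}"
    by (rule finite_iso_classes_dimvec)
  then show ?thesis
    using iso_class_in_iso_classes[OF Y] dimvec_class_repr[OF Y]
    by (simp add: char_all_def lookup_sum lookup_single when_def)
qed

lemma lookup_char_ss:
  assumes Y: "representation Q (Y :: ('k::{field, finite}, 'v, 'a, 'y, 'n) rep_scheme)"
  shows "Poly_Mapping.lookup (char_ss Q \<theta> d) (iso_class Y) = of_bool (dimvec Q Y = d \<and> semistable Q \<theta> Y)"
proof -
  obtain r where r: "subquo Q Y (zero_sub Q Y) (full_sub Q Y) (class_repr (iso_class Y)) r"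
    using class_repr_subquo[OF Y subquo_refl[OF Y]] by blast
  have "semistable Q \<theta> (class_repr (iso_class Y)) \<longleftrightarrow> semistable Q \<theta> Y"
    unfolding semistable_iff[OF Y r] semistable_iff[OF Y subquo_refl[OF Y]] ..
  moreover have "finite {A \<in> iso_classes Q. dimvec Q (class_repr A :: ('k, 'v, 'a, nat) rep) = d \<and>
      semistable Q \<theta> (class_repr A)}"
    by (rule finite_subset[OF _ finite_iso_classes_dimvec[of d]]) auto
  ultimately show ?thesis
    using iso_class_in_iso_classes[OF Y] dimvec_class_repr[OF Y]
    by (simp add: char_ss_def lookup_sum lookup_single when_def)
qed

lemma keys_char:
  "Poly_Mapping.keys (char_all Q d :: ('k::{field, finite}, 'v, 'a) hall_algebra) \<subseteq> iso_classes Q"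
  "Poly_Mapping.keys (char_ss Q \<theta> d :: ('k::{field, finite}, 'v, 'a) hall_algebra) \<subseteq> iso_classes Q"
proof -
  note * = keys_sum_single_subset
  show "Poly_Mapping.keys (char_all Q d :: ('k, 'v, 'a) hall_algebra) \<subseteq> iso_classes Q"
    unfolding char_all_def by (rule order_trans[OF *]) blast
  show "Poly_Mapping.keys (char_ss Q \<theta> d :: ('k, 'v, 'a) hall_algebra) \<subseteq> iso_classes Q"
    unfolding char_ss_def by (rule order_trans[OF *]) blast
qed

end

section \<open>Self-dual representations and their reductions\<close>

locale duality_quiver =
  fixes Q :: "('v, 'a) dquiver"
  assumes involution: "quiver_with_involution Q" and duality: "duality_structure Q"

sublocale duality_quiver \<subseteq> finite_quiver
  by (rule finite_quiverI[OF involution])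

text \<open>A presentation \<open>p : U\<^sup>\<bottom> \<rightarrow> R\<close> of \<open>N // U\<close>; isometries \<open>N \<rightarrow> R\<close> are the case \<open>U = 0\<close>.\<close>

definition reduction_map ::
  "('v, 'a) dquiver \<Rightarrow> ('k::field, 'v, 'a, 'x) sd_rep \<Rightarrow> ('v \<Rightarrow> 'x set) \<Rightarrow>
     ('k, 'v, 'a, 'y) sd_rep \<Rightarrow> ('v \<Rightarrow> 'x \<Rightarrow> 'y) \<Rightarrow> bool" where
  "reduction_map Q N U R p \<longleftrightarrow> subquo Q N U (perp Q N U) R p \<and>
     (\<forall>i\<in>verts Q. \<forall>j\<in>verts Q. \<forall>x\<in>perp Q N U i. \<forall>y\<in>perp Q N U j.
        form R i j (p i x) (p j y) = form N i j x y)"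

context duality_quiver
begin

lemma node_inv: "i \<in> verts Q \<Longrightarrow> node_inv Q i \<in> verts Q" "i \<in> verts Q \<Longrightarrow> node_inv Q (node_inv Q i) = i"
  using involution by (auto simp: quiver_with_involution_def)

lemma arrow_inv:
  assumes "a \<in> arcs Q"
  shows "arrow_inv Q a \<in> arcs Q" "tail Q (arrow_inv Q a) = node_inv Q (head Q a)"
    "head Q (arrow_inv Q a) = node_inv Q (tail Q a)"
  using involution assms by (auto simp: quiver_with_involution_def)

lemma node_sgn: "i \<in> verts Q \<Longrightarrow> (of_int (node_sgn Q i) :: 'k::field) \<noteq> 0"
  using duality by (auto simp: duality_structure_def)

lemma bilinear_zero:
  assumes "bilinear_on V W b" "kspace V" "kspace W"
  shows "y \<in> carrier W \<Longrightarrow> b \<zero>\<^bsub>V\<^esub> y = 0" "x \<in> carrier V \<Longrightarrow> b x \<zero>\<^bsub>W\<^esub> = 0"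
proof -
  have *: "b (c \<odot>\<^bsub>V\<^esub> x) y = c * b x y" "b x (c \<odot>\<^bsub>W\<^esub> y) = c * b x y"
    if "x \<in> carrier V" "y \<in> carrier W" for c x y
    using assms(1) that unfolding bilinear_on_def by blast+
  show "b \<zero>\<^bsub>V\<^esub> y = 0" if "y \<in> carrier W"
    using *(1)[OF kspace_closed(1)[OF assms(2)] that, of 0] kspace_closed(6)[OF assms(2)] by simp
  show "b x \<zero>\<^bsub>W\<^esub> = 0" if "x \<in> carrier V"
    using *(2)[OF that kspace_closed(1)[OF assms(3)], of 0] kspace_closed(6)[OF assms(3)] by simp
qed

text \<open>Nondegeneracy is required on the direct sum; by orthogonality it can be tested node by
  node, pairing the space at i with the one at \<open>node_inv Q i\<close> alone.\<close>

lemma self_dualI: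
  assumes rep: "representation Q (M :: ('k::{field, finite}, 'v, 'a, 'x) sd_rep)"
    and bil: "\<And>i j. i \<in> verts Q \<Longrightarrow> j \<in> verts Q \<Longrightarrow> bilinear_on (node_space M i) (node_space M j) (form M i j)"
    and nd: "\<And>i x. i \<in> verts Q \<Longrightarrow> x \<in> carrier (node_space M i) \<Longrightarrow>
      (\<And>y. y \<in> carrier (node_space M (node_inv Q i)) \<Longrightarrow> form M i (node_inv Q i) x y = 0) \<Longrightarrow>
      x = \<zero>\<^bsub>node_space M i\<^esub>"
    and orth: "\<And>i j x y. i \<in> verts Q \<Longrightarrow> j \<in> verts Q \<Longrightarrow> i \<noteq> node_inv Q j \<Longrightarrow>
      x \<in> carrier (node_space M i) \<Longrightarrow> y \<in> carrier (node_space M j) \<Longrightarrow> form M i j x y = 0"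
    and sym: "\<And>i j j' x x'. i \<in> verts Q \<Longrightarrow> j \<in> {i, node_inv Q i} \<Longrightarrow> j' \<in> {i, node_inv Q i} \<Longrightarrow>
      x \<in> carrier (node_space M j) \<Longrightarrow> x' \<in> carrier (node_space M j') \<Longrightarrow>
      form M j j' x x' = of_int (node_sgn Q i) * form M j' j x' x"
    and arrow: "\<And>a x x'. a \<in> arcs Q \<Longrightarrow> x \<in> carrier (node_space M (tail Q a)) \<Longrightarrow>
      x' \<in> carrier (node_space M (node_inv Q (head Q a))) \<Longrightarrow>
      form M (head Q a) (node_inv Q (head Q a)) (arrow_map M a x) x' =
      of_int (arrow_sgn Q a) * form M (tail Q a) (node_inv Q (tail Q a)) x (arrow_map M (arrow_inv Q a) x')"
  shows "self_dual_rep Q M"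
  unfolding self_dual_rep_def
proof (intro conjI ballI impI)
  fix x i
  assume x: "x \<in> (\<Pi>\<^sub>E i\<in>verts Q. carrier (node_space M i))" and i: "i \<in> verts Q"
    and z: "\<forall>y\<in>(\<Pi>\<^sub>E i\<in>verts Q. carrier (node_space M i)). pairing Q M x y = 0"
  show "x i = \<zero>\<^bsub>node_space M i\<^esub>"
  proof (rule nd[OF i])
    show "x i \<in> carrier (node_space M i)" using x i by blast
    fix y assume y: "y \<in> carrier (node_space M (node_inv Q i))"
    \<comment> \<open>A test vector concentrated at the dual node isolates the single component of
      the pairing with x at i.\<close>
    define Y where "Y = (\<lambda>j\<in>verts Q. if j = node_inv Q i then y else \<zero>\<^bsub>node_space M j\<^esub>)"
    have YP: "Y \<in> (\<Pi>\<^sub>E i\<in>verts Q. carrier (node_space M i))"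
      using y kspace_closed(1)[OF rep_spaceD(1)[OF rep]] by (auto simp: Y_def)
    have "form M j l (x j) (Y l) = (if j = i \<and> l = node_inv Q i then form M i (node_inv Q i) (x i) y else 0)"
      if j: "j \<in> verts Q" and l: "l \<in> verts Q" for j l
    proof (cases "l = node_inv Q i")
      case True
      show ?thesis
      proof (cases "j = i")
        case False
        then have "j \<noteq> node_inv Q l" using True node_inv(2)[OF i] by simp
        then show ?thesis using orth[OF j l] x j YP l False by (auto simp: PiE_iff)
      qed (use True l in \<open>simp add: Y_def\<close>)
    next
      case False
      then show ?thesis
        using bilinear_zero(2)[OF bil[OF j l] rep_spaceD(1)[OF rep j] rep_spaceD(1)[OF rep l]] x j l
        by (auto simp: Y_def PiE_iff)
    qed
    then have "pairing Q M x Y = (\<Sum>j\<in>verts Q. \<Sum>l\<in>verts Q.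
        if j = i \<and> l = node_inv Q i then form M i (node_inv Q i) (x i) y else 0)"
      unfolding pairing_def by (intro sum.cong refl) auto
    also have "\<dots> = (\<Sum>j\<in>verts Q. if j = i then (\<Sum>l\<in>verts Q.
        if l = node_inv Q i then form M i (node_inv Q i) (x i) y else 0) else 0)"
      by (intro sum.cong refl) auto
    also have "\<dots> = form M i (node_inv Q i) (x i) y"
      using finite_verts i node_inv(1)[OF i] by simp
    finally show "form M i (node_inv Q i) (x i) y = 0" using z YP by simp
  qed
qed (fact rep bil orth sym arrow)+

context
  fixes N :: "('k::{field, finite}, 'v, 'a, 'x) sd_rep"
  assumes N: "self_dual_rep Q N"
begin

lemma sd_rep: "representation Q N"
  using N by (simp add: self_dual_rep_def)

lemma sd_bilinear:
  "i \<in> verts Q \<Longrightarrow> j \<in> verts Q \<Longrightarrow> bilinear_on (node_space N i) (node_space N j) (form N i j)"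
  using N by (simp add: self_dual_rep_def)

lemma sd_orth:
  "i \<in> verts Q \<Longrightarrow> j \<in> verts Q \<Longrightarrow> i \<noteq> node_inv Q j \<Longrightarrow>
    x \<in> carrier (node_space N i) \<Longrightarrow> y \<in> carrier (node_space N j) \<Longrightarrow> form N i j x y = 0"
  using N unfolding self_dual_rep_def by blast

lemma sd_sym:
  "i \<in> verts Q \<Longrightarrow> j \<in> {i, node_inv Q i} \<Longrightarrow> j' \<in> {i, node_inv Q i} \<Longrightarrow>
    x \<in> carrier (node_space N j) \<Longrightarrow> x' \<in> carrier (node_space N j') \<Longrightarrow>
    form N j j' x x' = of_int (node_sgn Q i) * form N j' j x' x"
  using N unfolding self_dual_rep_def by blast

lemma sd_arrow:
  "a \<in> arcs Q \<Longrightarrow> x \<in> carrier (node_space N (tail Q a)) \<Longrightarrow>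
    x' \<in> carrier (node_space N (node_inv Q (head Q a))) \<Longrightarrow>
    form N (head Q a) (node_inv Q (head Q a)) (arrow_map N a x) x' =
    of_int (arrow_sgn Q a) * form N (tail Q a) (node_inv Q (tail Q a)) x (arrow_map N (arrow_inv Q a) x')"
  using N unfolding self_dual_rep_def by blast

text \<open>Between dual nodes the form is symmetric up to a sign, which is invertible in the field;
  between all other nodes both values vanish.\<close>

lemma sd_sym_zero:
  assumes "i \<in> verts Q" "j \<in> verts Q" "x \<in> carrier (node_space N i)" "y \<in> carrier (node_space N j)"
  shows "form N i j x y = 0 \<longleftrightarrow> form N j i y x = 0"
proof (cases "i = node_inv Q j")
  case True
  then show ?thesis
    using sd_sym[OF assms(2), of i j x y] assms node_sgn[OF assms(2), where 'k = 'k] by simp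
next
  case False
  then have "j \<noteq> node_inv Q i" using node_inv(2)[OF assms(1)] assms node_inv by metis
  then show ?thesis using False sd_orth assms by simp
qed

text \<open>The converse of the reduction made in \<open>self_dualI\<close>, by a vector
  concentrated at the node i.\<close>

lemma sd_nondegenerate:
  assumes i: "i \<in> verts Q" and x: "x \<in> carrier (node_space N i)"
    and z: "\<And>y. y \<in> carrier (node_space N (node_inv Q i)) \<Longrightarrow> form N i (node_inv Q i) x y = 0"
  shows "x = \<zero>\<^bsub>node_space N i\<^esub>"
proof -
  define X where "X = (\<lambda>j\<in>verts Q. if j = i then x else \<zero>\<^bsub>node_space N j\<^esub>)"
  have XP: "X \<in> (\<Pi>\<^sub>E i\<in>verts Q. carrier (node_space N i))"
    using x kspace_closed(1)[OF rep_spaceD(1)[OF sd_rep]] by (auto simp: X_def)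
  have "pairing Q N X y = 0" if y: "y \<in> (\<Pi>\<^sub>E i\<in>verts Q. carrier (node_space N i))" for y
    unfolding pairing_def
  proof (intro sum.neutral ballI)
    fix j l assume j: "j \<in> verts Q" and l: "l \<in> verts Q"
    have yl: "y l \<in> carrier (node_space N l)" using y l by blast
    show "form N j l (X j) (y l) = 0"
    proof (cases "j = i")
      case True
      show ?thesis
      proof (cases "l = node_inv Q i")
        case False
        then have "i \<noteq> node_inv Q l" using node_inv(2)[OF l] by metis
        then show ?thesis using sd_orth[OF i l _ x yl] True i by (simp add: X_def)
      qed (use True z yl i in \<open>simp add: X_def\<close>)
    next
      case False
      then show ?thesis
        using bilinear_zero(1)[OF sd_bilinear[OF j l] rep_spaceD(1)[OF sd_rep j] rep_spaceD(1)[OF sd_rep l] yl] j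
        by (simp add: X_def)
    qed
  qed
  then have "X i = \<zero>\<^bsub>node_space N i\<^esub>" using N XP i unfolding self_dual_rep_def by blast
  then show ?thesis using i by (simp add: X_def)
qed

section \<open>Orthogonal complements\<close>

lemma subrep_carrier: "U \<in> subreps Q N \<Longrightarrow> i \<in> verts Q \<Longrightarrow> x \<in> U i \<Longrightarrow> x \<in> carrier (node_space N i)"
  by (rule subsetD[OF ksubspaceD(1)[OF subrepsD(1)]])

lemma perp_iff:
  assumes U: "U \<in> subreps Q N" and i: "i \<in> verts Q"
  shows "x \<in> perp Q N U i \<longleftrightarrow>
    x \<in> carrier (node_space N i) \<and> (\<forall>y\<in>U (node_inv Q i). form N i (node_inv Q i) x y = 0)"
proof -
  have "form N i j x y = 0"
    if x: "x \<in> carrier (node_space N i)" and z: "\<forall>y\<in>U (node_inv Q i). form N i (node_inv Q i) x y = 0"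
      and j: "j \<in> verts Q" and y: "y \<in> U j" for j y
  proof (cases "j = node_inv Q i")
    case False
    then have "i \<noteq> node_inv Q j" using node_inv(2)[OF j] by metis
    then show ?thesis using sd_orth[OF i j _ x subrep_carrier[OF U j y]] by blast
  qed (use z y in blast)
  then show ?thesis using i node_inv(1)[OF i] unfolding perp_def by auto
qed

lemma perpD:
  assumes "i \<in> verts Q" "x \<in> perp Q N U i"
  shows "x \<in> carrier (node_space N i)" "\<And>j y. j \<in> verts Q \<Longrightarrow> y \<in> U j \<Longrightarrow> form N i j x y = 0"
  using assms by (auto simp: perp_def)

text \<open>Up to sign the adjoint of the arrow a is the arrow \<open>arrow_inv Q a\<close>, which
  preserves \<open>U\<close>; hence a preserves the complement.\<close>

lemma perp_subrep:
  assumes U: "U \<in> subreps Q N"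
  shows "perp Q N U \<in> subreps Q N"
proof (rule subrepsI)
  fix i assume i: "i \<in> verts Q"
  let ?j = "node_inv Q i"
  note j = node_inv(1)[OF i]
  note V = rep_spaceD(1)[OF sd_rep i] and W = rep_spaceD(1)[OF sd_rep j]
  note b = sd_bilinear[OF i j]
  have b': "form N i ?j (x \<oplus>\<^bsub>node_space N i\<^esub> x') y = form N i ?j x y + form N i ?j x' y"
    "form N i ?j (c \<odot>\<^bsub>node_space N i\<^esub> x) y = c * form N i ?j x y"
    if "x \<in> carrier (node_space N i)" "x' \<in> carrier (node_space N i)" "y \<in> carrier (node_space N ?j)" for x x' y c
    using b that unfolding bilinear_on_def by blast+
  note b'2 = b'(2)[OF _ kspace_closed(1)[OF V]]
  note c = subrep_carrier[OF U j]
  show "ksubspace (perp Q N U i) (node_space N i)"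
    unfolding ksubspace_iff[OF V]
  proof (intro conjI ballI allI)
    show "perp Q N U i \<subseteq> carrier (node_space N i)" using perpD(1)[OF i] by blast
    show "\<zero>\<^bsub>node_space N i\<^esub> \<in> perp Q N U i"
      unfolding perp_iff[OF U i] using bilinear_zero(1)[OF b V W] kspace_closed(1)[OF V] c by simp
    fix x assume x: "x \<in> perp Q N U i"
    show "k \<odot>\<^bsub>node_space N i\<^esub> x \<in> perp Q N U i" for k
      using x kspace_closed(4)[OF V] b'2 c unfolding perp_iff[OF U i] by simp
    show "x \<oplus>\<^bsub>node_space N i\<^esub> y \<in> perp Q N U i" if "y \<in> perp Q N U i" for y
      using x that kspace_closed(2)[OF V] b'(1) c unfolding perp_iff[OF U i] by simp
  qed
next
  fix a x assume a: "a \<in> arcs Q" and x: "x \<in> perp Q N U (tail Q a)"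
  note t = arc_verts(1)[OF a] and h = arc_verts(2)[OF a]
  have xc: "x \<in> carrier (node_space N (tail Q a))" by (rule perpD(1)[OF t x])
  have "form N (head Q a) (node_inv Q (head Q a)) (arrow_map N a x) y = 0" if y: "y \<in> U (node_inv Q (head Q a))" for y
  proof -
    have "arrow_map N (arrow_inv Q a) y \<in> U (node_inv Q (tail Q a))"
      using subrepsD(3)[OF U arrow_inv(1)[OF a]] y arrow_inv[OF a] by simp
    then show ?thesis
      using sd_arrow[OF a xc subrep_carrier[OF U node_inv(1)[OF h] y]] x unfolding perp_iff[OF U t] by simp
  qed
  then show "arrow_map N a x \<in> perp Q N U (head Q a)"
    unfolding perp_iff[OF U h] using rep_arrowD(1)[OF sd_rep a xc] by blast
qed (simp add: perp_def)

lemma perp_antimono: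
  assumes "U \<in> subreps Q N" "W \<in> subreps Q N" "U \<le> W"
  shows "perp Q N W \<le> perp Q N U"
  using assms by (auto simp: le_fun_def perp_def)

text \<open>Only the component of \<open>U\<close> at the dual node constrains an element at i, so
  \<open>card_annihilator\<close> applies to that one pairing.\<close>

lemma card_perp:
  assumes U: "U \<in> subreps Q N" and i: "i \<in> verts Q"
  shows "card (perp Q N U i) * card (U (node_inv Q i)) = card (carrier (node_space N i))"
proof -
  let ?j = "node_inv Q i"
  note j = node_inv(1)[OF i]
  have "y = \<zero>\<^bsub>node_space N ?j\<^esub>"
    if y: "y \<in> U ?j" and z: "\<And>x. x \<in> carrier (node_space N i) \<Longrightarrow> form N i ?j x y = 0" for y
  proof (rule sd_nondegenerate[OF j])
    show yc: "y \<in> carrier (node_space N ?j)" by (rule subrep_carrier[OF U j y])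
    show "form N ?j (node_inv Q ?j) y x = 0" if "x \<in> carrier (node_space N (node_inv Q ?j))" for x
      using sd_sym_zero[OF j i yc, of x] z that node_inv(2)[OF i] by simp
  qed
  moreover have "perp Q N U i = {x \<in> carrier (node_space N i). \<forall>u\<in>U ?j. form N i ?j x u = 0}"
    using perp_iff[OF U i] by blast
  ultimately show ?thesis
    using card_annihilator[OF rep_spaceD(1,2)[OF sd_rep i] rep_spaceD(1,2)[OF sd_rep j]
        subrepsD(1)[OF U j] sd_bilinear[OF i j]] by simp
qed

lemma perp_full: "perp Q N (full_sub Q N) = zero_sub Q N"
proof (rule subreps_eqI[OF perp_subrep[OF full_sub_subrep[OF sd_rep]] zero_sub_subrep[OF sd_rep]])
  fix i assume i: "i \<in> verts Q"
  note j = node_inv(1)[OF i]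
  have "x = \<zero>\<^bsub>node_space N i\<^esub>" if "x \<in> perp Q N (full_sub Q N) i" for x
    using that sd_nondegenerate[OF i] j unfolding perp_iff[OF full_sub_subrep[OF sd_rep] i]
    by (simp add: full_sub_def)
  moreover have "\<zero>\<^bsub>node_space N i\<^esub> \<in> perp Q N (full_sub Q N) i"
    by (rule ksubspaceD(2)[OF subrepsD(1)[OF perp_subrep[OF full_sub_subrep[OF sd_rep]] i]])
  ultimately have "perp Q N (full_sub Q N) i = {\<zero>\<^bsub>node_space N i\<^esub>}" by blast
  then show "perp Q N (full_sub Q N) i = zero_sub Q N i" using i by (simp add: zero_sub_def)
qed

text \<open>The case of \<open>card_perp\<close> where the subrepresentation is everything and its
  complement is 0.\<close>

lemma card_node_inv:
  assumes i: "i \<in> verts Q"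
  shows "card (carrier (node_space N (node_inv Q i))) = card (carrier (node_space N i))"
  using card_perp[OF full_sub_subrep[OF sd_rep] i, unfolded perp_full] node_inv(1)[OF i] i
  by (simp add: zero_sub_def full_sub_def)

lemma finite_subrep: "U \<in> subreps Q N \<Longrightarrow> i \<in> verts Q \<Longrightarrow> finite (U i)"
  by (rule finite_subset[OF ksubspaceD(1)[OF subrepsD(1)] rep_spaceD(2)[OF sd_rep]])

lemma card_subrep_pos: "U \<in> subreps Q N \<Longrightarrow> i \<in> verts Q \<Longrightarrow> 0 < card (U i)"
  using finite_subrep[of U i] ksubspaceD(2)[OF subrepsD(1)[of U Q N i]] by (auto simp: card_gt_0_iff)

text \<open>One inclusion is the symmetry of orthogonality, the other a count:
  \<open>card_perp\<close> at i and at the dual node gives both sides the same size.\<close>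

lemma perp_perp:
  assumes U: "U \<in> subreps Q N"
  shows "perp Q N (perp Q N U) = U"
proof (rule subreps_eqI[OF perp_subrep[OF perp_subrep[OF U]] U])
  fix i assume i: "i \<in> verts Q"
  let ?j = "node_inv Q i"
  note j = node_inv(1)[OF i] and ji = node_inv(2)[OF i] and P = perp_subrep[OF U]
  have "U i \<subseteq> perp Q N (perp Q N U) i"
  proof
    fix x assume x: "x \<in> U i"
    have xc: "x \<in> carrier (node_space N i)" by (rule subrep_carrier[OF U i x])
    have "form N i ?j x y = 0" if y: "y \<in> perp Q N U ?j" for y
      using perpD(2)[OF j y i x] sd_sym_zero[OF i j xc perpD(1)[OF j y]] by simp
    then show "x \<in> perp Q N (perp Q N U) i" unfolding perp_iff[OF P i] using xc by blast
  qed
  moreover have "card (perp Q N (perp Q N U) i) * card (perp Q N U ?j) = card (U i) * card (perp Q N U ?j)"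
    using card_perp[OF P i] card_perp[OF U j] card_node_inv[OF i] ji by (simp add: mult.commute)
  then have "card (perp Q N (perp Q N U) i) = card (U i)" using card_subrep_pos[OF P j] by simp
  ultimately show "perp Q N (perp Q N U) i = U i"
    using card_subset_eq[OF finite_subrep[OF perp_subrep[OF P] i]] by metis
qed

lemma perp_zero: "perp Q N (zero_sub Q N) = full_sub Q N"
  using perp_perp[OF full_sub_subrep[OF sd_rep]] by (simp add: perp_full)

lemma isotropic_subrepsD:
  assumes "U \<in> isotropic_subreps Q N"
  shows "U \<in> subreps Q N" "U \<le> perp Q N U"
proof -
  show U: "U \<in> subreps Q N" using assms by (simp add: isotropic_subreps_def)
  show "U \<le> perp Q N U"
    using assms unfolding subreps_le_iff[OF U perp_subrep[OF U]] by (simp add: isotropic_subreps_def)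
qed

lemma isotropic_subreps_eq: "isotropic_subreps Q N = {U \<in> subreps Q N. U \<le> perp Q N U}"
  using isotropic_subrepsD by (auto simp: isotropic_subreps_def le_fun_def)

lemma isotropic_iff:
  assumes U: "U \<in> subreps Q N"
  shows "U \<in> isotropic_subreps Q N \<longleftrightarrow>
    (\<forall>i\<in>verts Q. \<forall>j\<in>verts Q. \<forall>x\<in>U i. \<forall>y\<in>U j. form N i j x y = 0)"
  using U subrep_carrier[OF U] by (auto simp: isotropic_subreps_def perp_def subset_eq)

lemma zero_isotropic: "zero_sub Q N \<in> isotropic_subreps Q N"
  unfolding isotropic_subreps_eq
  using zero_sub_subrep[OF sd_rep] subrep_bounds(1)[OF sd_rep perp_subrep[OF zero_sub_subrep[OF sd_rep]]] by blast

text \<open>The \<open>THE\<close> in \<open>reduction\<close> is meaningful because changing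
  representatives in the complement by elements of \<open>U\<close> does not alter the form:
  \<open>U\<close> is isotropic and orthogonal to the complement.\<close>

lemma reduction_map_reduction:
  assumes "U \<in> isotropic_subreps Q N"
  shows "reduction_map Q N U (reduction Q N U) (\<lambda>i x. U i +>\<^bsub>node_space (sub_rep N (perp Q N U)) i\<^esub> x)"
proof -
  note U = isotropic_subrepsD[OF assms] and P = perp_subrep[OF isotropic_subrepsD(1)[OF assms]]
  let ?p = "\<lambda>i x. U i +>\<^bsub>node_space (sub_rep N (perp Q N U)) i\<^esub> x"
  have s: "subquo Q N U (perp Q N U) (reduction Q N U) ?p"
    using subquo_sq[OF sd_rep U(1) P U(2)] unfolding subquo_def by (simp add: reduction_def)
  have "form (reduction Q N U) i j (?p i x) (?p j y) = form N i j x y"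
    if i: "i \<in> verts Q" and j: "j \<in> verts Q" and x: "x \<in> perp Q N U i" and y: "y \<in> perp Q N U j" for i j x y
  proof -
    note b = sd_bilinear[OF i j]
    have e: "form N i j (u \<oplus>\<^bsub>node_space N i\<^esub> x) (v \<oplus>\<^bsub>node_space N j\<^esub> y) = form N i j x y"
      if u: "u \<in> U i" and v: "v \<in> U j" for u v
    proof -
      note uc = subrep_carrier[OF U(1) i u] and vc = subrep_carrier[OF U(1) j v]
        and xc = perpD(1)[OF i x] and yc = perpD(1)[OF j y]
      have "form N i j (u \<oplus>\<^bsub>node_space N i\<^esub> x) (v \<oplus>\<^bsub>node_space N j\<^esub> y) =
          form N i j u (v \<oplus>\<^bsub>node_space N j\<^esub> y) + form N i j x (v \<oplus>\<^bsub>node_space N j\<^esub> y)"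
        using b uc xc kspace_closed(2)[OF rep_spaceD(1)[OF sd_rep j] vc yc] unfolding bilinear_on_def by blast
      moreover have "form N i j u (v \<oplus>\<^bsub>node_space N j\<^esub> y) = form N i j u v + form N i j u y"
        "form N i j x (v \<oplus>\<^bsub>node_space N j\<^esub> y) = form N i j x v + form N i j x y"
        using b uc xc vc yc unfolding bilinear_on_def by blast+
      moreover have "form N i j u v = 0" using isotropic_iff[OF U(1)] assms u v i j by blast
      moreover have "form N i j x v = 0" by (rule perpD(2)[OF i x j v])
      moreover have "form N i j u y = 0"
        using perpD(2)[OF j y i u] sd_sym_zero[OF i j uc yc] by simp
      ultimately show ?thesis by simp
    qed
    have pi: "?p i x = {u \<oplus>\<^bsub>node_space N i\<^esub> x |u. u \<in> U i}"
      and pj: "?p j y = {v \<oplus>\<^bsub>node_space N j\<^esub> y |v. v \<in> U j}"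
      by (auto simp: a_r_coset_def' sub_rep_def)
    have z: "\<zero>\<^bsub>node_space N i\<^esub> \<in> U i" "\<zero>\<^bsub>node_space N j\<^esub> \<in> U j"
      using ksubspaceD(2)[OF subrepsD(1)[OF U(1)]] i j by auto
    have "(THE c. \<exists>x'\<in>?p i x. \<exists>y'\<in>?p j y. c = form N i j x' y') = form N i j x y"
    proof (rule the_equality)
      show "\<exists>x'\<in>?p i x. \<exists>y'\<in>?p j y. form N i j x y = form N i j x' y'"
        unfolding pi pj using e[OF z] z by (metis (mono_tags, lifting) mem_Collect_eq)
      show "c = form N i j x y" if "\<exists>x'\<in>?p i x. \<exists>y'\<in>?p j y. c = form N i j x' y'" for c
        using that e unfolding pi pj by auto
    qed
    then show ?thesis by (simp add: reduction_def)
  qed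
  then show ?thesis unfolding reduction_map_def using s by blast
qed

lemma reduction_map_refl: "reduction_map Q N (zero_sub Q N) N (\<lambda>i x. x)"
  unfolding reduction_map_def perp_zero using subquo_refl[OF sd_rep] by simp

text \<open>All axioms are checked on lifts to the complement of \<open>U\<close>. Nondegeneracy is
  where \<open>perp_perp\<close> enters: a lift orthogonal to the whole complement lies in
  \<open>U\<close> and so maps to 0.\<close>

lemma reduction_map_self_dual:
  assumes "U \<in> isotropic_subreps Q N"
    and p: "reduction_map Q N U (R :: ('k, 'v, 'a, 'y) sd_rep) p"
  shows "self_dual_rep Q R"
proof -
  note U = isotropic_subrepsD[OF assms(1)] and P = perp_subrep[OF isotropic_subrepsD(1)[OF assms(1)]]
  have f: "form R i j (p i x) (p j y) = form N i j x y"
    if "i \<in> verts Q" "j \<in> verts Q" "x \<in> perp Q N U i" "y \<in> perp Q N U j" for i j x y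
    using p that unfolding reduction_map_def by auto
  have s: "subquo Q N U (perp Q N U) R p" using p unfolding reduction_map_def by blast
  note sD = subquoD[OF s] and lift = subquo_lift[OF s] and pc = perpD(1)
  note cl = ksubspaceD[OF subrepsD(1)[OF P]]
  show ?thesis
  proof (rule self_dualI)
    show rR: "representation Q R" by (rule subquo_rep[OF sd_rep s])
    show "bilinear_on (node_space R i) (node_space R j) (form R i j)"
      if i: "i \<in> verts Q" and j: "j \<in> verts Q" for i j
      unfolding bilinear_on_def
    proof (intro conjI ballI allI)
      note b = sd_bilinear[OF i j, unfolded bilinear_on_def]
      fix x y assume "x \<in> carrier (node_space R i)" "y \<in> carrier (node_space R j)"
      then obtain x' y' where x: "x' \<in> perp Q N U i" "p i x' = x" and y: "y' \<in> perp Q N U j" "p j y' = y"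
        using lift[OF i] lift[OF j] by metis
      note c = pc[OF i x(1)] pc[OF j y(1)]
      show "form R i j (k \<odot>\<^bsub>node_space R i\<^esub> x) y = k * form R i j x y" for k
        using f[OF i j cl(4)[OF i x(1)] y(1), of k] f[OF i j x(1) y(1)] sD(6)[OF i x(1), of k] x(2) y(2) b c
        by simp
      show "form R i j x (k \<odot>\<^bsub>node_space R j\<^esub> y) = k * form R i j x y" for k
        using f[OF i j x(1) cl(4)[OF j y(1)], of k] f[OF i j x(1) y(1)] sD(6)[OF j y(1), of k] x(2) y(2) b c
        by simp
      show "form R i j (x \<oplus>\<^bsub>node_space R i\<^esub> w) y = form R i j x y + form R i j w y"
        if w: "w \<in> carrier (node_space R i)" for w
      proof -
        obtain w' where w': "w' \<in> perp Q N U i" "p i w' = w" by (rule lift[OF i w])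
        show ?thesis
          using f[OF i j cl(3)[OF i x(1) w'(1)] y(1)] f[OF i j x(1) y(1)] f[OF i j w'(1) y(1)]
            sD(5)[OF i x(1) w'(1)] x(2) y(2) w'(2) b c pc[OF i w'(1)] by simp
      qed
      show "form R i j x (y \<oplus>\<^bsub>node_space R j\<^esub> w) = form R i j x y + form R i j x w"
        if w: "w \<in> carrier (node_space R j)" for w
      proof -
        obtain w' where w': "w' \<in> perp Q N U j" "p j w' = w" by (rule lift[OF j w])
        show ?thesis
          using f[OF i j x(1) cl(3)[OF j y(1) w'(1)]] f[OF i j x(1) y(1)] f[OF i j x(1) w'(1)]
            sD(5)[OF j y(1) w'(1)] x(2) y(2) w'(2) b c pc[OF j w'(1)] by simp
      qed
    qed
    show "x = \<zero>\<^bsub>node_space R i\<^esub>"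
      if i: "i \<in> verts Q" and x: "x \<in> carrier (node_space R i)"
        and z: "\<And>y. y \<in> carrier (node_space R (node_inv Q i)) \<Longrightarrow> form R i (node_inv Q i) x y = 0" for i x
    proof -
      obtain x' where x': "x' \<in> perp Q N U i" "p i x' = x" by (rule lift[OF i x])
      note j = node_inv(1)[OF i]
      have "form N i (node_inv Q i) x' y = 0" if y: "y \<in> perp Q N U (node_inv Q i)" for y
        using f[OF i j x'(1) y] z[of "p (node_inv Q i) y"] sD(4)[OF j] y x'(2) by auto
      then have "x' \<in> perp Q N (perp Q N U) i" unfolding perp_iff[OF P i] using pc[OF i x'(1)] by blast
      then have "x' \<in> U i" by (simp add: perp_perp[OF U(1)])
      then show ?thesis using sD(7)[OF i x'(1)] x'(2) by simp
    qed
    show "form R i j x y = 0"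
      if i: "i \<in> verts Q" and j: "j \<in> verts Q" and n: "i \<noteq> node_inv Q j"
        and x: "x \<in> carrier (node_space R i)" and y: "y \<in> carrier (node_space R j)" for i j x y
    proof -
      obtain x' where x': "x' \<in> perp Q N U i" "p i x' = x" by (rule lift[OF i x])
      obtain y' where y': "y' \<in> perp Q N U j" "p j y' = y" by (rule lift[OF j y])
      show ?thesis
        using f[OF i j x'(1) y'(1)] sd_orth[OF i j n pc[OF i x'(1)] pc[OF j y'(1)]] x'(2) y'(2) by simp
    qed
    show "form R j j' x y = of_int (node_sgn Q i) * form R j' j y x"
      if i: "i \<in> verts Q" and j: "j \<in> {i, node_inv Q i}" and j': "j' \<in> {i, node_inv Q i}"
        and x: "x \<in> carrier (node_space R j)" and y: "y \<in> carrier (node_space R j')" for i j j' x y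
    proof -
      have v: "j \<in> verts Q" "j' \<in> verts Q" using j j' i node_inv(1)[OF i] by auto
      obtain x' where x': "x' \<in> perp Q N U j" "p j x' = x" by (rule lift[OF v(1) x])
      obtain y' where y': "y' \<in> perp Q N U j'" "p j' y' = y" by (rule lift[OF v(2) y])
      show ?thesis
        using f[OF v x'(1) y'(1)] f[OF v(2,1) y'(1) x'(1)]
          sd_sym[OF i j j' pc[OF v(1) x'(1)] pc[OF v(2) y'(1)]] x'(2) y'(2) by simp
    qed
    show "form R (head Q a) (node_inv Q (head Q a)) (arrow_map R a x) y =
      of_int (arrow_sgn Q a) * form R (tail Q a) (node_inv Q (tail Q a)) x (arrow_map R (arrow_inv Q a) y)"
      if a: "a \<in> arcs Q" and x: "x \<in> carrier (node_space R (tail Q a))"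
        and y: "y \<in> carrier (node_space R (node_inv Q (head Q a)))" for a x y
    proof -
      note t = arc_verts(1)[OF a] and h = arc_verts(2)[OF a]
      note t' = node_inv(1)[OF t] and h' = node_inv(1)[OF h] and a' = arrow_inv[OF a]
      obtain x' where x': "x' \<in> perp Q N U (tail Q a)" "p (tail Q a) x' = x" by (rule lift[OF t x])
      obtain y' where y': "y' \<in> perp Q N U (node_inv Q (head Q a))" "p (node_inv Q (head Q a)) y' = y"
        by (rule lift[OF h' y])
      have m: "arrow_map N a x' \<in> perp Q N U (head Q a)"
        "arrow_map N (arrow_inv Q a) y' \<in> perp Q N U (node_inv Q (tail Q a))"
        using subrepsD(3)[OF P a x'(1)] subrepsD(3)[OF P a'(1), of y'] y'(1) a'(2,3) by auto
      have "p (node_inv Q (tail Q a)) (arrow_map N (arrow_inv Q a) y') = arrow_map R (arrow_inv Q a) y"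
        using sD(8)[OF a'(1), of y'] y' a'(2,3) by simp
      moreover have "p (head Q a) (arrow_map N a x') = arrow_map R a x"
        using sD(8)[OF a x'(1)] x'(2) by simp
      ultimately show ?thesis
        using f[OF h h' m(1) y'(1)] f[OF t t' x'(1) m(2)] x'(2) y'(2)
          sd_arrow[OF a pc[OF t x'(1)] pc[OF h' y'(1)]] by simp
    qed
  qed
qed

text \<open>Both forms pull back to the form of \<open>N\<close>, so the isomorphism of
  \<open>subquo_unique\<close>, which commutes with the presentations, preserves them.\<close>

lemma reduction_map_isometric:
  assumes p: "reduction_map Q N U (R :: ('k, 'v, 'a, 'y) sd_rep) p"
    and r: "reduction_map Q N U (R' :: ('k, 'v, 'a, 'w) sd_rep) r"
  shows "isometric Q R R'"
proof -
  have s: "subquo Q N U (perp Q N U) R p" and t: "subquo Q N U (perp Q N U) R' r"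
    using p r by (auto simp: reduction_map_def)
  obtain f where f: "rep_isomorphism Q R R' f"
    and fp: "\<And>i x. i \<in> verts Q \<Longrightarrow> x \<in> perp Q N U i \<Longrightarrow> f i (p i x) = r i x"
    using subquo_unique[OF sd_rep s t] by blast
  have "form R' i j (f i x) (f j y) = form R i j x y"
    if i: "i \<in> verts Q" and j: "j \<in> verts Q" and x: "x \<in> carrier (node_space R i)"
      and y: "y \<in> carrier (node_space R j)" for i j x y
  proof -
    obtain x' where x': "x' \<in> perp Q N U i" "p i x' = x" by (rule subquo_lift[OF s i x])
    obtain y' where y': "y' \<in> perp Q N U j" "p j y' = y" by (rule subquo_lift[OF s j y])
    show ?thesis
      using p r i j x' y' fp[OF i x'(1)] fp[OF j y'(1)] by (auto simp: reduction_map_def)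
  qed
  then show ?thesis using f unfolding isometric_def by blast
qed

lemma isometric_iff_reduction_map:
  assumes R: "self_dual_rep Q (R :: ('k, 'v, 'a, 'y) sd_rep)"
  shows "isometric Q N R \<longleftrightarrow> (\<exists>f. reduction_map Q N (zero_sub Q N) R f)"
proof -
  have R': "representation Q R" using R by (simp add: self_dual_rep_def)
  show ?thesis
    unfolding isometric_def reduction_map_def perp_zero rep_isomorphism_iff_subquo[OF sd_rep R']
    by (simp add: full_sub_def)
qed

end

lemma isotropic_preim:
  assumes N: "self_dual_rep Q (N :: ('k::{field, finite}, 'v, 'a, 'x) sd_rep)"
    and p: "reduction_map Q N U (R :: ('k, 'v, 'a, 'y) sd_rep) p" and R: "self_dual_rep Q R"
    and V: "V \<in> subreps Q R"
  shows "V \<in> isotropic_subreps Q R \<longleftrightarrow> preim Q (perp Q N U) p V \<in> isotropic_subreps Q N"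
proof -
  have s: "subquo Q N U (perp Q N U) R p" using p by (simp add: reduction_map_def)
  have f: "form R i j (p i x) (p j y) = form N i j x y"
    if "i \<in> verts Q" "j \<in> verts Q" "x \<in> perp Q N U i" "y \<in> perp Q N U j" for i j x y
    using p that unfolding reduction_map_def by auto
  show ?thesis
    unfolding isotropic_iff[OF R V] isotropic_iff[OF N preim_subrep(1)[OF sd_rep[OF N] s V]]
  proof (intro iffI ballI)
    fix i j x y assume z: "\<forall>i\<in>verts Q. \<forall>j\<in>verts Q. \<forall>x\<in>V i. \<forall>y\<in>V j. form R i j x y = 0"
      and i: "i \<in> verts Q" and j: "j \<in> verts Q" and "x \<in> preim Q (perp Q N U) p V i" "y \<in> preim Q (perp Q N U) p V j"
    then have x: "x \<in> perp Q N U i" "p i x \<in> V i" and y: "y \<in> perp Q N U j" "p j y \<in> V j"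
      by (auto simp: preim_def)
    show "form N i j x y = 0" using f[OF i j x(1) y(1)] z i j x(2) y(2) by simp
  next
    fix i j x y assume z: "\<forall>i\<in>verts Q. \<forall>j\<in>verts Q. \<forall>x\<in>preim Q (perp Q N U) p V i.
        \<forall>y\<in>preim Q (perp Q N U) p V j. form N i j x y = 0"
      and i: "i \<in> verts Q" and j: "j \<in> verts Q" and x: "x \<in> V i" and y: "y \<in> V j"
    obtain x' where x': "x' \<in> perp Q N U i" "p i x' = x"
      by (rule subquo_lift[OF s i subrep_carrier[OF R V i x]])
    obtain y' where y': "y' \<in> perp Q N U j" "p j y' = y"
      by (rule subquo_lift[OF s j subrep_carrier[OF R V j y]])
    have "x' \<in> preim Q (perp Q N U) p V i" "y' \<in> preim Q (perp Q N U) p V j"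
      using x' y' x y i j by (auto simp: preim_def)
    then show "form R i j x y = 0" using f[OF i j x'(1) y'(1)] z i j x'(2) y'(2) by fastforce
  qed
qed

text \<open>Isotropic subrepresentations of the reduction correspond to the isotropic W above
  \<open>U\<close>. No upper bound appears, since such a W lies below its own complement and hence
  below that of \<open>U\<close>.\<close>

lemma sd_semistable_iff:
  assumes N: "self_dual_rep Q (N :: ('k::{field, finite}, 'v, 'a, 'x) sd_rep)"
    and U: "U \<in> isotropic_subreps Q N"
    and p: "reduction_map Q N U (R :: ('k, 'v, 'a, 'y) sd_rep) p"
  shows "sd_semistable Q \<theta> R \<longleftrightarrow> (\<forall>W\<in>isotropic_subreps Q N. U \<le> W \<longrightarrow> W \<noteq> U \<longrightarrow>
    slope Q \<theta> (dimvec Q (sub_rep N W) - dimvec Q (sub_rep N U)) \<le> 0)"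
proof -
  note X = sd_rep[OF N] and R = reduction_map_self_dual[OF N U p]
  note rR = sd_rep[OF R] and UD = isotropic_subrepsD[OF N U]
  let ?P = "perp Q N U"
  have s: "subquo Q N U ?P R p" using p by (simp add: reduction_map_def)
  note b = bij_betw_preim[OF X s]
  have im: "preim Q ?P p ` isotropic_subreps Q R = {W \<in> isotropic_subreps Q N. U \<le> W}"
  proof (intro equalityI subsetI)
    fix W assume "W \<in> preim Q ?P p ` isotropic_subreps Q R"
    then show "W \<in> {W \<in> isotropic_subreps Q N. U \<le> W}"
      using isotropic_preim[OF N p R] isotropic_subrepsD(1)[OF R] preim_subrep(2)[OF X s] by blast
  next
    fix W assume "W \<in> {W \<in> isotropic_subreps Q N. U \<le> W}"
    then have W: "W \<in> isotropic_subreps Q N" "U \<le> W" by auto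
    note WD = isotropic_subrepsD[OF N W(1)]
    have "W \<le> ?P" using WD(2) perp_antimono[OF N UD(1) WD(1) W(2)] by (rule order_trans)
    then have "W \<in> preim Q ?P p ` subreps Q R" using b WD(1) W(2) by (simp add: bij_betw_def)
    then show "W \<in> preim Q ?P p ` isotropic_subreps Q R"
      using W(1) isotropic_preim[OF N p R] by blast
  qed
  have inj: "preim Q ?P p V = U \<longleftrightarrow> V = zero_sub Q R" if "V \<in> subreps Q R" for V
    using b that zero_sub_subrep[OF rR] preim_zero[OF X s] unfolding bij_betw_def inj_on_def by metis
  have dV: "dimvec Q (sub_rep R V) = dimvec Q (sub_rep N (preim Q ?P p V)) - dimvec Q (sub_rep N U)"
    if "V \<in> subreps Q R" for V
    using dimvec_subquo[OF X subquo_subrep(1)[OF X s that]] by simp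
  have "sd_semistable Q \<theta> R \<longleftrightarrow> (\<forall>V\<in>isotropic_subreps Q R. preim Q ?P p V \<noteq> U \<longrightarrow>
    slope Q \<theta> (dimvec Q (sub_rep N (preim Q ?P p V)) - dimvec Q (sub_rep N U)) \<le> 0)"
    unfolding sd_semistable_def using inj dV isotropic_subrepsD(1)[OF R] by simp
  also have "\<dots> \<longleftrightarrow> (\<forall>W\<in>preim Q ?P p ` isotropic_subreps Q R. W \<noteq> U \<longrightarrow>
    slope Q \<theta> (dimvec Q (sub_rep N W) - dimvec Q (sub_rep N U)) \<le> 0)" by simp
  finally show ?thesis unfolding im by auto
qed

lemma reduction_map_compose:
  assumes N: "self_dual_rep Q (N :: ('k::{field, finite}, 'v, 'a, 'x) sd_rep)"
    and U: "U \<in> isotropic_subreps Q N"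
    and p: "reduction_map Q N U (R :: ('k, 'v, 'a, 'y) sd_rep) p"
    and r: "reduction_map Q R (zero_sub Q R) (S :: ('k, 'v, 'a, 'w) sd_rep) r"
  shows "reduction_map Q N U S (\<lambda>i x. r i (p i x))"
proof -
  note R = reduction_map_self_dual[OF N U p]
  have s: "subquo Q N U (perp Q N U) R p" using p by (simp add: reduction_map_def)
  have t: "subquo Q R (zero_sub Q R) (full_sub Q R) S r"
    using r by (simp add: reduction_map_def perp_zero[OF R])
  have "p i x \<in> full_sub Q R i" if "i \<in> verts Q" "x \<in> perp Q N U i" for i x
    using subquoD(4)[OF s that(1)] that by (auto simp: full_sub_def)
  then show ?thesis
    using p r subquo_isomorphism[OF sd_rep[OF N] s t]
    unfolding reduction_map_def perp_zero[OF R] by simp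
qed

section \<open>Isometry classes and the basis of the Hall module\<close>

lemma isometric_sym:
  assumes N: "self_dual_rep Q (N :: ('k::{field, finite}, 'v, 'a, 'x) sd_rep)"
    and R: "self_dual_rep Q (R :: ('k, 'v, 'a, 'y) sd_rep)" and "isometric Q N R"
  shows "isometric Q R N"
  using assms(3) reduction_map_isometric[OF N _ reduction_map_refl[OF N]]
  unfolding isometric_iff_reduction_map[OF N R] by blast

lemma isometric_trans:
  assumes N: "self_dual_rep Q (N :: ('k::{field, finite}, 'v, 'a, 'x) sd_rep)"
    and R: "self_dual_rep Q (R :: ('k, 'v, 'a, 'y) sd_rep)"
    and S: "self_dual_rep Q (S :: ('k, 'v, 'a, 'w) sd_rep)"
    and "isometric Q N R" "isometric Q R S"
  shows "isometric Q N S"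
  using assms(4,5) reduction_map_compose[OF N zero_isotropic[OF N]]
  unfolding isometric_iff_reduction_map[OF N R] isometric_iff_reduction_map[OF R S]
    isometric_iff_reduction_map[OF N S] by blast

definition isom_class :: "('k::field, 'v, 'a, 'x) sd_rep \<Rightarrow> ('k, 'v, 'a) sd_class" where
  "isom_class M = {N. self_dual_rep Q N \<and> isometric Q M N}"

lemma isom_class_eq_iff:
  assumes N: "self_dual_rep Q (N :: ('k::{field, finite}, 'v, 'a, 'x) sd_rep)"
    and R: "self_dual_rep Q (R :: ('k, 'v, 'a, 'y) sd_rep)" and ne: "isom_class R \<noteq> {}"
  shows "isom_class N = isom_class R \<longleftrightarrow> isometric Q N R"
proof
  assume e: "isom_class N = isom_class R"
  obtain S where "S \<in> isom_class R" using ne by blast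
  then have "self_dual_rep Q S" "isometric Q N S" "isometric Q R S"
    using e by (auto simp: isom_class_def)
  then show "isometric Q N R" using isometric_trans[OF N _ R] isometric_sym[OF R] by blast
next
  assume "isometric Q N R"
  then show "isom_class N = isom_class R"
    using isometric_trans[OF N R] isometric_trans[OF R N] isometric_sym[OF N R]
    unfolding isom_class_def by blast
qed

definition copy_sd ::
  "('v \<Rightarrow> 'x \<Rightarrow> 'y) \<Rightarrow> ('k::field, 'v, 'a, 'x) sd_rep \<Rightarrow> ('k, 'v, 'a, 'y) sd_rep" where
  "copy_sd g M =
     \<lparr>node_space = node_space (copy_rep g M), arrow_map = arrow_map (copy_rep g M),
      form = (\<lambda>i j x y. form M i j (inv_into (carrier (node_space M i)) (g i) x)
        (inv_into (carrier (node_space M j)) (g j) y))\<rparr>"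

lemma isom_class_bounded_member:
  assumes N: "self_dual_rep Q (N :: ('k::{field, finite}, 'v, 'a, 'x) sd_rep)"
  shows "\<exists>R\<in>isom_class N. \<forall>i\<in>verts Q. carrier (node_space R i) \<subseteq> {..<card (carrier (node_space N i))}"
proof -
  note X = sd_rep[OF N]
  obtain g :: "'v \<Rightarrow> 'x \<Rightarrow> nat" where
    g: "\<And>i. i \<in> verts Q \<Longrightarrow> bij_betw (g i) (carrier (node_space N i)) {..<card (carrier (node_space N i))}"
    using nat_copy[OF X] by blast
  note gi = bij_betw_imp_inj_on[OF g]
  have "subquo Q N (zero_sub Q N) (full_sub Q N) (copy_sd g N) g"
    using subquo_copy[OF X gi] unfolding subquo_def by (simp add: copy_sd_def)
  then have m: "reduction_map Q N (zero_sub Q N) (copy_sd g N) g"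
    unfolding reduction_map_def perp_zero[OF N] using gi
    by (auto simp: full_sub_def copy_sd_def inv_into_f_f)
  have R: "copy_sd g N \<in> isom_class N"
    using reduction_map_self_dual[OF N zero_isotropic[OF N] m] m
      isometric_iff_reduction_map[OF N reduction_map_self_dual[OF N zero_isotropic[OF N] m]]
    unfolding isom_class_def by blast
  show ?thesis
  proof (rule bexI[OF _ R], rule ballI)
    fix i assume "i \<in> verts Q"
    then show "carrier (node_space (copy_sd g N) i) \<subseteq> {..<card (carrier (node_space N i))}"
      using g by (simp add: copy_sd_def copy_rep_def Let_def bij_betw_def)
  qed
qed

lemma isom_class_nonempty:
  assumes N: "self_dual_rep Q (N :: ('k::{field, finite}, 'v, 'a, 'x) sd_rep)"
  shows "isom_class N \<noteq> {}"
  using isom_class_bounded_member[OF N] by blast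

lemma isometry_rel_image: "self_dual_rep Q M \<Longrightarrow> isometry_rel Q `` {M} = isom_class M"
  by (auto simp: isometry_rel_def isom_class_def)

lemma isom_class_in_isometry_classes:
  assumes N: "self_dual_rep Q (N :: ('k::{field, finite}, 'v, 'a, 'x) sd_rep)"
  shows "isom_class N \<in> isometry_classes Q"
proof -
  obtain R :: "('k, 'v, 'a, nat) sd_rep" where R: "self_dual_rep Q R" "isometric Q N R"
    using isom_class_nonempty[OF N] unfolding isom_class_def by blast
  then have "isom_class N = isom_class R"
    using isom_class_eq_iff[OF N R(1)] isom_class_nonempty[OF R(1)] by blast
  then show ?thesis
    using R(1) isometry_rel_image[OF R(1)] unfolding isometry_classes_def quotient_def by blast
qed

lemma isometry_classesD:
  assumes "C \<in> (isometry_classes Q :: ('k::{field, finite}, 'v, 'a) sd_class set)"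
  shows "class_repr C \<in> C" "self_dual_rep Q (class_repr C)" "isom_class (class_repr C) = C"
    and "N \<in> C \<Longrightarrow> self_dual_rep Q N \<and> isom_class N = C"
proof -
  obtain M :: "('k, 'v, 'a, nat) sd_rep" where M: "self_dual_rep Q M" "C = isom_class M"
    using assms unfolding isometry_classes_def quotient_def by (auto simp: isometry_rel_image)
  show 1: "self_dual_rep Q N \<and> isom_class N = C" if "N \<in> C" for N
    using that M isom_class_eq_iff[OF M(1) _ isom_class_nonempty]
    unfolding M(2) isom_class_def by blast
  show 2: "class_repr C \<in> C"
    using isom_class_nonempty[OF M(1)] unfolding M(2) class_repr_def by (simp add: some_in_eq)
  show "self_dual_rep Q (class_repr C)" "isom_class (class_repr C) = C" using 1[OF 2] by auto
qed

lemma class_repr_reduction_map: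
  assumes N: "self_dual_rep Q (N :: ('k::{field, finite}, 'v, 'a, 'x) sd_rep)"
    and U: "U \<in> isotropic_subreps Q N"
    and p: "reduction_map Q N U (R :: ('k, 'v, 'a, 'y) sd_rep) p"
  shows "\<exists>r. reduction_map Q N U (class_repr (isom_class R)) r"
proof -
  note R = reduction_map_self_dual[OF N U p]
  note C = isometry_classesD[OF isom_class_in_isometry_classes[OF R]]
  have "isometric Q R (class_repr (isom_class R))" using C(1) by (simp add: isom_class_def)
  then show ?thesis
    using reduction_map_compose[OF N U p] unfolding isometric_iff_reduction_map[OF R C(2)] by blast
qed

lemma dimvec_isom_class_repr:
  assumes N: "self_dual_rep Q (N :: ('k::{field, finite}, 'v, 'a, 'x) sd_rep)"
  shows "dimvec Q (class_repr (isom_class N)) = dimvec Q N"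
proof -
  obtain r where r: "reduction_map Q N (zero_sub Q N) (class_repr (isom_class N)) r"
    using class_repr_reduction_map[OF N zero_isotropic[OF N] reduction_map_refl[OF N]] by blast
  then show ?thesis
    using dimvec_subquo[OF sd_rep[OF N], of _ _ "class_repr (isom_class N)" r]
      dimvec_subquo[OF sd_rep[OF N] subquo_refl[OF sd_rep[OF N]]]
    unfolding reduction_map_def perp_zero[OF N] by (metis add_left_cancel)
qed

text \<open>Form values lie in the finite field and can be recorded on all of {..n}; the masking in
  \<open>rep_code\<close> is what keeps the other values inside {..n}.\<close>

definition sd_code :: "nat \<Rightarrow> ('k::field, 'v, 'a, nat) sd_rep \<Rightarrow>
  (('v \<Rightarrow> nat set) \<times> ('v \<Rightarrow> nat \<Rightarrow> nat \<Rightarrow> nat) \<times> ('v \<Rightarrow> 'k \<Rightarrow> nat \<Rightarrow> nat) \<times> ('a \<Rightarrow> nat \<Rightarrow> nat)) \<times>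
  ('v \<Rightarrow> 'v \<Rightarrow> nat \<Rightarrow> nat \<Rightarrow> 'k)" where
  "sd_code n M = (rep_code n M, (\<lambda>i\<in>verts Q. \<lambda>j\<in>verts Q. \<lambda>x\<in>{..n}. \<lambda>y\<in>{..n}. form M i j x y))"

lemma finite_isometry_classes_dimvec:
  "finite {C \<in> isometry_classes Q. dimvec Q (class_repr C :: ('k::{field, finite}, 'v, 'a, nat) sd_rep) = d}"
proof -
  define n where "n = (\<Sum>i\<in>verts Q. CARD('k) ^ nat (Poly_Mapping.lookup d i))"
  have n: "CARD('k) ^ nat (Poly_Mapping.lookup d i) \<le> n" if "i \<in> verts Q" for i
    unfolding n_def by (rule member_le_sum[OF that]) (use finite_verts in auto)
  let ?good = "\<lambda>N :: ('k, 'v, 'a, nat) sd_rep. \<forall>i\<in>verts Q. carrier (node_space N i) \<subseteq> {..n}"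
  let ?T = "(rep_codes n :: (_ \<times> _ \<times> ('v \<Rightarrow> 'k \<Rightarrow> nat \<Rightarrow> nat) \<times> _) set) \<times>
    (verts Q \<rightarrow>\<^sub>E verts Q \<rightarrow>\<^sub>E {..n} \<rightarrow>\<^sub>E {..n} \<rightarrow>\<^sub>E (UNIV :: 'k set))"
  show ?thesis
  proof (rule finite_by_code[where good = ?good and code = "sd_code n" and T = ?T])
    show "finite ?T"
      using finite_verts finite_rep_codes by (intro finite_cartesian_product finite_PiE) auto
  next
    fix C :: "('k, 'v, 'a) sd_class"
    assume "C \<in> {C \<in> isometry_classes Q. dimvec Q (class_repr C) = d}"
    then have C: "C \<in> isometry_classes Q" "dimvec Q (class_repr C) = d" by auto
    note CD = isometry_classesD[OF C(1)]
    obtain N where N: "N \<in> C" "\<forall>i\<in>verts Q. carrier (node_space N i) \<subseteq> {..<card (carrier (node_space (class_repr C) i))}"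
      using isom_class_bounded_member[OF CD(2)] CD(3) by auto
    have g: "?good N"
    proof
      fix i assume i: "i \<in> verts Q"
      have "card (carrier (node_space (class_repr C) i)) \<le> n"
        using n[OF i] card_node_space[OF sd_rep[OF CD(2)] i] C(2) by simp
      then show "carrier (node_space N i) \<subseteq> {..n}" using N(2) i by fastforce
    qed
    have "self_dual_rep Q N" using CD(4)[OF N(1)] by blast
    then have "rep_code n N \<in> rep_codes n" using rep_code_in[OF sd_rep] g by blast
    then have "sd_code n N \<in> ?T" by (simp add: sd_code_def)
    with g have "?good N \<and> sd_code n N \<in> ?T" ..
    then show "\<exists>N\<in>C. ?good N \<and> sd_code n N \<in> ?T" using N(1) by (rule bexI)
  next
    fix C D :: "('k, 'v, 'a) sd_class" and N N' :: "('k, 'v, 'a, nat) sd_rep"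
    assume "C \<in> {C \<in> isometry_classes Q. dimvec Q (class_repr C) = d}" "N \<in> C"
      and "D \<in> {C \<in> isometry_classes Q. dimvec Q (class_repr C) = d}" "N' \<in> D"
      and g: "?good N" "?good N'" and e: "sd_code n N = sd_code n N'"
    then have N: "self_dual_rep Q N" "isom_class N = C" "self_dual_rep Q N'" "isom_class N' = D"
      using isometry_classesD(4)[of C N] isometry_classesD(4)[of D N'] by simp_all
    have e': "rep_code n N = rep_code n N'" using e by (simp add: sd_code_def)
    have "form N' i j x y = form N i j x y"
      if "i \<in> verts Q" "j \<in> verts Q" "x \<in> carrier (node_space N i)" "y \<in> carrier (node_space N j)" for i j x y
    proof -
      have "x \<le> n" "y \<le> n" using that g(1) by auto
      then show ?thesis
        using arg_cong[OF e, of "\<lambda>(_, f). f i j x y"] that(1,2) by (simp add: sd_code_def)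
    qed
    then have "isometric Q N N'"
      using rep_code_eq[OF sd_rep[OF N(1)] sd_rep[OF N(3)] _ e'] g(1) unfolding isometric_def by blast
    then show "C = D" using isom_class_eq_iff[OF N(1,3) isom_class_nonempty[OF N(3)]] N by blast
  qed
qed

section \<open>Dimension vectors of complements and reductions\<close>

lemma lookup_dual_dimvec:
  assumes "d \<in> dimvecs Q"
  shows "Poly_Mapping.lookup (dual_dimvec Q d) i = (if i \<in> verts Q then Poly_Mapping.lookup d (node_inv Q i) else 0)"
proof -
  have k: "Poly_Mapping.keys d \<subseteq> verts Q" using assms by (auto simp: dimvecs_def)
  have "Poly_Mapping.lookup (dual_dimvec Q d) i =
      (\<Sum>j\<in>Poly_Mapping.keys d. if i = node_inv Q j then Poly_Mapping.lookup d j else 0)"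
    unfolding dual_dimvec_def frag_extend_def lookup_sum by (intro sum.cong refl) simp
  also have "\<dots> = (if i \<in> verts Q then Poly_Mapping.lookup d (node_inv Q i) else 0)"
  proof (cases "i \<in> verts Q")
    case True
    have "(\<Sum>j\<in>Poly_Mapping.keys d. if i = node_inv Q j then Poly_Mapping.lookup d j else 0) =
        (\<Sum>j\<in>Poly_Mapping.keys d. if node_inv Q i = j then Poly_Mapping.lookup d j else 0)"
      using k node_inv(2) True by (intro sum.cong refl) (metis subsetD)
    then show ?thesis using True by (simp add: in_keys_iff)
  next
    case False
    then have "i \<noteq> node_inv Q j" if "j \<in> Poly_Mapping.keys d" for j using k node_inv(1)[of j] that by blast
    then show ?thesis using False by simp
  qed
  finally show ?thesis .
qed

lemma dimvec_perp:
  assumes N: "self_dual_rep Q (N :: ('k::{field, finite}, 'v, 'a, 'x) sd_rep)" and U: "U \<in> subreps Q N"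
  shows "dimvec Q (sub_rep N (perp Q N U)) + dual_dimvec Q (dimvec Q (sub_rep N U)) = dimvec Q N"
proof (rule poly_mapping_eqI)
  fix i
  note X = sd_rep[OF N] and P = perp_subrep[OF N U]
  note rU = subquo_rep[OF X subquo_sub[OF X U]] and rP = subquo_rep[OF X subquo_sub[OF X P]]
  let ?l = Poly_Mapping.lookup
  note ld = lookup_dual_dimvec[OF dimvec_carrier]
  show "?l (dimvec Q (sub_rep N (perp Q N U)) + dual_dimvec Q (dimvec Q (sub_rep N U))) i = ?l (dimvec Q N) i"
  proof (cases "i \<in> verts Q")
    case True
    note j = node_inv(1)[OF True]
    have nn: "0 \<le> ?l (dimvec Q M) i" for M :: "('k, 'v, 'a, 'x) rep" and i by (simp add: lookup_dimvec)
    have nn': "0 \<le> ?l (dimvec Q N) i" by (simp add: lookup_dimvec)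
    have "CARD('k) ^ (nat (?l (dimvec Q (sub_rep N (perp Q N U))) i) +
        nat (?l (dimvec Q (sub_rep N U)) (node_inv Q i))) = CARD('k) ^ nat (?l (dimvec Q N) i)"
      using card_perp[OF N U True] card_node_space[OF rP True] card_node_space[OF rU j] card_node_space[OF X True]
      by (simp add: sub_rep_def power_add)
    then have "nat (?l (dimvec Q (sub_rep N (perp Q N U))) i) + nat (?l (dimvec Q (sub_rep N U)) (node_inv Q i)) =
        nat (?l (dimvec Q N) i)"
      using card_field_gt_1[where 'k = 'k] power_inject_exp by blast
    then show ?thesis
      using nn[of "sub_rep N (perp Q N U)" i] nn[of "sub_rep N U" "node_inv Q i"] nn' True
      by (simp add: lookup_add ld)
  qed (simp add: lookup_add ld lookup_dimvec)
qed

text \<open>The dimension vector of the complement is that of \<open>U\<close> plus that of the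
  reduction, and \<open>dimvec_perp\<close> supplies the dual of dim U. Thus reduction preserves the
  weight that indexes the two sums.\<close>

lemma dimvec_reduction:
  assumes N: "self_dual_rep Q (N :: ('k::{field, finite}, 'v, 'a, 'x) sd_rep)" and U: "U \<in> subreps Q N"
    and p: "reduction_map Q N U (R :: ('k, 'v, 'a, 'y) sd_rep) p"
  shows "dimvec Q N = hyperbolic_dimvec Q (dimvec Q (sub_rep N U)) + dimvec Q R"
proof -
  have "dimvec Q (sub_rep N (perp Q N U)) = dimvec Q (sub_rep N U) + dimvec Q R"
    using dimvec_subquo[OF sd_rep[OF N]] p unfolding reduction_map_def by blast
  then show ?thesis using dimvec_perp[OF N U] by (simp add: hyperbolic_dimvec_def add_ac)
qed

lemma dual_dimvec_self_dual:
  assumes N: "self_dual_rep Q (N :: ('k::{field, finite}, 'v, 'a, 'x) sd_rep)"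
  shows "dual_dimvec Q (dimvec Q N) = dimvec Q N"
  using dimvec_perp[OF N full_sub_subrep[OF sd_rep[OF N]]]
  by (simp add: perp_full[OF N] dimvec_zero_sub[OF sd_rep[OF N]] dimvec_full_sub)

lemma finite_isotropic_subreps:
  assumes N: "self_dual_rep Q (N :: ('k::{field, finite}, 'v, 'a, 'x) sd_rep)"
  shows "finite (isotropic_subreps Q N)"
  by (rule finite_subset[OF _ finite_subreps[OF sd_rep[OF N]]]) (auto simp: isotropic_subreps_def)

lemma lookup_hall_act:
  fixes f :: "('k::{field, finite}, 'v, 'a) hall_algebra" and m :: "('k, 'v, 'a) hall_module"
  assumes f: "Poly_Mapping.keys f \<subseteq> iso_classes Q" and m: "Poly_Mapping.keys m \<subseteq> isometry_classes Q"
  shows "Poly_Mapping.lookup (hall_act Q f m) C =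
    (if C \<in> isometry_classes Q then
      (\<Sum>W\<in>isotropic_subreps Q (class_repr C). Poly_Mapping.lookup f (iso_class (sub_rep (class_repr C) W)) *
        Poly_Mapping.lookup m (isom_class (reduction Q (class_repr C) W))) else 0)"
proof (cases "C \<in> isometry_classes Q")
  case False
  then show ?thesis
    unfolding hall_act_def Let_def lookup_sum by (auto intro!: sum.neutral simp: lookup_single when_def)
next
  case True
  have eq: "hall_module_number Q (class_repr C) (class_repr A) (class_repr B) =
      card {W \<in> isotropic_subreps Q (class_repr C). iso_class (sub_rep (class_repr C) W) = A \<and>
        isom_class (reduction Q (class_repr C) W) = B}"
    if C: "C \<in> isometry_classes Q" and A: "A \<in> iso_classes Q" and B: "B \<in> isometry_classes Q"
    for A :: "('k, 'v, 'a) rep_class" and B C :: "('k, 'v, 'a) sd_class"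
  proof -
    note N = isometry_classesD(2)[OF C]
    have "isomorphic Q (sub_rep (class_repr C) W) (class_repr A) \<longleftrightarrow> iso_class (sub_rep (class_repr C) W) = A"
      "isometric Q (reduction Q (class_repr C) W) (class_repr B) \<longleftrightarrow> isom_class (reduction Q (class_repr C) W) = B"
      if W: "W \<in> isotropic_subreps Q (class_repr C)" for W
      using iso_class_eq_iff[OF subquo_rep[OF sd_rep[OF N] subquo_sub[OF sd_rep[OF N] isotropic_subrepsD(1)[OF N W]]]
            iso_classesD(2)[OF A]]
        isom_class_eq_iff[OF reduction_map_self_dual[OF N W reduction_map_reduction[OF N W]] isometry_classesD(2)[OF B]]
        iso_classesD(1,3)[OF A] isometry_classesD(1,3)[OF B]
      by blast+
    then show ?thesis
      unfolding hall_module_number_def by (metis (no_types, lifting))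
  qed
  \<comment> \<open>A nonzero coefficient fixes the dimension vector of the result, through
    \<open>dimvec_reduction\<close>.\<close>
  have fin: "finite {C \<in> isometry_classes Q. hall_module_number Q (class_repr C) (class_repr A) (class_repr B) \<noteq> 0}"
    if A: "A \<in> iso_classes Q" and B: "B \<in> isometry_classes Q"
    for A :: "('k, 'v, 'a) rep_class" and B :: "('k, 'v, 'a) sd_class"
  proof (rule finite_subset[OF _ finite_isometry_classes_dimvec])
    show "{C \<in> isometry_classes Q. hall_module_number Q (class_repr C) (class_repr A) (class_repr B) \<noteq> 0} \<subseteq>
      {C \<in> isometry_classes Q. dimvec Q (class_repr C) =
        hyperbolic_dimvec Q (dimvec Q (class_repr A)) + dimvec Q (class_repr B)}"
    proof
      fix C assume "C \<in> {C \<in> isometry_classes Q. hall_module_number Q (class_repr C) (class_repr A) (class_repr B) \<noteq> 0}"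
      then have C: "C \<in> isometry_classes Q" and "hall_module_number Q (class_repr C) (class_repr A) (class_repr B) \<noteq> 0"
        by auto
      from card_nonzero_ex[OF this(2)[unfolded eq[OF C A B]]]
      obtain W where W: "W \<in> isotropic_subreps Q (class_repr C)" "iso_class (sub_rep (class_repr C) W) = A"
        "isom_class (reduction Q (class_repr C) W) = B" by auto
      note N = isometry_classesD(2)[OF C]
      note WD = isotropic_subrepsD[OF N W(1)] and r = reduction_map_reduction[OF N W(1)]
      have "dimvec Q (class_repr A) = dimvec Q (sub_rep (class_repr C) W)"
        "dimvec Q (class_repr B) = dimvec Q (reduction Q (class_repr C) W)"
        using dimvec_class_repr[OF subquo_rep[OF sd_rep[OF N] subquo_sub[OF sd_rep[OF N] WD(1)]]]
          dimvec_isom_class_repr[OF reduction_map_self_dual[OF N W(1) r]] W(2,3) by auto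
      then show "C \<in> {C \<in> isometry_classes Q. dimvec Q (class_repr C) =
          hyperbolic_dimvec Q (dimvec Q (class_repr A)) + dimvec Q (class_repr B)}"
        using C dimvec_reduction[OF N WD(1) r] by simp
    qed
  qed
  show ?thesis
    unfolding hall_act_def Let_def
    by (rule lookup_structure_sum[where a = "\<lambda>W. iso_class (sub_rep (class_repr C) W)"
          and b = "\<lambda>W. isom_class (reduction Q (class_repr C) W)"])
       (use fin eq f m finite_isotropic_subreps[OF isometry_classesD(2)[OF True]] in blast)+
qed

lemma lookup_char_sd_all:
  assumes N: "self_dual_rep Q (N :: ('k::{field, finite}, 'v, 'a, 'x) sd_rep)"
  shows "Poly_Mapping.lookup (char_sd_all Q d) (isom_class N) = of_bool (dimvec Q N = d)"
proof -
  have "finite {C \<in> isometry_classes Q. dimvec Q (class_repr C :: ('k, 'v, 'a, nat) sd_rep) = d}"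
    by (rule finite_isometry_classes_dimvec)
  then show ?thesis
    using isom_class_in_isometry_classes[OF N] dimvec_isom_class_repr[OF N]
    by (simp add: char_sd_all_def lookup_sum lookup_single when_def)
qed

lemma lookup_char_sd_ss:
  assumes N: "self_dual_rep Q (N :: ('k::{field, finite}, 'v, 'a, 'x) sd_rep)"
  shows "Poly_Mapping.lookup (char_sd_ss Q \<theta> d) (isom_class N) = of_bool (dimvec Q N = d \<and> sd_semistable Q \<theta> N)"
proof -
  obtain r where r: "reduction_map Q N (zero_sub Q N) (class_repr (isom_class N)) r"
    using class_repr_reduction_map[OF N zero_isotropic[OF N] reduction_map_refl[OF N]] by blast
  have "sd_semistable Q \<theta> (class_repr (isom_class N)) \<longleftrightarrow> sd_semistable Q \<theta> N"
    unfolding sd_semistable_iff[OF N zero_isotropic[OF N] r]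
      sd_semistable_iff[OF N zero_isotropic[OF N] reduction_map_refl[OF N]] ..
  moreover have "finite {A \<in> isometry_classes Q. dimvec Q (class_repr A :: ('k, 'v, 'a, nat) sd_rep) = d \<and>
      sd_semistable Q \<theta> (class_repr A)}"
    by (rule finite_subset[OF _ finite_isometry_classes_dimvec[of d]]) auto
  ultimately show ?thesis
    using isom_class_in_isometry_classes[OF N] dimvec_isom_class_repr[OF N]
    by (simp add: char_sd_ss_def lookup_sum lookup_single when_def)
qed

lemma keys_char_sd:
  "Poly_Mapping.keys (char_sd_all Q d :: ('k::{field, finite}, 'v, 'a) hall_module) \<subseteq> isometry_classes Q"
  "Poly_Mapping.keys (char_sd_ss Q \<theta> d :: ('k::{field, finite}, 'v, 'a) hall_module) \<subseteq> isometry_classes Q"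
  unfolding char_sd_all_def char_sd_ss_def
  by (rule order_trans[OF keys_sum_single_subset], blast)+

end

section \<open>The lattice of subrepresentations of a self-dual representation\<close>

locale stable_self_dual = duality_quiver Q for Q :: "('v, 'a) dquiver" +
  fixes \<theta> :: "('v \<Rightarrow>\<^sub>0 int) \<Rightarrow> int" and N :: "('k::{field, finite}, 'v, 'a, 'x) sd_rep"
  assumes compatible: "compatible_stability Q \<theta>" and self_dual: "self_dual_rep Q N"
begin

abbreviation sdim :: "('v \<Rightarrow> 'x set) \<Rightarrow> ('v \<Rightarrow>\<^sub>0 int)" where
  "sdim U \<equiv> dimvec Q (sub_rep N U)"

definition subrep_sum :: "('v \<Rightarrow> 'x set) \<Rightarrow> ('v \<Rightarrow> 'x set) \<Rightarrow> ('v \<Rightarrow> 'x set)" where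
  "subrep_sum U W = (\<lambda>i\<in>verts Q. U i <+>\<^bsub>node_space N i\<^esub> W i)"

definition theta_sub :: "('v \<Rightarrow> 'x set) \<Rightarrow> int" where
  "theta_sub U = \<theta> (sdim U)"

definition rank_sub :: "('v \<Rightarrow> 'x set) \<Rightarrow> int" where
  "rank_sub U = (\<Sum>i\<in>verts Q. Poly_Mapping.lookup (sdim U) i)"

lemma rep: "representation Q N"
  by (rule sd_rep[OF self_dual])

lemma theta_add: "x \<in> dimvecs Q \<Longrightarrow> y \<in> dimvecs Q \<Longrightarrow> \<theta> (x + y) = \<theta> x + \<theta> y"
  using compatible by (auto simp: compatible_stability_def stability_def dimvecs_def hom_def)

lemma theta_zero: "\<theta> 0 = 0"
  using theta_add[of 0 0] by (simp add: dimvecs_def)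

lemma theta_dual: "x \<in> dimvecs Q \<Longrightarrow> \<theta> (dual_dimvec Q x) = - \<theta> x"
  using compatible by (auto simp: compatible_stability_def dimvecs_def)

lemma theta_self_dual: "\<theta> (dimvec Q N) = 0"
  using theta_dual[OF dimvec_carrier[of N]] dual_dimvec_self_dual[OF self_dual] by simp

lemma dual_dimvec_carrier: "d \<in> dimvecs Q \<Longrightarrow> dual_dimvec Q d \<in> dimvecs Q"
proof -
  assume d: "d \<in> dimvecs Q"
  have "Poly_Mapping.keys (dual_dimvec Q d) \<subseteq> verts Q"
    by (auto simp: in_keys_iff lookup_dual_dimvec[OF d] split: if_splits)
  then show ?thesis using d by (auto simp: dimvecs_def lookup_dual_dimvec[OF d])
qed

lemma inf_subrep:
  assumes U: "U \<in> subreps Q N" and W: "W \<in> subreps Q N"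
  shows "inf U W \<in> subreps Q N"
proof (rule subrepsI)
  fix i assume i: "i \<in> verts Q"
  show "ksubspace (inf U W i) (node_space N i)"
    using subrepsD(1)[OF U i] subrepsD(1)[OF W i] by (auto simp: ksubspace_iff[OF rep_spaceD(1)[OF rep i]])
qed (use subrepsD(2,3)[OF U] subrepsD(2,3)[OF W] in auto)

lemma sum_subrep:
  assumes U: "U \<in> subreps Q N" and W: "W \<in> subreps Q N"
  shows "subrep_sum U W \<in> subreps Q N"
proof (rule subrepsI)
  fix i assume i: "i \<in> verts Q"
  note V = rep_spaceD(1)[OF rep i] and Ui = ksubspaceD[OF subrepsD(1)[OF U i]]
    and Wi = ksubspaceD[OF subrepsD(1)[OF W i]]
  interpret V: vectorspace "class_ring :: 'k ring" "node_space N i" by (rule V)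
  show "ksubspace (subrep_sum U W i) (node_space N i)"
    unfolding ksubspace_iff[OF V]
  proof (intro conjI allI ballI)
    show "subrep_sum U W i \<subseteq> carrier (node_space N i)"
      using i Ui(1) Wi(1) by (auto simp: subrep_sum_def set_add_def' subset_eq)
    have "u \<oplus>\<^bsub>node_space N i\<^esub> w \<in> subrep_sum U W i" if "u \<in> U i" "w \<in> W i" for u w
      using i that by (auto simp: subrep_sum_def set_add_def')
    from this[OF Ui(2) Wi(2)] show "\<zero>\<^bsub>node_space N i\<^esub> \<in> subrep_sum U W i" by simp
    fix x assume "x \<in> subrep_sum U W i"
    then obtain u w where x: "u \<in> U i" "w \<in> W i" "x = u \<oplus>\<^bsub>node_space N i\<^esub> w"
      using i by (auto simp: subrep_sum_def set_add_def')
    have xc: "u \<in> carrier (node_space N i)" "w \<in> carrier (node_space N i)" using x Ui(1) Wi(1) by auto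
    show "c \<odot>\<^bsub>node_space N i\<^esub> x \<in> subrep_sum U W i" for c
      using x(3) V.smult_r_distr[of c, OF _ xc] Ui(4)[OF x(1), of c] Wi(4)[OF x(2), of c] i
      by (auto simp: subrep_sum_def set_add_def')
    fix y assume "y \<in> subrep_sum U W i"
    then obtain u' w' where y: "u' \<in> U i" "w' \<in> W i" "y = u' \<oplus>\<^bsub>node_space N i\<^esub> w'"
      using i by (auto simp: subrep_sum_def set_add_def')
    have yc: "u' \<in> carrier (node_space N i)" "w' \<in> carrier (node_space N i)" using y Ui(1) Wi(1) by auto
    have "x \<oplus>\<^bsub>node_space N i\<^esub> y = (u \<oplus>\<^bsub>node_space N i\<^esub> u') \<oplus>\<^bsub>node_space N i\<^esub> (w \<oplus>\<^bsub>node_space N i\<^esub> w')"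
      using x(3) y(3) xc yc by (simp add: V.a_ac)
    then show "x \<oplus>\<^bsub>node_space N i\<^esub> y \<in> subrep_sum U W i"
      using Ui(3)[OF x(1) y(1)] Wi(3)[OF x(2) y(2)] i by (auto simp: subrep_sum_def set_add_def')
  qed
next
  fix a x assume a: "a \<in> arcs Q" and "x \<in> subrep_sum U W (tail Q a)"
  note t = arc_verts(1)[OF a] and h = arc_verts(2)[OF a]
  obtain u w where x: "u \<in> U (tail Q a)" "w \<in> W (tail Q a)" "x = u \<oplus>\<^bsub>node_space N (tail Q a)\<^esub> w"
    using t \<open>x \<in> subrep_sum U W (tail Q a)\<close> by (auto simp: subrep_sum_def set_add_def')
  have "arrow_map N a x = arrow_map N a u \<oplus>\<^bsub>node_space N (head Q a)\<^esub> arrow_map N a w"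
    using rep_arrowD(2)[OF rep a] x subrep_carrier[OF self_dual] U W t by blast
  then show "arrow_map N a x \<in> subrep_sum U W (head Q a)"
    using subrepsD(3)[OF U a x(1)] subrepsD(3)[OF W a x(2)] h by (auto simp: subrep_sum_def set_add_def')
qed (simp add: subrep_sum_def)

lemma sum_upper:
  assumes U: "U \<in> subreps Q N" and W: "W \<in> subreps Q N"
  shows "U \<le> subrep_sum U W" "W \<le> subrep_sum U W"
proof -
  note S = sum_subrep[OF U W]
  have "U i \<subseteq> subrep_sum U W i \<and> W i \<subseteq> subrep_sum U W i" if i: "i \<in> verts Q" for i
  proof -
    interpret V: vectorspace "class_ring :: 'k ring" "node_space N i" by (rule rep_spaceD(1)[OF rep i])
    note Ui = ksubspaceD[OF subrepsD(1)[OF U i]] and Wi = ksubspaceD[OF subrepsD(1)[OF W i]]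
    have "x \<in> subrep_sum U W i" if x: "x \<in> U i" for x
    proof -
      have "x = x \<oplus>\<^bsub>node_space N i\<^esub> \<zero>\<^bsub>node_space N i\<^esub>" using x Ui(1) by auto
      then show ?thesis using x Wi(2) i unfolding subrep_sum_def set_add_def' by auto
    qed
    moreover have "x \<in> subrep_sum U W i" if x: "x \<in> W i" for x
    proof -
      have "x = \<zero>\<^bsub>node_space N i\<^esub> \<oplus>\<^bsub>node_space N i\<^esub> x" using x Wi(1) by auto
      then show ?thesis using x Ui(2) i unfolding subrep_sum_def set_add_def' by auto
    qed
    ultimately show ?thesis by blast
  qed
  then show "U \<le> subrep_sum U W" "W \<le> subrep_sum U W"
    unfolding subreps_le_iff[OF U S] subreps_le_iff[OF W S] by blast+
qed

lemma sum_least: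
  assumes U: "U \<in> subreps Q N" and W: "W \<in> subreps Q N" and Z: "Z \<in> subreps Q N"
    and le: "U \<le> Z" "W \<le> Z"
  shows "subrep_sum U W \<le> Z"
  unfolding subreps_le_iff[OF sum_subrep[OF U W] Z]
proof (intro ballI subsetI)
  fix i x assume i: "i \<in> verts Q" and "x \<in> subrep_sum U W i"
  then obtain u w where x: "u \<in> U i" "w \<in> W i" "x = u \<oplus>\<^bsub>node_space N i\<^esub> w"
    by (auto simp: subrep_sum_def set_add_def')
  have "u \<in> Z i" "w \<in> Z i" using x le by (auto simp: le_fun_def)
  then show "x \<in> Z i" using ksubspaceD(3)[OF subrepsD(1)[OF Z i]] x(3) by blast
qed

text \<open>The second isomorphism theorem: \<open>U / (U \<inter> W)\<close> and \<open>(U + W) / W\<close> are the same subspace of \<open>N / W\<close>.\<close>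

lemma sdim_modular:
  assumes U: "U \<in> subreps Q N" and W: "W \<in> subreps Q N"
  shows "sdim (inf U W) + sdim (subrep_sum U W) = sdim U + sdim W"
proof -
  let ?S = "subrep_sum U W" and ?F = "full_sub Q N" and ?Y = "quot_rep Q N W"
  let ?p = "\<lambda>i x. W i +>\<^bsub>node_space N i\<^esub> x"
  note S = sum_subrep[OF U W]
  note q = subquo_quot[OF rep W]
  note SF = subrep_bounds(2)[OF rep S] and UF = subrep_bounds(2)[OF rep U]
  define V where "V = (\<lambda>i\<in>verts Q. ?p i ` ?S i)"
  note V = preim_image[OF rep q S sum_upper(2)[OF U W] SF, folded V_def]
  have s: "subquo Q N W ?S (sub_rep ?Y V) ?p"
    using subquo_subrep(1)[OF rep q V(1)] V(2) by simp
  have US: "U i \<subseteq> ?S i" for i using sum_upper(1)[OF U W] by (simp add: le_fun_def)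
  note sD = subquoD[OF s]
  have "subquo Q N (inf U W) U (sub_rep ?Y V) ?p"
  proof (rule subquoI)
    show "inf U W \<in> subreps Q N" "U \<in> subreps Q N" by (fact inf_subrep[OF U W], fact U)
    fix i assume i: "i \<in> verts Q"
    show "inf U W i \<subseteq> U i" by simp
    have "?p i ` U i = ?p i ` ?S i"
    proof (intro equalityI subsetI)
      fix y assume "y \<in> ?p i ` ?S i"
      then obtain x where x: "x \<in> ?S i" "y = ?p i x" by blast
      then obtain u w where uw: "u \<in> U i" "w \<in> W i" "x = u \<oplus>\<^bsub>node_space N i\<^esub> w"
        using i by (auto simp: subrep_sum_def set_add_def')
      interpret Y: vectorspace "class_ring :: 'k ring" "node_space (sub_rep ?Y V) i"
        by (rule rep_spaceD(1)[OF subquo_rep[OF rep s] i])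
      have uS: "u \<in> ?S i" and wS: "w \<in> ?S i" using uw US sD(3)[OF i] by blast+
      have "?p i w = \<zero>\<^bsub>node_space (sub_rep ?Y V) i\<^esub>" using sD(7)[OF i wS] uw(2) by blast
      moreover have "?p i u \<in> carrier (node_space (sub_rep ?Y V) i)" using sD(4)[OF i] uS by blast
      ultimately have "y = ?p i u" using sD(5)[OF i uS wS] x(2) uw(3) by simp
      then show "y \<in> ?p i ` U i" using uw(1) by blast
    qed (use US in blast)
    then show "?p i ` U i = carrier (node_space (sub_rep ?Y V) i)" using sD(4)[OF i] by simp
    fix x assume x: "x \<in> U i"
    show "?p i (c \<odot>\<^bsub>node_space N i\<^esub> x) = c \<odot>\<^bsub>node_space (sub_rep ?Y V) i\<^esub> ?p i x" for c
      using sD(6)[OF i] x US by blast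
    show "?p i x = \<zero>\<^bsub>node_space (sub_rep ?Y V) i\<^esub> \<longleftrightarrow> x \<in> inf U W i"
      using sD(7)[OF i, of x] x US by auto
    show "?p i (x \<oplus>\<^bsub>node_space N i\<^esub> y) = ?p i x \<oplus>\<^bsub>node_space (sub_rep ?Y V) i\<^esub> ?p i y" if "y \<in> U i" for y
      using sD(5)[OF i, of x y] x that US by blast
  next
    fix a x assume "a \<in> arcs Q" "x \<in> U (tail Q a)"
    then show "?p (head Q a) (arrow_map N a x) = arrow_map (sub_rep ?Y V) a (?p (tail Q a) x)"
      using sD(8)[of a x] US by blast
  qed
  from dimvec_subquo[OF rep this] dimvec_subquo[OF rep s] show ?thesis by simp
qed

lemma sdim_diff:
  assumes "A \<in> subreps Q N" "W \<in> subreps Q N" "A \<le> W"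
  shows "sdim W - sdim A = dimvec Q (sq Q N A W)"
  using dimvec_subquo[OF rep subquo_sq[OF rep assms]] by simp

lemma rank_strict:
  assumes A: "A \<in> subreps Q N" and W: "W \<in> subreps Q N" and less: "A < W"
  shows "rank_sub A < rank_sub W"
proof -
  have le: "A \<le> W" using less by simp
  note s = subquo_sq[OF rep A W le]
  let ?d = "dimvec Q (sq Q N A W)"
  have nn: "0 \<le> Poly_Mapping.lookup ?d i" for i by (simp add: lookup_dimvec)
  have "\<exists>i\<in>verts Q. Poly_Mapping.lookup ?d i \<noteq> 0"
  proof (rule ccontr)
    assume "\<not> ?thesis"
    then have "card (carrier (node_space (sq Q N A W) i)) = 1" if "i \<in> verts Q" for i
      using card_node_space[OF subquo_rep[OF rep s] that] that by simp
    then have "card (W i) = card (A i)" if "i \<in> verts Q" for i using subquo_card[OF rep s that] that by simp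
    then have "A i = W i" if "i \<in> verts Q" for i
      using card_subset_eq[OF finite_subrep[OF self_dual W that]] le that by (metis le_funD)
    then show False using subreps_eqI[OF A W] less by simp
  qed
  then have "0 < (\<Sum>i\<in>verts Q. Poly_Mapping.lookup ?d i)"
    using nn finite_verts by (metis order_le_less sum_pos2)
  moreover have "sdim W = sdim A + ?d" by (rule dimvec_subquo[OF rep s])
  ultimately show ?thesis unfolding rank_sub_def by (simp add: lookup_add sum.distrib)
qed

text \<open>The meet is the pointwise intersection that the function type already provides, while
  the join is the sum of subspaces rather than the pointwise union; this is why the locale takes the
  join as a parameter.\<close>

sublocale lat: polarised_lattice "subreps Q N" subrep_sum "perp Q N" "zero_sub Q N" theta_sub rank_sub
proof
  show "finite (subreps Q N)" by (rule finite_subreps[OF rep])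
  show "zero_sub Q N \<in> subreps Q N" by (rule zero_sub_subrep[OF rep])
  show "theta_sub (zero_sub Q N) = 0" by (simp add: theta_sub_def dimvec_zero_sub[OF rep] theta_zero)
next
  fix U assume U: "U \<in> subreps Q N"
  show "zero_sub Q N \<le> U" by (rule subrep_bounds(1)[OF rep U])
  show "perp Q N U \<in> subreps Q N" by (rule perp_subrep[OF self_dual U])
  show "perp Q N (perp Q N U) = U" by (rule perp_perp[OF self_dual U])
  show "theta_sub (perp Q N U) = theta_sub U"
    using dimvec_perp[OF self_dual U] theta_add[OF dimvec_carrier dual_dimvec_carrier[OF dimvec_carrier],
        of "sub_rep N (perp Q N U)" "sub_rep N U"] theta_self_dual theta_dual[OF dimvec_carrier, of "sub_rep N U"]
    by (simp add: theta_sub_def)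
  fix W assume W: "W \<in> subreps Q N"
  show "inf U W \<in> subreps Q N" by (rule inf_subrep[OF U W])
  show "subrep_sum U W \<in> subreps Q N" by (rule sum_subrep[OF U W])
  show "U \<le> subrep_sum U W" "W \<le> subrep_sum U W" by (fact sum_upper[OF U W])+
  show "perp Q N W \<le> perp Q N U" if "U \<le> W" by (rule perp_antimono[OF self_dual U W that])
  show "theta_sub (inf U W) + theta_sub (subrep_sum U W) = theta_sub U + theta_sub W"
    using arg_cong[OF sdim_modular[OF U W], of \<theta>]
      theta_add[OF dimvec_carrier[of "sub_rep N (inf U W)"] dimvec_carrier[of "sub_rep N (subrep_sum U W)"]]
      theta_add[OF dimvec_carrier[of "sub_rep N U"] dimvec_carrier[of "sub_rep N W"]]
    by (simp add: theta_sub_def)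
  have "(\<Sum>i\<in>verts Q. Poly_Mapping.lookup (sdim (inf U W) + sdim (subrep_sum U W)) i) =
      (\<Sum>i\<in>verts Q. Poly_Mapping.lookup (sdim U + sdim W) i)"
    by (simp only: sdim_modular[OF U W])
  then show "rank_sub (inf U W) + rank_sub (subrep_sum U W) = rank_sub U + rank_sub W"
    by (simp add: rank_sub_def lookup_add sum.distrib)
  show "rank_sub U < rank_sub W" if "U < W" by (rule rank_strict[OF U W that])
  fix Z assume "Z \<in> subreps Q N" "U \<le> Z" "W \<le> Z"
  then show "subrep_sum U W \<le> Z" by (rule sum_least[OF U W])
qed

lemma isotr_eq: "lat.isotr = isotropic_subreps Q N"
  by (simp add: lat.isotr_def isotropic_subreps_eq[OF self_dual])

lemma theta_diff:
  assumes "A \<in> subreps Q N" "W \<in> subreps Q N" "A \<le> W"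
  shows "\<theta> (sdim W - sdim A) = theta_sub W - theta_sub A"
proof -
  have "sdim W = sdim A + dimvec Q (sq Q N A W)" using sdim_diff[OF assms] by (simp add: algebra_simps)
  then have "\<theta> (sdim W) = \<theta> (sdim A) + \<theta> (dimvec Q (sq Q N A W))"
    using theta_add[OF dimvec_carrier dimvec_carrier] by metis
  then show ?thesis using sdim_diff[OF assms] by (simp add: theta_sub_def)
qed

lemma mu_eq_slope:
  assumes "A \<in> subreps Q N" "W \<in> subreps Q N" "A \<le> W"
  shows "lat.mu A W = slope Q \<theta> (sdim W - sdim A)"
  using theta_diff[OF assms]
  by (simp add: lat.mu_def slope_def rank_sub_def lookup_minus sum_subtractf)

lemma ss_iff:
  assumes "A \<in> subreps Q N" "W \<in> subreps Q N" "A \<le> W"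
  shows "semistable Q \<theta> (sq Q N A W) \<longleftrightarrow> lat.ss A W"
  unfolding semistable_iff[OF rep subquo_sq[OF rep assms]] lat.ss_def
  using assms by (auto simp: mu_eq_slope)

lemma sd_ss_iff:
  assumes "U \<in> isotropic_subreps Q N"
  shows "sd_semistable Q \<theta> (reduction Q N U) \<longleftrightarrow> lat.sd_ss U"
proof -
  note UL = isotropic_subrepsD(1)[OF self_dual assms]
  have "slope Q \<theta> (sdim W - sdim U) \<le> 0 \<longleftrightarrow> theta_sub W \<le> theta_sub U"
    if W: "W \<in> isotropic_subreps Q N" "U < W" for W
    using lat.mu_le_iff[OF UL isotropic_subrepsD(1)[OF self_dual W(1)] W(2), of 0]
      mu_eq_slope[OF UL isotropic_subrepsD(1)[OF self_dual W(1)]] W(2) by simp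
  then show ?thesis
    unfolding sd_semistable_iff[OF self_dual assms reduction_map_reduction[OF self_dual assms]]
      lat.sd_ss_def isotr_eq by (auto simp: less_le)
qed

text \<open>Chains are weakly increasing, like the flags of a Hall product, and \<open>P\<close>
  constrains consecutive terms. Strictness is recovered from the nonzero entries of the tuples in
  \<open>fchain_diffs_nonzero\<close>.\<close>

fun fchain :: "(('v \<Rightarrow> 'x set) \<Rightarrow> ('v \<Rightarrow> 'x set) \<Rightarrow> bool) \<Rightarrow> ('v \<Rightarrow> 'x set) \<Rightarrow> ('v \<Rightarrow> 'x set) list \<Rightarrow> bool" where
  "fchain P A [] = True"
| "fchain P A (W # Ws) = (W \<in> subreps Q N \<and> A \<le> W \<and> P A W \<and> fchain P W Ws)"

fun diffs :: "('v \<Rightarrow> 'x set) \<Rightarrow> ('v \<Rightarrow> 'x set) list \<Rightarrow> ('v \<Rightarrow>\<^sub>0 int) list" where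
  "diffs A [] = []"
| "diffs A (W # Ws) = (sdim W - sdim A) # diffs W Ws"

lemma length_diffs [simp]: "length (diffs A Ws) = length Ws"
  by (induction Ws arbitrary: A) auto

lemma fchain_last:
  "fchain P A Ws \<Longrightarrow> A \<in> subreps Q N \<Longrightarrow> last (A # Ws) \<in> subreps Q N \<and> A \<le> last (A # Ws)"
  by (induction Ws arbitrary: A) (auto intro: order_trans)

lemma fchain_subset: "fchain P A Ws \<Longrightarrow> set Ws \<subseteq> subreps Q N"
  by (induction Ws arbitrary: A) auto

lemma fchain_mono: "fchain P A Ws \<Longrightarrow> (\<And>A W. P A W \<Longrightarrow> P' A W) \<Longrightarrow> fchain P' A Ws"
  by (induction Ws arbitrary: A) auto

definition flags :: "(('v \<Rightarrow> 'x set) \<Rightarrow> ('v \<Rightarrow> 'x set) \<Rightarrow> bool) \<Rightarrow> ('v \<Rightarrow>\<^sub>0 int) list \<Rightarrow>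
    ('v \<Rightarrow> 'x set) \<Rightarrow> ('v \<Rightarrow> 'x set) \<Rightarrow> ('v \<Rightarrow> 'x set) list set" where
  "flags P ds A U = {Ws. fchain P A Ws \<and> diffs A Ws = ds \<and> last (A # Ws) = U}"

lemma finite_fchains: "finite {Ws. fchain P A Ws \<and> diffs A Ws = ds}"
proof (rule finite_subset)
  show "{Ws. fchain P A Ws \<and> diffs A Ws = ds} \<subseteq> {Ws. set Ws \<subseteq> subreps Q N \<and> length Ws = length ds}"
    using fchain_subset by (auto simp flip: length_diffs)
qed (rule finite_lists_length_eq[OF finite_subreps[OF rep]])

text \<open>When every weight is the indicator of a dimension vector and a property \<open>P\<close>
  of the step, the weighted count is an honest one. \<open>P\<close> is \<open>lat.ss\<close> for
  the recursion and \<open>True\<close> for the resolution.\<close>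

lemma flag_sum_eq_card:
  fixes \<chi> :: "('v \<Rightarrow>\<^sub>0 int) \<Rightarrow> ('k, 'v, 'a) hall_algebra"
  assumes \<chi>: "\<And>d A W. A \<in> subreps Q N \<Longrightarrow> W \<in> subreps Q N \<Longrightarrow> A \<le> W \<Longrightarrow>
      Poly_Mapping.lookup (\<chi> d) (iso_class (sq Q N A W)) = of_bool (sdim W - sdim A = d \<and> P A W)"
    and "A \<in> subreps Q N"
  shows "flag_sum N (map \<chi> ds) A U = of_nat (card (flags P ds A U))"
  using assms(2)
proof (induction ds arbitrary: A)
  case Nil
  have "flags P [] A U = (if A = U then {[]} else {})"
    by (auto simp: flags_def elim: diffs.elims)
  then show ?case by simp
next
  case (Cons d ds)
  let ?I = "{W. W \<in> subreps Q N \<and> A \<le> W \<and> W \<le> U}"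
  let ?J = "{W \<in> ?I. sdim W - sdim A = d \<and> P A W}"
  have finI: "finite ?I" by (rule finite_subset[OF _ finite_subreps[OF rep]]) auto
  have fin: "finite (flags P ds W U)" for W
    by (rule finite_subset[OF _ finite_fchains[of P W ds]]) (auto simp: flags_def)
  have "flag_sum N (map \<chi> (d # ds)) A U = (\<Sum>W\<in>?I. of_bool (sdim W - sdim A = d \<and> P A W) * of_nat (card (flags P ds W U)))"
    unfolding list.map flag_sum.simps
    by (intro sum.cong refl) (use Cons \<chi> in auto)
  also have "\<dots> = (\<Sum>W\<in>?J. of_nat (card (flags P ds W U)))"
    using finI by (intro sum.mono_neutral_cong_right) auto
  also have "\<dots> = of_nat (card (SIGMA W:?J. flags P ds W U))"
    using finite_subset[OF _ finI, of ?J] fin by (subst card_SigmaI) auto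
  also have "card (SIGMA W:?J. flags P ds W U) = card ((\<lambda>(W, Ws). W # Ws) ` (SIGMA W:?J. flags P ds W U))"
    by (rule card_image[symmetric]) (auto simp: inj_on_def)
  also have "(\<lambda>(W, Ws). W # Ws) ` (SIGMA W:?J. flags P ds W U) = flags P (d # ds) A U"
  proof (intro equalityI subsetI)
    fix Vs assume "Vs \<in> flags P (d # ds) A U"
    then have Vs: "fchain P A Vs" "diffs A Vs = d # ds" "last (A # Vs) = U" by (auto simp: flags_def)
    then obtain W Ws where "Vs = W # Ws" by (cases Vs) auto
    then show "Vs \<in> (\<lambda>(W, Ws). W # Ws) ` (SIGMA W:?J. flags P ds W U)"
      using Vs fchain_last[of P W Ws] by (auto simp: flags_def image_iff)
  qed (auto simp: flags_def)
  finally show ?case .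
qed

text \<open>A chain in N determines its tuple of dimension vectors, so summing over tuples and then
  over chains with that tuple is summing over all chains whose tuple lies in \<open>T\<close>. The
  sign \<open>c\<close> and the properties \<open>P\<close>, \<open>R\<close> are parameters, to
  serve both identities.\<close>

lemma coefficient_sum:
  fixes \<chi> :: "('v \<Rightarrow>\<^sub>0 int) \<Rightarrow> ('k, 'v, 'a) hall_algebra" and \<psi> :: "('v \<Rightarrow>\<^sub>0 int) \<Rightarrow> ('k, 'v, 'a) hall_module"
    and c :: "('v \<Rightarrow>\<^sub>0 int) list \<Rightarrow> rat"
  assumes \<chi>: "\<And>d A W. A \<in> subreps Q N \<Longrightarrow> W \<in> subreps Q N \<Longrightarrow> A \<le> W \<Longrightarrow>
      Poly_Mapping.lookup (\<chi> d) (iso_class (sq Q N A W)) = of_bool (sdim W - sdim A = d \<and> P A W)"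
    and \<chi>k: "\<And>d. Poly_Mapping.keys (\<chi> d) \<subseteq> iso_classes Q"
    and \<psi>: "\<And>e U. U \<in> isotropic_subreps Q N \<Longrightarrow>
      Poly_Mapping.lookup (\<psi> e) (isom_class (reduction Q N U)) = of_bool (dimvec Q (reduction Q N U) = e \<and> R U)"
    and T: "finite T"
  shows "(\<Sum>(ds, e)\<in>T. c ds * (\<Sum>U\<in>isotropic_subreps Q N.
      Poly_Mapping.lookup (hall_prod Q (map \<chi> ds)) (iso_class (sub_rep N U)) *
      Poly_Mapping.lookup (\<psi> e) (isom_class (reduction Q N U)))) =
    (\<Sum>Ws | fchain P (zero_sub Q N) Ws \<and> last (zero_sub Q N # Ws) \<in> isotropic_subreps Q N \<and>
        R (last (zero_sub Q N # Ws)) \<and>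
        (diffs (zero_sub Q N) Ws, dimvec Q (reduction Q N (last (zero_sub Q N # Ws)))) \<in> T.
      c (diffs (zero_sub Q N) Ws))"
proof -
  let ?z = "zero_sub Q N"
  note z = zero_sub_subrep[OF rep]
  define l where "l Ws = last (?z # Ws)" for Ws
  define g where "g Ws = (diffs ?z Ws, dimvec Q (reduction Q N (l Ws)))" for Ws
  define F where "F = {Ws. fchain P ?z Ws \<and> l Ws \<in> isotropic_subreps Q N \<and> R (l Ws)}"
  note fi = finite_isotropic_subreps[OF self_dual]
  have fin: "finite {Ws \<in> F. g Ws = t}" for t
    by (rule finite_subset[OF _ finite_fchains[of P ?z "fst t"]]) (auto simp: F_def g_def)
  have "(\<Sum>U\<in>isotropic_subreps Q N.
      Poly_Mapping.lookup (hall_prod Q (map \<chi> ds)) (iso_class (sub_rep N U)) *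
      Poly_Mapping.lookup (\<psi> e) (isom_class (reduction Q N U))) = of_nat (card {Ws \<in> F. g Ws = (ds, e)})" for ds e
  proof -
    have "(\<Sum>U\<in>isotropic_subreps Q N.
        Poly_Mapping.lookup (hall_prod Q (map \<chi> ds)) (iso_class (sub_rep N U)) *
        Poly_Mapping.lookup (\<psi> e) (isom_class (reduction Q N U))) =
      (\<Sum>U\<in>isotropic_subreps Q N. of_nat (card {Ws \<in> {Ws \<in> F. g Ws = (ds, e)}. l Ws = U}))"
    proof (rule sum.cong[OF refl])
      fix U assume U: "U \<in> isotropic_subreps Q N"
      note UL = isotropic_subrepsD(1)[OF self_dual U]
      have "Poly_Mapping.lookup (hall_prod Q (map \<chi> ds)) (iso_class (sub_rep N U)) = flag_sum N (map \<chi> ds) ?z U"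
        by (rule lookup_hall_prod[OF _ rep subquo_sub[OF rep UL]]) (use \<chi>k in auto)
      also have "\<dots> = of_nat (card (flags P ds ?z U))"
        by (rule flag_sum_eq_card[OF \<chi> z])
      finally have "Poly_Mapping.lookup (hall_prod Q (map \<chi> ds)) (iso_class (sub_rep N U)) =
        of_nat (card (flags P ds ?z U))" .
      moreover have "{Ws \<in> {Ws \<in> F. g Ws = (ds, e)}. l Ws = U} =
          (if dimvec Q (reduction Q N U) = e \<and> R U then flags P ds ?z U else {})"
        using U by (auto simp: F_def g_def flags_def l_def)
      ultimately show "Poly_Mapping.lookup (hall_prod Q (map \<chi> ds)) (iso_class (sub_rep N U)) *
          Poly_Mapping.lookup (\<psi> e) (isom_class (reduction Q N U)) =
        of_nat (card {Ws \<in> {Ws \<in> F. g Ws = (ds, e)}. l Ws = U})"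
        using \<psi>[OF U, of e] by simp
    qed
    also have "\<dots> = of_nat (card {Ws \<in> F. g Ws = (ds, e)})"
    proof -
      have "l ` {Ws \<in> F. g Ws = (ds, e)} \<subseteq> isotropic_subreps Q N" by (auto simp: F_def)
      from sum.group[OF fin fi this, of "\<lambda>_. 1::nat"] show ?thesis
        by (simp flip: of_nat_sum)
    qed
    finally show ?thesis .
  qed
  then have "(\<Sum>(ds, e)\<in>T. c ds * (\<Sum>U\<in>isotropic_subreps Q N.
      Poly_Mapping.lookup (hall_prod Q (map \<chi> ds)) (iso_class (sub_rep N U)) *
      Poly_Mapping.lookup (\<psi> e) (isom_class (reduction Q N U)))) =
    (\<Sum>t\<in>T. c (fst t) * of_nat (card {Ws \<in> F. g Ws = t}))"
    by (simp add: case_prod_unfold)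
  also have "\<dots> = (\<Sum>t\<in>T. \<Sum>Ws\<in>{Ws \<in> {Ws \<in> F. g Ws \<in> T}. g Ws = t}. c (fst (g Ws)))"
  proof (rule sum.cong[OF refl])
    fix t assume "t \<in> T"
    then have "{Ws \<in> {Ws \<in> F. g Ws \<in> T}. g Ws = t} = {Ws \<in> F. g Ws = t}" by auto
    then show "c (fst t) * of_nat (card {Ws \<in> F. g Ws = t}) =
        (\<Sum>Ws\<in>{Ws \<in> {Ws \<in> F. g Ws \<in> T}. g Ws = t}. c (fst (g Ws)))"
      by (simp add: mult.commute)
  qed
  also have "\<dots> = (\<Sum>Ws\<in>{Ws \<in> F. g Ws \<in> T}. c (fst (g Ws)))"
  proof (rule sum.group[OF _ T])
    have "{Ws \<in> F. g Ws \<in> T} = (\<Union>t\<in>T. {Ws \<in> F. g Ws = t})" by auto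
    then show "finite {Ws \<in> F. g Ws \<in> T}" using T fin by simp
  qed auto
  also have "{Ws \<in> F. g Ws \<in> T} = {Ws. fchain P ?z Ws \<and> last (?z # Ws) \<in> isotropic_subreps Q N \<and>
      R (last (?z # Ws)) \<and> (diffs ?z Ws, dimvec Q (reduction Q N (last (?z # Ws)))) \<in> T}"
    by (auto simp: F_def g_def l_def)
  finally show ?thesis by (simp add: g_def)
qed

lemma diffs_hyperbolic:
  "sum_list (map (hyperbolic_dimvec Q) (diffs A Ws)) = hyperbolic_dimvec Q (sdim (last (A # Ws))) - hyperbolic_dimvec Q (sdim A)"
proof (induction Ws arbitrary: A)
  case (Cons W Ws)
  have "hyperbolic_dimvec Q (sdim W - sdim A) = hyperbolic_dimvec Q (sdim W) - hyperbolic_dimvec Q (sdim A)"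
    by (simp add: hyperbolic_dimvec_def dual_dimvec_def frag_extend_diff)
  then show ?case using Cons.IH[of W] by simp
qed (simp add: hyperbolic_dimvec_def)

lemma sdim_eq_iff:
  assumes "A \<in> subreps Q N" "W \<in> subreps Q N" "A \<le> W"
  shows "sdim W - sdim A = 0 \<longleftrightarrow> W = A"
proof
  assume "sdim W - sdim A = 0"
  then have "rank_sub W = rank_sub A" by (simp add: rank_sub_def)
  then show "W = A" using rank_strict[OF assms(1,2)] assms(3) order.not_eq_order_implies_strict by force
qed simp

lemma fchain_diffs_nonzero:
  assumes "fchain P A Ws" "A \<in> subreps Q N"
  shows "set (diffs A Ws) \<subseteq> dimvecs Q - {0} \<longleftrightarrow> fchain (\<lambda>A W. P A W \<and> A \<noteq> W) A Ws"
  using assms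
proof (induction Ws arbitrary: A)
  case (Cons W Ws)
  then have W: "W \<in> subreps Q N" "A \<le> W" "fchain P W Ws" by auto
  have "sdim W - sdim A \<in> dimvecs Q" using sdim_diff[OF Cons.prems(2) W(1,2)] dimvec_carrier by metis
  then show ?case
    using Cons.IH[OF W(3,1)] Cons.prems sdim_eq_iff[OF Cons.prems(2) W(1,2)] by auto
qed simp

text \<open>The hyperbolic dimension vectors telescope to that of the last term, so by
  \<open>dimvec_reduction\<close> the weight of a chain is always dim N. What is left of the tuple
  condition is that no step is trivial.\<close>

lemma weighted_iff:
  assumes "fchain P (zero_sub Q N) Ws" "last (zero_sub Q N # Ws) \<in> isotropic_subreps Q N"
  shows "(diffs (zero_sub Q N) Ws, dimvec Q (reduction Q N (last (zero_sub Q N # Ws)))) \<in> weighted_tuples Q d \<longleftrightarrow>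
    dimvec Q N = d \<and> fchain (\<lambda>A W. P A W \<and> A \<noteq> W) (zero_sub Q N) Ws"
proof -
  let ?U = "last (zero_sub Q N # Ws)"
  note r = reduction_map_reduction[OF self_dual assms(2)]
  have "dimvec Q (reduction Q N ?U) \<in> sd_dimvecs Q"
    using dual_dimvec_self_dual[OF reduction_map_self_dual[OF self_dual assms(2) r]]
      dimvec_carrier[of "reduction Q N ?U"]
    unfolding sd_dimvecs_def by blast
  moreover have "sum_list (map (hyperbolic_dimvec Q) (diffs (zero_sub Q N) Ws)) + dimvec Q (reduction Q N ?U) = dimvec Q N"
    using dimvec_reduction[OF self_dual isotropic_subrepsD(1)[OF self_dual assms(2)] r]
    by (simp add: diffs_hyperbolic dimvec_zero_sub[OF rep] hyperbolic_dimvec_def dual_dimvec_def)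
  ultimately show ?thesis
    unfolding weighted_tuples_def using fchain_diffs_nonzero[OF assms(1) zero_sub_subrep[OF rep]] by auto
qed

lemma slopes_diffs: "fchain P A Ws \<Longrightarrow> A \<in> subreps Q N \<Longrightarrow> map (slope Q \<theta>) (diffs A Ws) = lat.slopes A Ws"
  by (induction Ws arbitrary: A) (auto simp: mu_eq_slope)

text \<open>\<open>lat.HN\<close> asks every term to be isotropic, a flag only its last one; a
  subrepresentation of an isotropic one is isotropic.\<close>

lemma HN_iff:
  assumes "A \<in> subreps Q N"
  shows "lat.HN A Ws \<and> last (A # Ws) \<in> isotropic_subreps Q N \<longleftrightarrow>
    fchain (\<lambda>A W. lat.ss A W \<and> A \<noteq> W) A Ws \<and> last (A # Ws) \<in> isotropic_subreps Q N \<and>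
    lat.sd_ss (last (A # Ws)) \<and> sorted_wrt (>) (lat.slopes A Ws @ [0])"
  using assms
proof (induction Ws arbitrary: A)
  case (Cons W Ws)
  have "W \<in> isotropic_subreps Q N"
    if "last (W # Ws) \<in> isotropic_subreps Q N" "W \<in> subreps Q N" "fchain P W Ws" for P
    using lat.isotr_down[of "last (W # Ws)" W] fchain_last[OF that(3,2)] that unfolding isotr_eq by blast
  moreover have "W \<in> subreps Q N" if "W \<in> isotropic_subreps Q N"
    by (rule isotropic_subrepsD(1)[OF self_dual that])
  ultimately show ?case using Cons.IH[of W] unfolding lat.HN.simps isotr_eq by (auto simp: less_le)
qed auto

text \<open>Partial sums of the steps telescope, so the slope condition on the partial sums of a
  tuple becomes a condition on the terms of the chain. The index shift is that of \<open>nth\<close>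
  counting from 0.\<close>

lemma take_diffs:
  assumes "Suc j \<le> length Ws"
  shows "sum_list (take (Suc j) (diffs A Ws)) = sdim (Ws ! j) - sdim A"
  using assms
proof (induction Ws arbitrary: A j)
  case (Cons W Ws)
  show ?case
  proof (cases j)
    case (Suc i)
    then show ?thesis using Cons.IH[of i W] Cons.prems by simp
  qed simp
qed simp

text \<open>Ranks of nonzero subrepresentations are positive; for the zero one both sides are false,
  the slope being 0 / 0 = 0.\<close>

lemma slope_pos_iff:
  assumes "W \<in> subreps Q N"
  shows "0 < slope Q \<theta> (sdim W) \<longleftrightarrow> 0 < theta_sub W"
proof (cases "W = zero_sub Q N")
  case True
  then show ?thesis using lat.z(3) by (simp add: slope_def theta_sub_def)
next
  case False
  then have "zero_sub Q N < W" using lat.z(2)[OF assms] by simp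
  then show ?thesis
    using lat.mu_pos_iff[OF lat.z(1) assms] mu_eq_slope[OF lat.z(1) assms] lat.z(2)[OF assms] lat.z(3)
    by (simp add: dimvec_zero_sub[OF rep])
qed

lemma asc_iff_fchain:
  assumes "A \<in> subreps Q N"
  shows "fchain (\<lambda>A W. True \<and> A \<noteq> W) A Ws \<and> last (A # Ws) \<in> isotropic_subreps Q N \<longleftrightarrow>
    lat.asc A Ws \<and> last (A # Ws) \<in> isotropic_subreps Q N"
  using assms
proof (induction Ws arbitrary: A)
  case (Cons W Ws)
  have "W \<in> isotropic_subreps Q N"
    if "last (W # Ws) \<in> isotropic_subreps Q N" "W \<in> subreps Q N" "fchain P W Ws" for P
    using lat.isotr_down[of "last (W # Ws)" W] fchain_last[OF that(3,2)] that unfolding isotr_eq by blast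
  moreover have "W \<in> subreps Q N" if "W \<in> isotropic_subreps Q N"
    by (rule isotropic_subrepsD(1)[OF self_dual that])
  ultimately show ?case using Cons.IH[of W] unfolding lat.asc.simps isotr_eq by (auto simp: less_le)
qed simp

lemma asc_last: "lat.asc A Ws \<Longrightarrow> A \<in> isotropic_subreps Q N \<Longrightarrow> last (A # Ws) \<in> isotropic_subreps Q N"
  by (induction Ws arbitrary: A) (auto simp: isotr_eq)

end

section \<open>The Harder--Narasimhan recursion and its resolution\<close>

context duality_quiver
begin

definition total :: "('v \<Rightarrow>\<^sub>0 int) \<Rightarrow> int" where
  "total d = (\<Sum>i\<in>verts Q. Poly_Mapping.lookup d i)"

lemma dimvec_total_pos:
  assumes "x \<in> dimvecs Q" "x \<noteq> 0"
  shows "1 \<le> total x"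
proof -
  obtain i where "Poly_Mapping.lookup x i \<noteq> 0" using assms(2) by (metis poly_mapping_eqI lookup_zero)
  then have i: "i \<in> verts Q" "0 < Poly_Mapping.lookup x i"
    using assms(1) by (auto simp: dimvecs_def in_keys_iff order_less_le)
  have "Poly_Mapping.lookup x i \<le> total x"
    unfolding total_def by (rule member_le_sum[OF i(1)]) (use assms(1) finite_verts in \<open>auto simp: dimvecs_def\<close>)
  then show ?thesis using i(2) by simp
qed

lemma finite_dimvecs_below: "finite {x \<in> dimvecs Q. \<forall>i. Poly_Mapping.lookup x i \<le> Poly_Mapping.lookup d i}"
  (is "finite ?S")
proof -
  have "inj_on (\<lambda>x. restrict (Poly_Mapping.lookup x) (verts Q)) ?S"
  proof (rule inj_onI)
    fix x y assume x: "x \<in> ?S" and y: "y \<in> ?S"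
      and e: "restrict (Poly_Mapping.lookup x) (verts Q) = restrict (Poly_Mapping.lookup y) (verts Q)"
    show "x = y"
    proof (rule poly_mapping_eqI)
      fix i
      show "Poly_Mapping.lookup x i = Poly_Mapping.lookup y i"
      proof (cases "i \<in> verts Q")
        case True
        then show ?thesis using fun_cong[OF e, of i] by simp
      next
        case False
        then have "i \<notin> Poly_Mapping.keys x" "i \<notin> Poly_Mapping.keys y" using x y by (auto simp: dimvecs_def)
        then show ?thesis by (simp add: in_keys_iff)
      qed
    qed
  qed
  moreover have "(\<lambda>x. restrict (Poly_Mapping.lookup x) (verts Q)) ` ?S \<subseteq>
      (\<Pi>\<^sub>E i\<in>verts Q. {0..Poly_Mapping.lookup d i})"
    by (auto simp: dimvecs_def)
  moreover have "finite (\<Pi>\<^sub>E i\<in>verts Q. {0..Poly_Mapping.lookup d i})"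
    using finite_verts by (intro finite_PiE) auto
  ultimately show ?thesis using inj_on_finite by blast
qed

text \<open>Each nonzero entry adds at least 1 to the total, which bounds the length, and all
  summands are nonnegative, which bounds the entries. This makes the index sets finite; over an
  infinite one the sums would be 0 by convention.\<close>

lemma weighted_bounds:
  assumes "set ds \<subseteq> dimvecs Q - {0}" "e \<in> dimvecs Q"
  shows "int (length ds) \<le> total (sum_list (map (hyperbolic_dimvec Q) ds) + e) \<and>
    (\<forall>x\<in>insert e (set ds). \<forall>i. Poly_Mapping.lookup x i \<le>
      Poly_Mapping.lookup (sum_list (map (hyperbolic_dimvec Q) ds) + e) i)"
  using assms(1)
proof (induction ds)
  case Nil
  then show ?case using assms(2) by (auto simp: total_def dimvecs_def intro!: sum_nonneg)
next
  case (Cons x ds)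
  define r where "r = sum_list (map (hyperbolic_dimvec Q) ds) + e"
  have x: "x \<in> dimvecs Q" "x \<noteq> 0" using Cons.prems by auto
  have IH: "int (length ds) \<le> total r"
    "\<And>y i. y \<in> insert e (set ds) \<Longrightarrow> Poly_Mapping.lookup y i \<le> Poly_Mapping.lookup r i"
    using Cons by (auto simp: r_def)
  have s: "sum_list (map (hyperbolic_dimvec Q) (x # ds)) + e = x + dual_dimvec Q x + r"
    by (simp add: r_def hyperbolic_dimvec_def add_ac)
  have nn: "0 \<le> Poly_Mapping.lookup x i" "0 \<le> Poly_Mapping.lookup (dual_dimvec Q x) i"
    "0 \<le> Poly_Mapping.lookup e i" for i
    using x(1) assms(2) by (auto simp: lookup_dual_dimvec dimvecs_def)
  have r: "0 \<le> Poly_Mapping.lookup r i" for i using IH(2)[of e i] nn(3)[of i] by simp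
  have "0 \<le> total (dual_dimvec Q x)" using nn by (auto simp: total_def intro: sum_nonneg)
  then have "int (length (x # ds)) \<le> total (x + dual_dimvec Q x + r)"
    using IH(1) dimvec_total_pos[OF x] by (simp add: total_def lookup_add sum.distrib)
  moreover have "Poly_Mapping.lookup y i \<le> Poly_Mapping.lookup (x + dual_dimvec Q x + r) i"
    if "y \<in> insert e (set (x # ds))" for y i
  proof (cases "y = x")
    case True
    then show ?thesis using nn[of i] r[of i] by (simp add: lookup_add)
  next
    case False
    then have "y \<in> insert e (set ds)" using that by auto
    from IH(2)[OF this, of i] show ?thesis using nn[of i] by (simp add: lookup_add)
  qed
  ultimately show ?case unfolding s by blast
qed

lemma finite_weighted_tuples: "finite (weighted_tuples Q d)"
proof (rule finite_subset)
  let ?S = "{x \<in> dimvecs Q. \<forall>i. Poly_Mapping.lookup x i \<le> Poly_Mapping.lookup d i}"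
  show "weighted_tuples Q d \<subseteq> {ds. set ds \<subseteq> ?S \<and> length ds \<le> nat (total d)} \<times> ?S"
  proof
    fix t assume "t \<in> weighted_tuples Q d"
    then obtain ds e where t: "t = (ds, e)" "set ds \<subseteq> dimvecs Q - {0}" "e \<in> sd_dimvecs Q"
      "sum_list (map (hyperbolic_dimvec Q) ds) + e = d"
      by (auto simp: weighted_tuples_def)
    have e: "e \<in> dimvecs Q" using t(3) by (simp add: sd_dimvecs_def)
    show "t \<in> {ds. set ds \<subseteq> ?S \<and> length ds \<le> nat (total d)} \<times> ?S"
      using weighted_bounds[OF t(2) e] t e by auto
  qed
  show "finite ({ds. set ds \<subseteq> ?S \<and> length ds \<le> nat (total d)} \<times> ?S)"
    using finite_lists_length_le[OF finite_dimvecs_below] finite_dimvecs_below by (rule finite_cartesian_product)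
qed

end

context stable_self_dual
begin

text \<open>The coefficient of the recursion at N: \<open>coefficient_sum\<close> turns it into the
  number of Harder-Narasimhan chains starting at 0, which is 1 by
  \<open>lat.card_HN\<close>.\<close>

lemma HN_tuples_sum:
  "(\<Sum>(ds, e)\<in>HN_tuples Q \<theta> d. \<Sum>U\<in>isotropic_subreps Q N.
      Poly_Mapping.lookup (hall_prod Q (map (char_ss Q \<theta>) ds)) (iso_class (sub_rep N U)) *
      Poly_Mapping.lookup (char_sd_ss Q \<theta> e) (isom_class (reduction Q N U))) = of_bool (dimvec Q N = d)"
proof -
  let ?z = "zero_sub Q N"
  have T: "finite (HN_tuples Q \<theta> d)"
    by (rule finite_subset[OF _ finite_weighted_tuples[of d]]) (auto simp: HN_tuples_def)
  have \<chi>: "Poly_Mapping.lookup (char_ss Q \<theta> d) (iso_class (sq Q N A W)) =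
      of_bool (sdim W - sdim A = d \<and> lat.ss A W)"
    if "A \<in> subreps Q N" "W \<in> subreps Q N" "A \<le> W" for d A W
    using lookup_char_ss[OF subquo_rep[OF rep subquo_sq[OF rep that]]] sdim_diff[OF that] ss_iff[OF that] by simp
  have \<psi>: "Poly_Mapping.lookup (char_sd_ss Q \<theta> e) (isom_class (reduction Q N U)) =
      of_bool (dimvec Q (reduction Q N U) = e \<and> lat.sd_ss U)"
    if "U \<in> isotropic_subreps Q N" for e U
    using lookup_char_sd_ss[OF reduction_map_self_dual[OF self_dual that reduction_map_reduction[OF self_dual that]]]
      sd_ss_iff[OF that] by simp
  have "{Ws. fchain lat.ss ?z Ws \<and> last (?z # Ws) \<in> isotropic_subreps Q N \<and> lat.sd_ss (last (?z # Ws)) \<and>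
      (diffs ?z Ws, dimvec Q (reduction Q N (last (?z # Ws)))) \<in> HN_tuples Q \<theta> d} =
    (if dimvec Q N = d then {Ws. lat.HN ?z Ws} else {})" (is "?W = _")
  proof -
    have "?W = {Ws. dimvec Q N = d \<and> fchain (\<lambda>A W. lat.ss A W \<and> A \<noteq> W) ?z Ws \<and>
        last (?z # Ws) \<in> isotropic_subreps Q N \<and> lat.sd_ss (last (?z # Ws)) \<and>
        sorted_wrt (>) (lat.slopes ?z Ws @ [0])}"
    proof (rule Collect_cong)
      fix Ws
      have mono: "fchain lat.ss ?z Ws" if "fchain (\<lambda>A W. lat.ss A W \<and> A \<noteq> W) ?z Ws"
        using that fchain_mono[of _ ?z Ws lat.ss] by blast
      show "fchain lat.ss ?z Ws \<and> last (?z # Ws) \<in> isotropic_subreps Q N \<and> lat.sd_ss (last (?z # Ws)) \<and>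
          (diffs ?z Ws, dimvec Q (reduction Q N (last (?z # Ws)))) \<in> HN_tuples Q \<theta> d \<longleftrightarrow>
        dimvec Q N = d \<and> fchain (\<lambda>A W. lat.ss A W \<and> A \<noteq> W) ?z Ws \<and>
        last (?z # Ws) \<in> isotropic_subreps Q N \<and> lat.sd_ss (last (?z # Ws)) \<and>
        sorted_wrt (>) (lat.slopes ?z Ws @ [0])"
        using weighted_iff[of lat.ss Ws d] slopes_diffs[OF _ lat.z(1), of lat.ss Ws] mono
        unfolding HN_tuples_def by auto
    qed
    also have "\<dots> = (if dimvec Q N = d then {Ws. lat.HN ?z Ws \<and> last (?z # Ws) \<in> isotropic_subreps Q N} else {})"
      using HN_iff[OF lat.z(1)] by auto
    also have "{Ws. lat.HN ?z Ws \<and> last (?z # Ws) \<in> isotropic_subreps Q N} = {Ws. lat.HN ?z Ws}"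
      using lat.HN_last zero_isotropic[OF self_dual] unfolding isotr_eq by blast
    finally show ?thesis .
  qed
  then show ?thesis
    using coefficient_sum[OF \<chi> keys_char(2) \<psi> T, of "\<lambda>_. 1"] lat.card_HN[of ?z] zero_isotropic[OF self_dual]
    by (simp add: isotr_eq)
qed

text \<open>The coefficient of the resolution at N: the chains that remain are exactly those of
  \<open>lat.asc_destab_sum\<close>, taken from 0.\<close>

lemma resolution_tuples_sum:
  "(\<Sum>(ds, e)\<in>resolution_tuples Q \<theta> d. (-1) ^ length ds * (\<Sum>U\<in>isotropic_subreps Q N.
      Poly_Mapping.lookup (hall_prod Q (map (char_all Q) ds)) (iso_class (sub_rep N U)) *
      Poly_Mapping.lookup (char_sd_all Q e) (isom_class (reduction Q N U)))) =
    of_bool (dimvec Q N = d \<and> sd_semistable Q \<theta> N)"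
proof -
  let ?z = "zero_sub Q N"
  have T: "finite (resolution_tuples Q \<theta> d)"
    by (rule finite_subset[OF _ finite_weighted_tuples[of d]]) (auto simp: resolution_tuples_def)
  have \<chi>: "Poly_Mapping.lookup (char_all Q d) (iso_class (sq Q N A W)) = of_bool (sdim W - sdim A = d \<and> True)"
    if "A \<in> subreps Q N" "W \<in> subreps Q N" "A \<le> W" for d A W
    using lookup_char_all[OF subquo_rep[OF rep subquo_sq[OF rep that]]] sdim_diff[OF that] by simp
  have \<psi>: "Poly_Mapping.lookup (char_sd_all Q e) (isom_class (reduction Q N U)) =
      of_bool (dimvec Q (reduction Q N U) = e \<and> True)"
    if "U \<in> isotropic_subreps Q N" for e U
    using lookup_char_sd_all[OF reduction_map_self_dual[OF self_dual that reduction_map_reduction[OF self_dual that]]]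
    by simp
  have "{Ws. fchain (\<lambda>_ _. True) ?z Ws \<and> last (?z # Ws) \<in> isotropic_subreps Q N \<and> True \<and>
      (diffs ?z Ws, dimvec Q (reduction Q N (last (?z # Ws)))) \<in> resolution_tuples Q \<theta> d} =
    (if dimvec Q N = d then {Ws. lat.asc ?z Ws \<and> (\<forall>W\<in>set Ws. 0 < theta_sub W)} else {})" (is "?W = _")
  proof -
    have "?W = {Ws. dimvec Q N = d \<and> fchain (\<lambda>A W. True \<and> A \<noteq> W) ?z Ws \<and>
        last (?z # Ws) \<in> isotropic_subreps Q N \<and> (\<forall>W\<in>set Ws. 0 < theta_sub W)}"
    proof (rule Collect_cong)
      fix Ws
      have mono: "fchain (\<lambda>_ _. True) ?z Ws" if "fchain (\<lambda>A W. True \<and> A \<noteq> W) ?z Ws"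
        using that fchain_mono[of _ ?z Ws "\<lambda>_ _. True"] by blast
      have pos: "(\<forall>j\<in>{1..length Ws}. 0 < slope Q \<theta> (sum_list (take j (diffs ?z Ws)))) \<longleftrightarrow>
          (\<forall>W\<in>set Ws. 0 < theta_sub W)"
        if "fchain (\<lambda>_ _. True) ?z Ws"
      proof -
        have "(\<forall>j\<in>{1..length Ws}. 0 < slope Q \<theta> (sum_list (take j (diffs ?z Ws)))) \<longleftrightarrow>
            (\<forall>j<length Ws. 0 < slope Q \<theta> (sum_list (take (Suc j) (diffs ?z Ws))))"
        proof (intro iffI allI ballI impI)
          fix j assume a: "\<forall>j<length Ws. 0 < slope Q \<theta> (sum_list (take (Suc j) (diffs ?z Ws)))"
            and j: "j \<in> {1..length Ws}"
          obtain i where "j = Suc i" using j by (cases j) auto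
          then show "0 < slope Q \<theta> (sum_list (take j (diffs ?z Ws)))" using a j by simp
        qed simp
        also have "\<dots> \<longleftrightarrow> (\<forall>j<length Ws. 0 < theta_sub (Ws ! j))"
        proof (intro all_cong)
          fix j assume j: "j < length Ws"
          then have "Ws ! j \<in> subreps Q N" using fchain_subset[OF that] by auto
          then show "0 < slope Q \<theta> (sum_list (take (Suc j) (diffs ?z Ws))) \<longleftrightarrow> 0 < theta_sub (Ws ! j)"
            using take_diffs[of j Ws ?z] j slope_pos_iff by (simp add: dimvec_zero_sub[OF rep])
        qed
        finally show ?thesis by (simp add: all_set_conv_all_nth)
      qed
      \<comment> \<open>For an empty chain the condition on j is vacuous, so the separate
        alternative ([], d) is absorbed.\<close>
      have "(diffs ?z Ws, dimvec Q (reduction Q N (last (?z # Ws)))) \<in> resolution_tuples Q \<theta> d \<longleftrightarrow>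
          (diffs ?z Ws, dimvec Q (reduction Q N (last (?z # Ws)))) \<in> weighted_tuples Q d \<and>
          (\<forall>j\<in>{1..length Ws}. 0 < slope Q \<theta> (sum_list (take j (diffs ?z Ws))))"
        unfolding resolution_tuples_def by (cases Ws) auto
      then show "fchain (\<lambda>_ _. True) ?z Ws \<and> last (?z # Ws) \<in> isotropic_subreps Q N \<and> True \<and>
          (diffs ?z Ws, dimvec Q (reduction Q N (last (?z # Ws)))) \<in> resolution_tuples Q \<theta> d \<longleftrightarrow>
        dimvec Q N = d \<and> fchain (\<lambda>A W. True \<and> A \<noteq> W) ?z Ws \<and>
        last (?z # Ws) \<in> isotropic_subreps Q N \<and> (\<forall>W\<in>set Ws. 0 < theta_sub W)"
        using weighted_iff[of "\<lambda>_ _. True" Ws d] pos mono by blast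
    qed
    also have "\<dots> = (if dimvec Q N = d then {Ws. lat.asc ?z Ws \<and> (\<forall>W\<in>set Ws. 0 < theta_sub W)} else {})"
    proof (cases "dimvec Q N = d")
      case True
      then show ?thesis
        using asc_iff_fchain[OF lat.z(1)] asc_last[OF _ zero_isotropic[OF self_dual]]
        unfolding if_P[OF True] by blast
    qed simp
    finally show ?thesis .
  qed
  moreover have "lat.sd_ss ?z \<longleftrightarrow> sd_semistable Q \<theta> N"
    unfolding sd_ss_iff[OF zero_isotropic[OF self_dual], symmetric]
      sd_semistable_iff[OF self_dual zero_isotropic[OF self_dual] reduction_map_refl[OF self_dual]]
      sd_semistable_iff[OF self_dual zero_isotropic[OF self_dual]
        reduction_map_reduction[OF self_dual zero_isotropic[OF self_dual]]] ..
  moreover have "(\<Sum>Ws | lat.asc ?z Ws \<and> (\<forall>W\<in>set Ws. 0 < theta_sub W). (-1 :: rat) ^ length Ws) =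
      of_bool (lat.sd_ss ?z)"
    using arg_cong[OF lat.asc_destab_sum, of "of_int :: int \<Rightarrow> rat"] by simp
  ultimately show ?thesis
    using coefficient_sum[OF \<chi> keys_char(1) \<psi> T, of "\<lambda>ds. (-1) ^ length ds"] by (simp cong: conj_cong)
qed

end

lemma lookup_hall_module_scale:
  "Poly_Mapping.lookup (hall_module_scale c m) C = c * Poly_Mapping.lookup m C"
  by (simp add: hall_module_scale_def map.rep_eq when_def)

theorem theorem3p3:
  fixes Q :: "('v, 'a) dquiver" and \<theta> :: "('v \<Rightarrow>\<^sub>0 int) \<Rightarrow> int"
  assumes "odd CHAR('k::{field, finite})"
    and "quiver_with_involution Q"
    and "duality_structure Q"
    and "compatible_stability Q \<theta>"
  shows
    "(\<forall>d\<in>sd_dimvecs Q.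
        (char_sd_all Q d :: ('k, 'v, 'a) hall_module) =
        (\<Sum>(ds, e)\<in>HN_tuples Q \<theta> d.
           hall_act Q (hall_prod Q (map (char_ss Q \<theta>) ds)) (char_sd_ss Q \<theta> e))) \<and>
     (\<forall>d\<in>sd_dimvecs Q.
        (char_sd_ss Q \<theta> d :: ('k, 'v, 'a) hall_module) =
        (\<Sum>(ds, e)\<in>resolution_tuples Q \<theta> d.
           hall_module_scale ((-1) ^ length ds)
             (hall_act Q (hall_prod Q (map (char_all Q) ds)) (char_sd_all Q e))))"
proof -
  interpret duality_quiver Q using assms(2,3) by unfold_locales
  have k: "Poly_Mapping.keys (hall_prod Q (map (char_ss Q \<theta>) ds) :: ('k, 'v, 'a) hall_algebra) \<subseteq> iso_classes Q"
    "Poly_Mapping.keys (hall_prod Q (map (char_all Q) ds) :: ('k, 'v, 'a) hall_algebra) \<subseteq> iso_classes Q" for ds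
    by (rule keys_hall_prod, simp add: keys_char)+
  note act = lookup_hall_act[OF k(1) keys_char_sd(2)] lookup_hall_act[OF k(2) keys_char_sd(1)]
  show ?thesis
  \<comment> \<open>Coefficients are compared at one isometry class at a time, with N its chosen
    representative; outside the isometry classes both sides are 0.\<close>
  proof (intro conjI ballI poly_mapping_eqI)
    fix d and C :: "('k, 'v, 'a) sd_class"
    show "Poly_Mapping.lookup (char_sd_all Q d) C = Poly_Mapping.lookup (\<Sum>(ds, e)\<in>HN_tuples Q \<theta> d.
        hall_act Q (hall_prod Q (map (char_ss Q \<theta>) ds)) (char_sd_ss Q \<theta> e)) C"
    proof (cases "C \<in> isometry_classes Q")
      case True
      note CD = isometry_classesD[OF True]
      interpret stable_self_dual Q \<theta> "class_repr C"
        by unfold_locales (use assms(4) CD(2) in auto)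
      show ?thesis
        using HN_tuples_sum[of d] lookup_char_sd_all[OF CD(2), of d] CD(3) True
        by (simp add: lookup_sum case_prod_unfold act)
    next
      case False
      then show ?thesis
        using keys_char_sd(1)[of d, where 'k = 'k]
        by (auto simp: lookup_sum case_prod_unfold act in_keys_iff subset_eq)
    qed
    show "Poly_Mapping.lookup (char_sd_ss Q \<theta> d) C = Poly_Mapping.lookup (\<Sum>(ds, e)\<in>resolution_tuples Q \<theta> d.
        hall_module_scale ((-1) ^ length ds) (hall_act Q (hall_prod Q (map (char_all Q) ds)) (char_sd_all Q e))) C"
    proof (cases "C \<in> isometry_classes Q")
      case True
      note CD = isometry_classesD[OF True]
      interpret stable_self_dual Q \<theta> "class_repr C"
        by unfold_locales (use assms(4) CD(2) in auto)
      show ?thesis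
        using resolution_tuples_sum[of d] lookup_char_sd_ss[OF CD(2), of \<theta> d] CD(3) True
        by (simp add: lookup_sum case_prod_unfold act lookup_hall_module_scale)
    next
      case False
      then show ?thesis
        using keys_char_sd(2)[of \<theta> d, where 'k = 'k]
        by (auto simp: lookup_sum case_prod_unfold act lookup_hall_module_scale in_keys_iff subset_eq)
    qed
  qed
qed

end
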